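(* Let $k$ be a fixed integer. For the directed complete graph on $n$ vertices with i.i.d. exponential mean-$1$ arc weights, if $k\ge 2$ then $$\lim_{n\to\infty}\mathbb P[\text{the min mean-weight cycle has length }k]=\lim_{n\to\infty}\mathbb P\Big[\text{the min mean-weight cycle has length }k\text{ and weight}\le \frac{k}{en}\Big]=\int_0^{1/e}\frac{c^{k-1}k^k}{k!}\,e^{-T(c)+c}\,dc.$$ For the undirected complete graph on $n$ vertices with i.i.d. exponential mean-$1$ edge weights, if $k\ge3$ then $$\lim_{n\to\infty}\mathbb P[\text{the min mean-weight cycle has length }k]=\lim_{n\to\infty}\mathbb P\Big[\text{the min mean-weight cycle has length }k\text{ and weight}\le \frac{k}{en}\Big]=\int_0^{1/e}\frac{c^{k-1}k^k}{2\,k!}\,e^{(-T(c)+c+c^2)/2}\,dc.$$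
   Context: The directed complete graph on $n$ vertices has one arc for each ordered pair of distinct vertices; its cycles are simple directed cycles, of length at least $2$. The undirected complete graph has one edge for each unordered pair of distinct vertices; its cycles are simple cycles, of length at least $3$. Edge (arc) weights are i.i.d. exponential with mean $1$. The weight of a cycle is the sum of its edge weights, its length is its number of edges, and its mean weight is weight divided by length. The min mean-weight cycle is the cycle of smallest mean weight (almost surely unique). The tree function is $T(z)=\sum_{k=1}^\infty k^{k-1}\frac{z^k}{k!}$, convergent for $|z|\le 1/e$. *)

theory Defs
  imports "HOL-Probability.Probability" "Graph_Theory.Graph_Theory"
begin

text \<open>
  The complete digraph on the vertices \<open>0, \<dots>, n - 1\<close>. Following Graph_Theory, it is also used, as a
  bidirected graph, to represent the undirected complete graph: the undirected edge joining
  \<open>u\<close> and \<open>v\<close> is the set \<open>{u, v}\<close>.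
\<close>

definition Kn :: "nat \<Rightarrow> nat pair_pre_digraph" where
  "Kn n = \<lparr>pverts = {..<n}, parcs = {(u, v). u < n \<and> v < n \<and> u \<noteq> v}\<rparr>"

lemma complete_digraph_Kn: "complete_digraph n (with_proj (Kn n))"
  by (auto simp: complete_digraph_pair_def Kn_def)

definition uedge :: "nat \<times> nat \<Rightarrow> nat set" where
  "uedge a = {fst a, snd a}"

definition Kn_edges :: "nat \<Rightarrow> nat set set" where
  "Kn_edges n = {e. e \<subseteq> {..<n} \<and> card e = 2}"

lemma uedge_arcs_Kn: "uedge ` parcs (Kn n) = Kn_edges n"
proof
  show "uedge ` parcs (Kn n) \<subseteq> Kn_edges n"
    by (auto simp: uedge_def Kn_edges_def Kn_def)
  show "Kn_edges n \<subseteq> uedge ` parcs (Kn n)"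
  proof
    fix e assume "e \<in> Kn_edges n"
    then obtain u v where "e = {u, v}" "u \<noteq> v" "u < n" "v < n"
      by (auto simp: Kn_edges_def card_2_iff)
    then have "e = uedge (u, v)" "(u, v) \<in> parcs (Kn n)"
      by (auto simp: uedge_def Kn_def)
    then show "e \<in> uedge ` parcs (Kn n)" by blast
  qed
qed

text \<open>
  The library's \<^const>\<open>pre_digraph.cycle\<close> is a closed walk (a list of arcs) with a chosen starting
  point. A cycle as a subgraph is identified with its set of arcs, or edges, so that rotations,
  and in the undirected case the two orientations, are not told apart. In the undirected case the
  bound on the length excludes the closed walks \<open>u, v, u\<close>, which are directed cycles only.
\<close>

definition directed_cycles :: "nat \<Rightarrow> (nat \<times> nat) set set" where
  "directed_cycles n = {set p |p. pre_digraph.cycle (with_proj (Kn n)) p}"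

definition undirected_cycles :: "nat \<Rightarrow> nat set set set" where
  "undirected_cycles n =
     {uedge ` set p |p. pre_digraph.cycle (with_proj (Kn n)) p \<and> 3 \<le> length p}"

text \<open>The length of a cycle is its number of arcs (edges), i.e. its cardinality.\<close>

definition weight :: "('e \<Rightarrow> real) \<Rightarrow> 'e set \<Rightarrow> real" where
  "weight w C = (\<Sum>e\<in>C. w e)"

definition mean_weight :: "('e \<Rightarrow> real) \<Rightarrow> 'e set \<Rightarrow> real" where
  "mean_weight w C = weight w C / real (card C)"

text \<open>
  \<open>C\<close> is \<^emph>\<open>the\<close> cycle of smallest mean weight among those in \<open>\<C>\<close>; when the minimum is attained
  more than once (an event of probability zero below), there is no such \<open>C\<close>.
\<close>

definition is_min_mean_cycle :: "('e \<Rightarrow> real) \<Rightarrow> 'e set set \<Rightarrow> 'e set \<Rightarrow> bool" where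
  "is_min_mean_cycle w \<C> C \<longleftrightarrow>
     C \<in> \<C> \<and> (\<forall>C'\<in>\<C>. C' \<noteq> C \<longrightarrow> mean_weight w C < mean_weight w C')"

definition iid_exponential :: "'a measure \<Rightarrow> 'e set \<Rightarrow> ('e \<Rightarrow> 'a \<Rightarrow> real) \<Rightarrow> bool" where
  "iid_exponential M E W \<longleftrightarrow>
     prob_space M \<and>
     prob_space.indep_vars M (\<lambda>_. borel) W E \<and>
     (\<forall>e\<in>E. distributed M lborel (W e) (exponential_density 1))"

definition tree_function :: "real \<Rightarrow> real" where
  "tree_function z = (\<Sum>k. real (Suc k) ^ k * z ^ Suc k / fact (Suc k))"

end

theory Submission
  imports Defs "HOL-Real_Asymp.Real_Asymp"
begin

text \<open>
  Call a cycle \<open>c\<close>-cheap if its mean weight is at most \<open>c / n\<close>. For each fixed length \<open>j\<close> the number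
  of \<open>c\<close>-cheap cycles is asymptotically Poisson with mean \<open>\<lambda>\<^sub>j(c) = (jc)\<^sup>j / (\<mu> j j!)\<close>, jointly in
  \<open>j \<le> K\<close> (\<open>\<mu> = 1\<close> for arcs, \<open>\<mu> = 2\<close> for edges), because two distinct cycles that meet have more edges than vertices in their union.
  It is enough to know this for void probabilities: the probability that the minimum lies in
  \<open>(c, c + dc]\<close> and is attained at length \<open>k\<close> is a difference of two of them, and summing over a
  partition of \<open>[0, 1/e]\<close> gives a Riemann--Stieltjes sum for the integral of
  \<open>\<lambda>\<^sub>k'(c) exp (- \<Sum>\<^sub>j \<lambda>\<^sub>j(c))\<close>.

  The value \<open>1/e\<close> is where \<open>\<Sum>\<^sub>j \<lambda>\<^sub>j\<close> stops converging. Since it still converges at \<open>1/e\<close>, cheap cycles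
  longer than \<open>K\<close> are unlikely uniformly in \<open>n\<close>; since it diverges beyond, some cycle of bounded
  length has mean weight at most \<open>(1 + \<epsilon>) / (en)\<close> with probability near \<open>1\<close>, so that a minimum
  above \<open>1/(en)\<close> is hardly ever attained at length \<open>k\<close>.
\<close>

section \<open>Poisson approximation of void probabilities\<close>

text \<open>Poisson limits are available only for lengths up to a fixed K, whereas the minimum is
  taken over all lengths. The two bounds escape this differently. For the upper bound, a minimal
  cycle of length k \<le> K is in particular minimal among the short ones, so long cycles can be
  ignored. For the lower bound, a long cycle might undercut the short ones; a first-moment estimate
  makes this unlikely, but only below 1/(en), which is why the lower bound is proved for the event
  with the weight restriction. That event is contained in the other, so the two bounds give both
  limits at once. To isolate length k, void events carry a separate threshold for every length.
  Moving the threshold of length k alone gives a window whose limiting probability is a product H(c)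
  (G(c) - G(c')), with H coming from the other lengths; hence the Stieltjes form. The overlap error
  is O(1/n): a union of s + 1 edges on at most s vertices can be placed in O(n^s) ways and is cheap
  with probability O(n^-(s+1)).\<close>

lemma (in prob_space) expectation_finite_range:
  fixes f :: "nat \<Rightarrow> real"
  assumes X: "X \<in> measurable M (count_space UNIV)" and le: "\<And>\<omega>. \<omega> \<in> space M \<Longrightarrow> X \<omega> \<le> N"
  shows "expectation (\<lambda>\<omega>. f (X \<omega>)) = (\<Sum>m\<le>N. f m * prob {\<omega> \<in> space M. X \<omega> = m})"
proof -
  have [measurable]: "{\<omega> \<in> space M. X \<omega> = m} \<in> events" for m
    using X by measurable
  have "expectation (\<lambda>\<omega>. f (X \<omega>)) =
    expectation (\<lambda>\<omega>. \<Sum>m\<le>N. f m * indicator {\<omega> \<in> space M. X \<omega> = m} \<omega>)"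
  proof (rule Bochner_Integration.integral_cong[OF refl])
    fix \<omega> assume "\<omega> \<in> space M"
    then have "(\<Sum>m\<le>N. f m * indicator {\<omega> \<in> space M. X \<omega> = m} \<omega>) = (\<Sum>m\<le>N. if m = X \<omega> then f m else 0)"
      by (intro sum.cong) (auto simp: indicator_def)
    then show "f (X \<omega>) = (\<Sum>m\<le>N. f m * indicator {\<omega> \<in> space M. X \<omega> = m} \<omega>)"
      using le[OF \<open>\<omega> \<in> space M\<close>] by simp
  qed
  also have "\<dots> = (\<Sum>m\<le>N. f m * prob {\<omega> \<in> space M. X \<omega> = m})"
    by (subst Bochner_Integration.integral_sum)
       (auto simp: Int_def less_top[symmetric] intro!: sum.cong arg_cong[where f=prob] Bochner_Integration.integrable_mult_right integrable_real_indicator)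
  finally show ?thesis .
qed

lemma abs_power_diff_le:
  fixes s :: real
  assumes "0 \<le> s" "s \<le> 1" "a \<le> b"
  shows "\<bar>s ^ b - s ^ a\<bar> \<le> real (b - a)"
proof (cases "b = a")
  case False
  have "s ^ b \<le> s ^ a" using assms by (simp add: power_decreasing)
  moreover have "0 \<le> s ^ b" "s ^ a \<le> 1" using assms by (auto simp: power_le_one)
  ultimately show ?thesis using False assms by linarith
qed simp

text \<open>The integrating factor \<open>exp (- l * s)\<close> turns the approximate equation into
  a bound for the derivative of \<open>h\<close>. The factor is at most 1 on [0, 1], so the mean
  value theorem keeps the constant \<open>b\<close>.\<close>

lemma exp_gronwall_01:
  fixes g :: "real \<Rightarrow> real"
  assumes der: "\<And>s. 0 \<le> s \<Longrightarrow> s \<le> 1 \<Longrightarrow> (g has_real_derivative g' s) (at s)"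
    and bd: "\<And>s. 0 \<le> s \<Longrightarrow> s \<le> 1 \<Longrightarrow> \<bar>g' s - l * g s\<bar> \<le> b" and l: "0 \<le> l" and g1: "g 1 = 1"
  shows "\<bar>g 0 - exp (- l)\<bar> \<le> b"
proof -
  define h where "h s = exp (- l * s) * g s" for s
  have "\<exists>z. 0 < z \<and> z < 1 \<and> h 1 - h 0 = (1 - 0) * (exp (- l * z) * (g' z - l * g z))"
    by (rule MVT2) (auto simp: h_def algebra_simps intro!: derivative_eq_intros der)
  then obtain z where z: "0 < z" "z < 1" "h 1 - h 0 = exp (- l * z) * (g' z - l * g z)" by auto
  have "\<bar>h 1 - h 0\<bar> \<le> 1 * b" unfolding z(3) abs_mult
    using z l by (intro mult_mono bd) auto
  then show ?thesis by (simp add: h_def g1 abs_minus_commute)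
qed

text \<open>
  The generating function \<open>g s = E s\<^sup>W\<close> of the number \<open>W\<close> of events that occur
  nearly solves \<open>g' = \<lambda> g\<close>, \<open>g 1 = 1\<close>, and the probability sought is \<open>g 0\<close>.
\<close>

lemma (in prob_space) poisson_void:
  fixes A :: "'i set" and B :: "'i \<Rightarrow> 'a set" and D :: "'i \<Rightarrow> 'i set"
  assumes fin: "finite A" and B[measurable]: "\<And>a. a \<in> A \<Longrightarrow> B a \<in> events"
    and D: "\<And>a. a \<in> A \<Longrightarrow> D a \<subseteq> A" "\<And>a. a \<in> A \<Longrightarrow> a \<in> D a"
    and indep: "\<And>a s::real. a \<in> A \<Longrightarrow> 0 \<le> s \<Longrightarrow> s \<le> 1 \<Longrightarrow>
      expectation (\<lambda>\<omega>. indicator (B a) \<omega> * s ^ card {b \<in> A - D a. \<omega> \<in> B b}) =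
      prob (B a) * expectation (\<lambda>\<omega>. s ^ card {b \<in> A - D a. \<omega> \<in> B b})"
  shows "\<bar>prob {\<omega> \<in> space M. \<forall>a\<in>A. \<omega> \<notin> B a} - exp (- (\<Sum>a\<in>A. prob (B a)))\<bar>
     \<le> (\<Sum>a\<in>A. \<Sum>b\<in>D a. prob (B a) * prob (B b)) + (\<Sum>a\<in>A. \<Sum>b\<in>D a - {a}. prob (B a \<inter> B b))"
proof -
  define W where "W \<omega> = card {b \<in> A. \<omega> \<in> B b}" for \<omega>
  define V where "V a \<omega> = card {b \<in> A - D a. \<omega> \<in> B b}" for a \<omega>
  define l where "l = (\<Sum>a\<in>A. prob (B a))"
  define b1 where "b1 a = (\<Sum>b\<in>D a. prob (B a) * prob (B b))" for a
  define b2 where "b2 a = (\<Sum>b\<in>D a - {a}. prob (B a \<inter> B b))" for a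
  have Wsum: "real (W \<omega>) = (\<Sum>a\<in>A. indicator (B a) \<omega>)" for \<omega>
    using fin by (simp add: W_def sum_of_bool_eq indicator_def Int_def)
  have finD: "finite (D a)" if "a \<in> A" for a using D(1)[OF that] fin by (rule finite_subset)
  have W_meas: "W \<in> measurable M (count_space UNIV)" 
  proof -
    have "W = (\<lambda>\<omega>. \<Sum>a\<in>A. if \<omega> \<in> B a then 1 else 0)"
      by (auto simp: W_def sum.If_cases[OF fin] Int_def fun_eq_iff)
    also have "\<dots> \<in> measurable M (count_space UNIV)" by measurable
    finally show ?thesis .
  qed
  have V_meas: "V a \<in> measurable M (count_space UNIV)" for a
  proof -
    have "V a = (\<lambda>\<omega>. \<Sum>b\<in>A-D a. if \<omega> \<in> B b then 1 else 0)"
      using fin by (auto simp: V_def sum.If_cases Int_def fun_eq_iff)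
    also have "\<dots> \<in> measurable M (count_space UNIV)" by measurable
    finally show ?thesis .
  qed
  note [measurable] = W_meas V_meas
  have Wle: "W \<omega> \<le> card A" for \<omega> unfolding W_def using fin by (intro card_mono) auto
  have VleW: "V a \<omega> \<le> W \<omega>" for a \<omega> unfolding W_def V_def using fin by (intro card_mono) auto
  have WV: "real (W \<omega> - V a \<omega>) = (\<Sum>b\<in>D a. indicator (B b) \<omega>)" if "a \<in> A" for a \<omega>
  proof -
    have "{b \<in> A. \<omega> \<in> B b} = {b \<in> A - D a. \<omega> \<in> B b} \<union> {b \<in> D a. \<omega> \<in> B b}" using D(1)[OF that] by auto
    then have "W \<omega> = V a \<omega> + card {b \<in> D a. \<omega> \<in> B b}" unfolding W_def V_def
      using fin finD[OF that] by (simp add: card_Un_disjoint disjoint_iff)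
    then show ?thesis using finD[OF that] by (simp add: sum_of_bool_eq indicator_def Int_def)
  qed
  define g where "g s = expectation (\<lambda>\<omega>. s ^ W \<omega>)" for s :: real
  define g' where "g' s = expectation (\<lambda>\<omega>. real (W \<omega>) * s ^ (W \<omega> - 1))" for s :: real
  have g_eq: "g = (\<lambda>s. \<Sum>m\<le>card A. s ^ m * prob {\<omega> \<in> space M. W \<omega> = m})"
    unfolding g_def fun_eq_iff by (intro allI expectation_finite_range[OF W_meas]) (use Wle in auto)
  have g'_eq: "g' s = (\<Sum>m\<le>card A. (real m * s ^ (m - 1)) * prob {\<omega> \<in> space M. W \<omega> = m})" for s
    unfolding g'_def by (intro expectation_finite_range[OF W_meas, of _ "\<lambda>m. real m * s ^ (m - 1)"]) (use Wle in auto)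
  have der: "(g has_real_derivative g' s) (at s)" for s
    unfolding g_eq g'_eq by (auto intro!: derivative_eq_intros sum.cong)
  have int_pow0: "integrable M (\<lambda>\<omega>. s ^ X \<omega>)"
    if "0 \<le> s" "s \<le> 1" and [measurable]: "X \<in> measurable M (count_space UNIV)" for s :: real and X :: "'a \<Rightarrow> nat"
    using that by (auto intro!: integrable_const_bound[where B=1] simp: power_le_one)
  have int_pow: "integrable M (\<lambda>\<omega>. indicator (B a) \<omega> * s ^ X \<omega>)"
    if "0 \<le> s" "s \<le> 1" "a \<in> A" and [measurable]: "X \<in> measurable M (count_space UNIV)" for s :: real and X :: "'a \<Rightarrow> nat" and a
    using that by (auto intro!: integrable_const_bound[where B=1] simp: abs_mult power_le_one indicator_def)
  have bound: "\<bar>g' s - l * g s\<bar> \<le> (\<Sum>a\<in>A. b1 a) + (\<Sum>a\<in>A. b2 a)" if s: "0 \<le> s" "s \<le> 1" for s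
  proof -
    \<comment> \<open>Writing \<open>W\<close> as a sum of indicators splits the derivative into one
      term per event, to be compared with the matching term of \<open>l * g s\<close>.\<close>
    have e1: "g' s = (\<Sum>a\<in>A. expectation (\<lambda>\<omega>. indicator (B a) \<omega> * s ^ (W \<omega> - 1)))"
      unfolding g'_def Wsum sum_distrib_right
      by (intro Bochner_Integration.integral_sum int_pow s) auto
    have e2: "l * g s = (\<Sum>a\<in>A. prob (B a) * g s)" by (simp add: l_def sum_distrib_right)
    have "\<bar>expectation (\<lambda>\<omega>. indicator (B a) \<omega> * s ^ (W \<omega> - 1)) - prob (B a) * g s\<bar> \<le> b1 a + b2 a"
      if a: "a \<in> A" for a
    proof -
      have mB: "B c \<in> events" if "c \<in> D a" for c using that D(1)[OF a] B by auto
      \<comment> \<open>On \<open>B a\<close> the event a itself accounts for the subtracted 1, so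
        \<open>W - 1\<close> exceeds \<open>V a\<close> exactly by the number of other events of
        \<open>D a\<close> that occur; the powers differ by no more than that number.\<close>
      have t1: "\<bar>expectation (\<lambda>\<omega>. indicator (B a) \<omega> * s ^ (W \<omega> - 1)) - expectation (\<lambda>\<omega>. indicator (B a) \<omega> * s ^ V a \<omega>)\<bar> \<le> b2 a"
      proof -
        have "\<bar>expectation (\<lambda>\<omega>. indicator (B a) \<omega> * s ^ (W \<omega> - 1)) - expectation (\<lambda>\<omega>. indicator (B a) \<omega> * s ^ V a \<omega>)\<bar>
          = \<bar>expectation (\<lambda>\<omega>. indicator (B a) \<omega> * s ^ (W \<omega> - 1) - indicator (B a) \<omega> * s ^ V a \<omega>)\<bar>"
          by (subst Bochner_Integration.integral_diff) (auto intro!: int_pow s a)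
        also have "\<dots> \<le> expectation (\<lambda>\<omega>. \<bar>indicator (B a) \<omega> * s ^ (W \<omega> - 1) - indicator (B a) \<omega> * s ^ V a \<omega>\<bar>)"
          by (rule integral_abs_bound)
        also have "\<dots> \<le> expectation (\<lambda>\<omega>. \<Sum>b\<in>D a - {a}. indicator (B a \<inter> B b) \<omega>)"
        proof (rule integral_mono)
          show "integrable M (\<lambda>\<omega>. \<bar>indicator (B a) \<omega> * s ^ (W \<omega> - 1) - indicator (B a) \<omega> * s ^ V a \<omega>\<bar>)"
            by (intro integrable_abs Bochner_Integration.integrable_diff int_pow s a) auto
          show "integrable M (\<lambda>\<omega>. \<Sum>b\<in>D a - {a}. indicator (B a \<inter> B b) \<omega> :: real)"
            using a B mB by (intro Bochner_Integration.integrable_sum integrable_real_indicator) (auto simp: less_top[symmetric])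
          fix \<omega>
          show "\<bar>indicator (B a) \<omega> * s ^ (W \<omega> - 1) - indicator (B a) \<omega> * s ^ V a \<omega>\<bar>
             \<le> (\<Sum>b\<in>D a - {a}. indicator (B a \<inter> B b) \<omega> :: real)"
          proof (cases "\<omega> \<in> B a")
            case True
            have "real (W \<omega> - V a \<omega>) = 1 + (\<Sum>b\<in>D a - {a}. indicator (B b) \<omega>)"
              using WV[OF a, of \<omega>] True finD[OF a] D(2)[OF a] by (simp add: sum.remove)
            moreover have "(0::real) \<le> (\<Sum>b\<in>D a - {a}. indicator (B b) \<omega>)" by (intro sum_nonneg) auto
            ultimately have "V a \<omega> \<le> W \<omega> - 1" "real (W \<omega> - 1 - V a \<omega>) = (\<Sum>b\<in>D a - {a}. indicator (B b) \<omega>)"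
              by linarith+
            then show ?thesis using True abs_power_diff_le[OF s, of "V a \<omega>" "W \<omega> - 1"]
              by (simp add: indicator_inter_arith)
          next
            case False
            then show ?thesis by (simp add: sum_nonneg)
          qed
        qed
        also have "\<dots> = b2 a"
          unfolding b2_def using a B mB by (subst Bochner_Integration.integral_sum) (auto simp: less_top[symmetric])
        finally show ?thesis .
      qed
      \<comment> \<open>Here a itself is among the events that are dropped; this is why the sum of
        products in the final bound contains the term b = a.\<close>
      have t2: "\<bar>expectation (\<lambda>\<omega>. s ^ V a \<omega>) - g s\<bar> \<le> (\<Sum>b\<in>D a. prob (B b))"
      proof -
        have "\<bar>expectation (\<lambda>\<omega>. s ^ V a \<omega>) - g s\<bar> = \<bar>expectation (\<lambda>\<omega>. s ^ V a \<omega> - s ^ W \<omega>)\<bar>"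
          unfolding g_def by (subst Bochner_Integration.integral_diff) (auto intro!: int_pow0 s)
        also have "\<dots> \<le> expectation (\<lambda>\<omega>. \<bar>s ^ V a \<omega> - s ^ W \<omega>\<bar>)"
          by (rule integral_abs_bound)
        also have "\<dots> \<le> expectation (\<lambda>\<omega>. \<Sum>b\<in>D a. indicator (B b) \<omega>)"
        proof (rule integral_mono)
          show "integrable M (\<lambda>\<omega>. \<bar>s ^ V a \<omega> - s ^ W \<omega>\<bar>)"
            by (intro integrable_abs Bochner_Integration.integrable_diff int_pow0 s) auto
          show "integrable M (\<lambda>\<omega>. \<Sum>b\<in>D a. indicator (B b) \<omega> :: real)"
            using a B mB by (intro Bochner_Integration.integrable_sum integrable_real_indicator) (auto simp: less_top[symmetric])
          fix \<omega>
          show "\<bar>s ^ V a \<omega> - s ^ W \<omega>\<bar> \<le> (\<Sum>b\<in>D a. indicator (B b) \<omega> :: real)"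
            using abs_power_diff_le[OF s VleW[of a \<omega>]] WV[OF a, of \<omega>] by (simp add: abs_minus_commute)
        qed
        also have "\<dots> = (\<Sum>b\<in>D a. prob (B b))"
          using a B mB by (subst Bochner_Integration.integral_sum) (auto simp: less_top[symmetric])
        finally show ?thesis .
      qed
      have t3: "expectation (\<lambda>\<omega>. indicator (B a) \<omega> * s ^ V a \<omega>) = prob (B a) * expectation (\<lambda>\<omega>. s ^ V a \<omega>)"
        unfolding V_def by (rule indep[OF a s])
      have "\<bar>prob (B a) * expectation (\<lambda>\<omega>. s ^ V a \<omega>) - prob (B a) * g s\<bar> \<le> b1 a"
        unfolding b1_def sum_distrib_left[symmetric] right_diff_distrib[symmetric] abs_mult
        using t2 by (simp add: mult_left_mono)
      with t1 t3 show ?thesis by linarith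
    qed
    then have "(\<Sum>a\<in>A. \<bar>expectation (\<lambda>\<omega>. indicator (B a) \<omega> * s ^ (W \<omega> - 1)) - prob (B a) * g s\<bar>) \<le> (\<Sum>a\<in>A. b1 a + b2 a)"
      by (rule sum_mono)
    with sum_abs[of "\<lambda>a. expectation (\<lambda>\<omega>. indicator (B a) \<omega> * s ^ (W \<omega> - 1)) - prob (B a) * g s" A]
    show ?thesis unfolding e1 e2 sum_subtractf[symmetric] sum.distrib[symmetric] by linarith
  qed
  have "\<bar>g 0 - exp (- l)\<bar> \<le> (\<Sum>a\<in>A. b1 a) + (\<Sum>a\<in>A. b2 a)"
    by (rule exp_gronwall_01[OF der bound]) (auto simp: l_def sum_nonneg g_def prob_space)
  \<comment> \<open>At s = 0 the power is 1 exactly when \<open>W\<close> vanishes, because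
    \<open>0 ^ 0 = 1\<close>.\<close>
  moreover have "g 0 = prob {\<omega> \<in> space M. \<forall>a\<in>A. \<omega> \<notin> B a}"
  proof -
    have "g 0 = expectation (indicator {\<omega> \<in> space M. \<forall>a\<in>A. \<omega> \<notin> B a})"
      unfolding g_def using fin by (intro Bochner_Integration.integral_cong) (auto simp: W_def power_0_left indicator_def)
    moreover have "{\<omega> \<in> space M. \<forall>a\<in>A. \<omega> \<notin> B a} \<in> events" using fin by measurable
    ultimately show ?thesis by (simp add: Int_absorb1)
  qed
  ultimately show ?thesis by (simp add: l_def b1_def b2_def)
qed

section \<open>Sums of exponential variables\<close>

text \<open>The difference is the tail of the exponential series from index j on. Its first term
  gives the lower bound; \<open>fact n * fact j \<le> fact (n + j)\<close> compares the tail
  termwise with \<open>x ^ j / fact j\<close> times the whole series.\<close>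

lemma exp_tail_bounds:
  fixes x :: real
  assumes "0 \<le> x"
  shows "x ^ j / fact j \<le> exp x - (\<Sum>n<j. x ^ n / fact n)"
    and "exp x - (\<Sum>n<j. x ^ n / fact n) \<le> x ^ j / fact j * exp x"
proof -
  have s: "(\<lambda>n. x ^ n / fact n) sums exp x"
    using exp_converges[of x] by (simp add: divide_inverse mult.commute)
  then have t: "(\<lambda>n. x ^ (n + j) / fact (n + j)) sums (exp x - (\<Sum>n<j. x ^ n / fact n))"
    by (rule sums_split_initial_segment)
  have "(\<lambda>n. if n = 0 then x ^ j / fact j else 0) sums (x ^ j / fact j)"
    using sums_single[of 0 "\<lambda>_. x ^ j / fact j"] by simp
  from sums_le[OF _ this t] show "x ^ j / fact j \<le> exp x - (\<Sum>n<j. x ^ n / fact n)"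
    using assms by simp
  show "exp x - (\<Sum>n<j. x ^ n / fact n) \<le> x ^ j / fact j * exp x"
  proof (rule sums_le[OF _ t sums_mult[OF s]])
    fix n
    have "(fact n * fact j :: real) \<le> fact (n + j)"
    proof -
      have "(fact n * fact j :: nat) \<le> fact (n + j)"
        by (intro dvd_imp_le fact_fact_dvd_fact) auto
      then show ?thesis by (metis of_nat_fact of_nat_le_iff of_nat_mult)
    qed
    then have "x ^ (n + j) / fact (n + j) \<le> x ^ (n + j) / (fact n * fact j)"
      using assms by (intro divide_left_mono) auto
    then show "x ^ (n + j) / fact (n + j) \<le> x ^ j / fact j * (x ^ n / fact n)"
      by (simp add: power_add field_simps)
  qed
qed

text \<open>Up to the factor \<open>exp (- x)\<close> the distribution function is a tail of the
  exponential series. The index k stands for a sum of k + 1 variables, hence \<open>Suc k\<close>.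
  For x of order 1/n the two bounds agree asymptotically.\<close>

lemma erlang_CDF_bounds:
  assumes "0 \<le> x"
  shows "erlang_CDF k 1 x \<le> x ^ Suc k / fact (Suc k)" (is ?upper)
    and "exp (- x) * x ^ Suc k / fact (Suc k) \<le> erlang_CDF k 1 x" (is ?lower)
proof -
  have eq: "erlang_CDF k 1 x = exp (- x) * (exp x - (\<Sum>n<Suc k. x ^ n / fact n))"
  proof -
    have "exp (- x) * exp x = 1" by (simp add: exp_minus)
    moreover have "(\<Sum>n\<le>k. x ^ n * exp (- x) / fact n) = exp (- x) * (\<Sum>n<Suc k. x ^ n / fact n)"
      unfolding sum_distrib_left lessThan_Suc_atMost by (intro sum.cong) auto
    ultimately show ?thesis
      using assms by (simp add: erlang_CDF_def right_diff_distrib del: sum.lessThan_Suc)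
  qed
  have "exp (- x) * (exp x - (\<Sum>n<Suc k. x ^ n / fact n)) \<le> exp (- x) * (x ^ Suc k / fact (Suc k) * exp x)"
    by (intro mult_left_mono exp_tail_bounds assms) auto
  also have "\<dots> = x ^ Suc k / fact (Suc k) * (exp (- x) * exp x)" by (simp only: ac_simps)
  also have "exp (- x) * exp x = 1" by (simp add: exp_minus)
  finally show ?upper unfolding eq by simp
  have "exp (- x) * (x ^ Suc k / fact (Suc k)) \<le> exp (- x) * (exp x - (\<Sum>n<Suc k. x ^ n / fact n))"
    by (intro mult_left_mono exp_tail_bounds assms) auto
  then show ?lower unfolding eq by simp
qed

text \<open>By independence the joint law is a product, and each section of the diagonal at a fixed
  y is a single point, null for the law of \<open>X\<close>.\<close>

lemma (in prob_space) prob_indep_eq_zero: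
  fixes X Y :: "'a \<Rightarrow> real"
  assumes indep: "indep_var borel X borel Y" and atomless: "\<And>y. prob {\<omega> \<in> space M. X \<omega> = y} = 0"
  shows "prob {\<omega> \<in> space M. X \<omega> = Y \<omega>} = 0"
proof -
  have [measurable]: "random_variable borel X" "random_variable borel Y"
    using indep_var_rv1[OF indep] indep_var_rv2[OF indep] by auto
  interpret X: prob_space "distr M borel X" by (rule prob_space_distr) simp
  interpret Y: prob_space "distr M borel Y" by (rule prob_space_distr) simp
  interpret XY: pair_sigma_finite "distr M borel X" "distr M borel Y" ..
  let ?D = "{z \<in> space (borel \<Otimes>\<^sub>M borel). fst z = snd z} :: (real \<times> real) set"
  have "(\<lambda>z. fst z - snd z) \<in> borel_measurable (borel \<Otimes>\<^sub>M borel :: (real \<times> real) measure)" by measurable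
  then have "(\<lambda>z. fst z - snd z) -` {0} \<inter> space (borel \<Otimes>\<^sub>M borel) \<in> sets (borel \<Otimes>\<^sub>M borel :: (real \<times> real) measure)"
    by (rule measurable_sets) simp
  also have "(\<lambda>z. fst z - snd z) -` {0} \<inter> space (borel \<Otimes>\<^sub>M borel) = ?D" by auto
  finally have D[measurable]: "?D \<in> sets (borel \<Otimes>\<^sub>M borel)" .
  have null: "emeasure (distr M borel X) {y} = 0" for y
    using atomless[of y] by (simp add: emeasure_distr vimage_def Int_def conj_commute emeasure_eq_measure)
  have "emeasure M {\<omega> \<in> space M. X \<omega> = Y \<omega>}
      = emeasure (distr M (borel \<Otimes>\<^sub>M borel) (\<lambda>\<omega>. (X \<omega>, Y \<omega>))) ?D"
    by (subst emeasure_distr[OF _ D]) (auto intro!: arg_cong2[where f=emeasure] simp: space_pair_measure)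
  also have "\<dots> = emeasure (distr M borel X \<Otimes>\<^sub>M distr M borel Y) ?D"
    using indep by (simp add: indep_var_distribution_eq)
  also have "\<dots> = (\<integral>\<^sup>+ y. emeasure (distr M borel X) ((\<lambda>x. (x, y)) -` ?D) \<partial>distr M borel Y)"
    by (rule XY.emeasure_pair_measure_alt2) (use D in \<open>simp cong: sets_pair_measure_cong\<close>)
  also have "\<dots> = (\<integral>\<^sup>+ y. 0 \<partial>distr M borel Y)"
  proof (rule nn_integral_cong)
    fix y :: real
    have "(\<lambda>x. (x, y)) -` ?D = {y}" by (auto simp: space_pair_measure)
    then show "emeasure (distr M borel X) ((\<lambda>x. (x, y)) -` ?D) = 0" by (simp only: null)
  qed
  finally show ?thesis by (simp add: emeasure_eq_measure)
qed

section \<open>Weights of sets of edges\<close>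

locale iid_exponential_family = prob_space M for M :: "'a measure" +
  fixes E :: "'e set" and W :: "'e \<Rightarrow> 'a \<Rightarrow> real"
  assumes finite_E: "finite E" and indep_W: "indep_vars (\<lambda>_. borel) W E"
    and distributed_W: "\<And>e. e \<in> E \<Longrightarrow> distributed M lborel (W e) (exponential_density 1)"
begin

lemma measurable_W[measurable]: "e \<in> E \<Longrightarrow> W e \<in> borel_measurable M"
  using distributed_measurable[OF distributed_W] by simp

lemma measurable_weight[measurable]:
  "C \<subseteq> E \<Longrightarrow> (\<lambda>\<omega>. weight (\<lambda>e. W e \<omega>) C) \<in> borel_measurable M"
  unfolding weight_def by (intro borel_measurable_sum) auto

lemma measurable_mean_weight[measurable]:
  "C \<subseteq> E \<Longrightarrow> (\<lambda>\<omega>. mean_weight (\<lambda>e. W e \<omega>) C) \<in> borel_measurable M"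
  unfolding mean_weight_def by measurable

lemma weight_cdf_bounds:
  assumes "C \<subseteq> E" "C \<noteq> {}" "0 \<le> x"
  shows "prob {\<omega> \<in> space M. weight (\<lambda>e. W e \<omega>) C \<le> x} \<le> x ^ card C / fact (card C)"
    and "exp (- x) * x ^ card C / fact (card C) \<le> prob {\<omega> \<in> space M. weight (\<lambda>e. W e \<omega>) C \<le> x}"
proof -
  have "finite C" using assms(1) finite_E by (rule finite_subset)
  then have Suc: "Suc (card C - 1) = card C" using assms(2) by (simp add: card_gt_0_iff)
  have "distributed M lborel (\<lambda>\<omega>. \<Sum>e\<in>C. W e \<omega>) (erlang_density (card C - 1) 1)"
    by (rule exponential_distributed_sum[OF \<open>finite C\<close> assms(2)])
      (use assms indep_vars_subset[OF indep_W] distributed_W in auto)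
  from erlang_distributed_le[OF this _ assms(3)]
  have eq: "prob {\<omega> \<in> space M. weight (\<lambda>e. W e \<omega>) C \<le> x} = erlang_CDF (card C - 1) 1 x"
    by (simp add: weight_def)
  from erlang_CDF_bounds[OF assms(3), of "card C - 1", unfolded Suc]
  show "prob {\<omega> \<in> space M. weight (\<lambda>e. W e \<omega>) C \<le> x} \<le> x ^ card C / fact (card C)"
    "exp (- x) * x ^ card C / fact (card C) \<le> prob {\<omega> \<in> space M. weight (\<lambda>e. W e \<omega>) C \<le> x}"
    unfolding eq by auto
qed

lemma prob_W_le: 
  assumes "e \<in> E" "0 \<le> x"
  shows "prob {\<omega> \<in> space M. W e \<omega> \<le> x} \<le> x"
  using weight_cdf_bounds(1)[of "{e}" x] assms by (simp add: weight_def)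

lemma AE_W_pos: "AE \<omega> in M. \<forall>e\<in>E. 0 < W e \<omega>"
proof -
  have "AE \<omega> in M. 0 < W e \<omega>" if "e \<in> E" for e
  proof -
    have "prob {\<omega> \<in> space M. W e \<omega> \<le> 0} = 0" 
      using prob_W_le[OF that, of 0] by (simp add: measure_le_0_iff)
    then have "AE \<omega> in M. \<not> W e \<omega> \<le> 0"
      using that by (subst (asm) prob_eq_0) auto
    then show ?thesis by eventually_elim simp
  qed
  then show ?thesis using finite_E by (simp add: AE_ball_countable countable_finite)
qed

lemma prob_all_le:
  assumes "F \<subseteq> E" "0 \<le> x"
  shows "prob {\<omega> \<in> space M. \<forall>e\<in>F. W e \<omega> \<le> x} \<le> x ^ card F"
proof (cases "F = {}")
  case True
  then show ?thesis by (simp add: prob_space)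
next
  case False
  have "finite F" using assms(1) finite_E by (rule finite_subset)
  have "{\<omega> \<in> space M. \<forall>e\<in>F. W e \<omega> \<le> x} = (\<Inter>e\<in>F. W e -` {..x} \<inter> space M)"
    using False by auto
  then have "prob {\<omega> \<in> space M. \<forall>e\<in>F. W e \<omega> \<le> x} = (\<Prod>e\<in>F. prob (W e -` {..x} \<inter> space M))"
    using indep_varsD[OF indep_W False \<open>finite F\<close> assms(1), of "\<lambda>_. {..x}"] by simp
  also have "\<dots> \<le> (\<Prod>e\<in>F. x)"
  proof (rule prod_mono)
    fix e assume "e \<in> F"
    have "W e -` {..x} \<inter> space M = {\<omega> \<in> space M. W e \<omega> \<le> x}" by auto
    then show "0 \<le> prob (W e -` {..x} \<inter> space M) \<and> prob (W e -` {..x} \<inter> space M) \<le> x"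
      using prob_W_le[of e x] \<open>e \<in> F\<close> assms by auto
  qed
  finally show ?thesis by simp
qed

text \<open>Weights are almost surely positive, so totals below z force every single edge of the
  union below z. This loses constants but keeps the power of z, which decides the size of the
  overlap error.\<close>

lemma prob_two_weights_le:
  assumes "C \<subseteq> E" "D \<subseteq> E" "x \<le> z" "y \<le> z" "0 \<le> z"
  shows "prob {\<omega> \<in> space M. weight (\<lambda>e. W e \<omega>) C \<le> x \<and> weight (\<lambda>e. W e \<omega>) D \<le> y} \<le> z ^ card (C \<union> D)"
proof -
  have "prob {\<omega> \<in> space M. weight (\<lambda>e. W e \<omega>) C \<le> x \<and> weight (\<lambda>e. W e \<omega>) D \<le> y}
      \<le> prob {\<omega> \<in> space M. \<forall>e\<in>C\<union>D. W e \<omega> \<le> z}"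
  proof (rule finite_measure_mono_AE)
    show "{\<omega> \<in> space M. \<forall>e\<in>C\<union>D. W e \<omega> \<le> z} \<in> events"
    proof -
      have "finite (C \<union> D)" using assms(1,2) by (intro finite_subset[OF _ finite_E]) auto
      moreover have "W e \<in> borel_measurable M" if "e \<in> C \<union> D" for e using that assms by auto
      ultimately show ?thesis by measurable
    qed
    show "AE \<omega> in M. \<omega> \<in> {\<omega> \<in> space M. weight (\<lambda>e. W e \<omega>) C \<le> x \<and> weight (\<lambda>e. W e \<omega>) D \<le> y} \<longrightarrow>
       \<omega> \<in> {\<omega> \<in> space M. \<forall>e\<in>C\<union>D. W e \<omega> \<le> z}"
      using AE_W_pos
    proof eventually_elim
      case (elim \<omega>)
      have "W e \<omega> \<le> weight (\<lambda>e. W e \<omega>) F" if "e \<in> F" "F \<subseteq> E" for e F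
        unfolding weight_def using elim that finite_subset[OF that(2) finite_E]
        by (intro member_le_sum) (auto intro: less_imp_le)
      then have "W e \<omega> \<le> z" if "e \<in> C \<union> D" "weight (\<lambda>e. W e \<omega>) C \<le> x" "weight (\<lambda>e. W e \<omega>) D \<le> y" for e
        using that assms by (meson Un_iff order_trans)
      then show ?case by simp
    qed
  qed
  also have "\<dots> \<le> z ^ card (C \<union> D)" using assms by (intro prob_all_le) auto
  finally show ?thesis .
qed

text \<open>The weight of \<open>C\<close> is a function of the coordinates in \<open>C\<close>, the
  count a function of those in \<open>E - C\<close>, so independence of two blocks of the family
  applies. This supplies the independence hypothesis of \<open>poisson_void\<close> for cycles that
  share no edge.\<close>

lemma indep_count:
  fixes s :: real and t :: "'e set \<Rightarrow> real"
  assumes "C \<subseteq> E" "finite \<D>" "\<And>D. D \<in> \<D> \<Longrightarrow> D \<subseteq> E - C" "0 \<le> s" "s \<le> 1"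
  shows "expectation (\<lambda>\<omega>. indicator {\<omega> \<in> space M. weight (\<lambda>e. W e \<omega>) C \<le> x} \<omega> *
       s ^ card {D \<in> \<D>. \<omega> \<in> {\<omega> \<in> space M. weight (\<lambda>e. W e \<omega>) D \<le> t D}}) =
     prob {\<omega> \<in> space M. weight (\<lambda>e. W e \<omega>) C \<le> x} *
     expectation (\<lambda>\<omega>. s ^ card {D \<in> \<D>. \<omega> \<in> {\<omega> \<in> space M. weight (\<lambda>e. W e \<omega>) D \<le> t D}})"
proof -
  define Y1 :: "('e \<Rightarrow> real) \<Rightarrow> real" where "Y1 f = indicator {..x} (weight f C)" for f
  \<comment> \<open>Writing the cardinality as a sum of zeros and ones makes the exponent visibly
    measurable.\<close>
  define Y2 :: "('e \<Rightarrow> real) \<Rightarrow> real" where "Y2 f = s ^ (\<Sum>D\<in>\<D>. if weight f D \<le> t D then 1 else 0)" for f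
  define X1 where "X1 = Y1 \<circ> (\<lambda>\<omega>. restrict (\<lambda>e. W e \<omega>) C)"
  define X2 where "X2 = Y2 \<circ> (\<lambda>\<omega>. restrict (\<lambda>e. W e \<omega>) (E - C))"
  have wm: "(\<lambda>f. weight f D) \<in> borel_measurable (PiM F (\<lambda>_. borel))" if "D \<subseteq> F" for D F
    unfolding weight_def using that by (intro borel_measurable_sum measurable_component_singleton) auto
  have "Y1 \<in> borel_measurable (PiM C (\<lambda>_. borel))"
    unfolding Y1_def using wm[of C C] by measurable
  moreover have "Y2 \<in> borel_measurable (PiM (E - C) (\<lambda>_. borel))"
  proof -
    have [measurable]: "D \<in> \<D> \<Longrightarrow> (\<lambda>f. weight f D) \<in> borel_measurable (PiM (E - C) (\<lambda>_. borel))" for D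
      using wm assms(3) by blast
    show ?thesis unfolding Y2_def by measurable
  qed
  ultimately have ind: "indep_var borel X1 borel X2"
    unfolding X1_def X2_def
    using assms(1) by (intro indep_var_compose[OF indep_var_restrict[OF indep_W]]) auto
  have [measurable]: "X1 \<in> borel_measurable M" "X2 \<in> borel_measurable M"
    using indep_var_rv1[OF ind] indep_var_rv2[OF ind] by auto
  have "integrable M X1" "integrable M X2"
  proof -
    have "norm (X1 \<omega>) \<le> 1" "norm (X2 \<omega>) \<le> 1" for \<omega>
      using assms(4,5) by (auto simp: X1_def X2_def Y1_def Y2_def power_le_one indicator_def)
    then show "integrable M X1" "integrable M X2"
      by (auto intro!: integrable_const_bound[where B=1])
  qed
  from indep_var_lebesgue_integral[OF ind this]
  have *: "expectation (\<lambda>\<omega>. X1 \<omega> * X2 \<omega>) = expectation X1 * expectation X2" .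
  have w_restrict: "weight (restrict f F) D = weight f D" if "D \<subseteq> F" for f :: "'e \<Rightarrow> real" and D F
    unfolding weight_def using that by (intro sum.cong) auto
  have X1: "X1 \<omega> = indicator {\<omega> \<in> space M. weight (\<lambda>e. W e \<omega>) C \<le> x} \<omega>" if "\<omega> \<in> space M" for \<omega>
    using that by (auto simp: X1_def Y1_def w_restrict indicator_def)
  have X2: "X2 \<omega> = s ^ card {D \<in> \<D>. \<omega> \<in> {\<omega> \<in> space M. weight (\<lambda>e. W e \<omega>) D \<le> t D}}" if "\<omega> \<in> space M" for \<omega>
  proof -
    have "(\<Sum>D\<in>\<D>. if weight (restrict (\<lambda>e. W e \<omega>) (E - C)) D \<le> t D then 1 else 0)
        = card {D \<in> \<D>. weight (\<lambda>e. W e \<omega>) D \<le> t D}"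
      using assms(2,3) by (simp add: w_restrict sum.If_cases Int_def)
    then show ?thesis using that by (simp add: X2_def Y2_def)
  qed
  have "expectation X1 = expectation (indicator {\<omega> \<in> space M. weight (\<lambda>e. W e \<omega>) C \<le> x})"
    by (intro Bochner_Integration.integral_cong X1) auto
  also have "\<dots> = prob {\<omega> \<in> space M. weight (\<lambda>e. W e \<omega>) C \<le> x}" by (simp add: Int_absorb2)
  finally have e1: "expectation X1 = prob {\<omega> \<in> space M. weight (\<lambda>e. W e \<omega>) C \<le> x}" .
  have e2: "expectation X2 = expectation (\<lambda>\<omega>. s ^ card {D \<in> \<D>. \<omega> \<in> {\<omega> \<in> space M. weight (\<lambda>e. W e \<omega>) D \<le> t D}})"
    by (intro Bochner_Integration.integral_cong X2) auto
  have e3: "expectation (\<lambda>\<omega>. X1 \<omega> * X2 \<omega>) = expectation (\<lambda>\<omega>. indicator {\<omega> \<in> space M. weight (\<lambda>e. W e \<omega>) C \<le> x} \<omega> *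
       s ^ card {D \<in> \<D>. \<omega> \<in> {\<omega> \<in> space M. weight (\<lambda>e. W e \<omega>) D \<le> t D}})"
    by (intro Bochner_Integration.integral_cong) (simp_all only: X1 X2)
  show ?thesis using * unfolding e1 e2 e3 .
qed

lemma prob_W_eq: "e \<in> E \<Longrightarrow> prob {\<omega> \<in> space M. W e \<omega> = y} = 0"
proof -
  assume "e \<in> E"
  have "emeasure M (W e -` {y} \<inter> space M) = (\<integral>\<^sup>+x. ennreal (exponential_density 1 x) * indicator {y} x \<partial>lborel)"
    by (intro distributed_emeasure[OF distributed_W[OF \<open>e \<in> E\<close>]]) simp
  also have "\<dots> = 0" by (rule nn_integral_null_set) (simp add: null_sets_def)
  finally have "emeasure M (W e -` {y} \<inter> space M) = 0" .
  moreover have "W e -` {y} \<inter> space M = {\<omega> \<in> space M. W e \<omega> = y}" by auto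
  ultimately show ?thesis by (simp add: emeasure_eq_measure)
qed

text \<open>Given all other weights, a tie fixes the weight of \<open>e\<close> at the value
  \<open>Y\<close>, obtained by solving the tie for it. The weight of \<open>e\<close> has no atoms
  and is independent of \<open>Y\<close>.\<close>

lemma prob_mean_weight_tie_aux:
  assumes "C \<subseteq> E" "D \<subseteq> E" "e \<in> C" "e \<notin> D"
  shows "prob {\<omega> \<in> space M. mean_weight (\<lambda>e. W e \<omega>) C = mean_weight (\<lambda>e. W e \<omega>) D} = 0"
proof -
  have sub: "D \<subseteq> E - {e}" "C - {e} \<subseteq> E - {e}" using assms by auto
  define Y where "Y f = real (card C) * mean_weight f D - weight f (C - {e})" for f :: "'e \<Rightarrow> real"
  have fC: "finite C" using assms(1) finite_E by (rule finite_subset)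
  then have c: "card C > 0" using assms(3) card_gt_0_iff by blast
  have wm: "(\<lambda>f. weight f D) \<in> borel_measurable (PiM F (\<lambda>_. borel))" if "D \<subseteq> F" for D F
    unfolding weight_def using that by (intro borel_measurable_sum measurable_component_singleton) auto
  have [measurable]: "Y \<in> borel_measurable (PiM (E - {e}) (\<lambda>_. borel))"
  proof -
    have [measurable]: "(\<lambda>f. weight f D) \<in> borel_measurable (PiM (E - {e}) (\<lambda>_. borel))"
      "(\<lambda>f. weight f (C - {e})) \<in> borel_measurable (PiM (E - {e}) (\<lambda>_. borel))"
      using sub by (simp_all only: wm)
    show ?thesis unfolding Y_def mean_weight_def by measurable
  qed
  have "indep_var borel ((\<lambda>f. f e) \<circ> (\<lambda>\<omega>. restrict (\<lambda>e. W e \<omega>) {e}))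
      borel (Y \<circ> (\<lambda>\<omega>. restrict (\<lambda>e. W e \<omega>) (E - {e})))"
    using assms by (intro indep_var_compose[OF indep_var_restrict[OF indep_W]]) auto
  also have "(\<lambda>f. f e) \<circ> (\<lambda>\<omega>. restrict (\<lambda>e. W e \<omega>) {e}) = W e" by (simp add: fun_eq_iff)
  also have "Y \<circ> (\<lambda>\<omega>. restrict (\<lambda>e. W e \<omega>) (E - {e})) = (\<lambda>\<omega>. Y (\<lambda>e. W e \<omega>))"
  proof
    fix \<omega>
    have w_restrict: "weight (restrict f F) D = weight f D" if "D \<subseteq> F" for f :: "'e \<Rightarrow> real" and D F
      unfolding weight_def using that by (intro sum.cong) auto
    from sub show "(Y \<circ> (\<lambda>\<omega>. restrict (\<lambda>e. W e \<omega>) (E - {e}))) \<omega> = Y (\<lambda>e. W e \<omega>)"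
      by (simp add: Y_def mean_weight_def w_restrict)
  qed
  finally have indep: "indep_var borel (W e) borel (\<lambda>\<omega>. Y (\<lambda>e. W e \<omega>))" .
  have "e \<in> E" using assms by auto
  from prob_indep_eq_zero[OF indep prob_W_eq[OF this]]
  have "prob {\<omega> \<in> space M. W e \<omega> = Y (\<lambda>e. W e \<omega>)} = 0" .
  moreover have "mean_weight f C = mean_weight f D \<longleftrightarrow> f e = Y f" for f
  proof -
    have "weight f C = f e + weight f (C - {e})"
      unfolding weight_def using fC assms(3) by (rule sum.remove)
    then have "mean_weight f C = mean_weight f D \<longleftrightarrow> f e + weight f (C - {e}) = real (card C) * mean_weight f D"
      unfolding mean_weight_def[of f C] using c by (subst divide_eq_eq) (auto simp: mult.commute)
    then show ?thesis by (auto simp: Y_def)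
  qed
  ultimately show ?thesis by simp
qed

text \<open>Of two distinct sets one contains an edge outside the other, and there are only finitely
  many pairs. With ties excluded, an attained minimum is strict, as \<open>is_min_mean_cycle\<close>
  demands.\<close>

lemma AE_no_mean_weight_ties:
  assumes "\<C> \<subseteq> Pow E"
  shows "AE \<omega> in M. \<forall>C\<in>\<C>. \<forall>D\<in>\<C>. C \<noteq> D \<longrightarrow> mean_weight (\<lambda>e. W e \<omega>) C \<noteq> mean_weight (\<lambda>e. W e \<omega>) D"
proof -
  have fin: "finite \<C>" using assms finite_E by (simp add: finite_subset)
  have "AE \<omega> in M. mean_weight (\<lambda>e. W e \<omega>) C \<noteq> mean_weight (\<lambda>e. W e \<omega>) D"
    if "C \<subseteq> E" "D \<subseteq> E" "C \<noteq> D" for C D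
  proof -
    have "prob {\<omega> \<in> space M. mean_weight (\<lambda>e. W e \<omega>) C = mean_weight (\<lambda>e. W e \<omega>) D} = 0"
    proof (cases "C \<subseteq> D")
      case True
      then obtain e where "e \<in> D" "e \<notin> C" using \<open>C \<noteq> D\<close> by auto
      then show ?thesis using prob_mean_weight_tie_aux[of D C e] that by (simp add: eq_commute[of "mean_weight _ C"])
    next
      case False
      then obtain e where "e \<in> C" "e \<notin> D" by auto
      then show ?thesis using prob_mean_weight_tie_aux[of C D e] that by simp
    qed
    then show ?thesis using that by (subst (asm) prob_eq_0) auto
  qed
  then have "AE \<omega> in M. C \<noteq> D \<longrightarrow> mean_weight (\<lambda>e. W e \<omega>) C \<noteq> mean_weight (\<lambda>e. W e \<omega>) D"
    if "C \<in> \<C>" "D \<in> \<C>" for C D using that assms by (cases "C = D") auto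
  then show ?thesis using fin by (simp add: AE_ball_countable countable_finite)
qed

end

section \<open>Limiting cycle counts and the tree function\<close>

text \<open>
  The limiting mean number of cycles of length \<open>j\<close> and mean weight at most \<open>c / n\<close>, where
  \<open>\<mu>\<close> is the number of orientations of an edge.
\<close>

definition cycle_rate :: "nat \<Rightarrow> nat \<Rightarrow> real \<Rightarrow> real" where
  "cycle_rate \<mu> j c = (real j * c) ^ j / (real \<mu> * real j * fact j)"

lemma cycle_rate_nonneg: "0 \<le> c \<Longrightarrow> 0 \<le> cycle_rate \<mu> j c"
  by (simp add: cycle_rate_def)

lemma cycle_rate_mono: "0 \<le> c \<Longrightarrow> c \<le> d \<Longrightarrow> cycle_rate \<mu> j c \<le> cycle_rate \<mu> j d"
  unfolding cycle_rate_def by (intro divide_right_mono power_mono mult_left_mono) auto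

lemma cycle_rate_pos: "0 < c \<Longrightarrow> 0 < \<mu> \<Longrightarrow> 0 < j \<Longrightarrow> 0 < cycle_rate \<mu> j c"
  by (simp add: cycle_rate_def)

lemma cycle_rate_0: "0 < j \<Longrightarrow> cycle_rate \<mu> j 0 = 0"
  by (simp add: cycle_rate_def)

text \<open>The ratio of consecutive terms tends to c times e, since (1 + 1/n)^(n - 1) tends to e:
  this is the source of the critical value 1/e.\<close>

lemma cycle_rate_Suc:
  assumes "0 < n"
  shows "cycle_rate \<mu> (Suc n) c = cycle_rate \<mu> n c * (c * ((real n + 1) / real n) ^ (n - 1))"
proof -
  obtain p where n: "n = Suc p" using assms by (cases n) auto
  define x y :: real where "x = real n" and "y = real n + 1"
  have xy: "x > 0" "y > 0" using assms by (auto simp: x_def y_def)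
  have "cycle_rate \<mu> (Suc n) c = (y * c) ^ Suc (Suc p) / (real \<mu> * y * (y * fact n))"
    by (simp add: cycle_rate_def n x_def y_def algebra_simps)
  also have "\<dots> = (x * c) ^ Suc p / (real \<mu> * x * fact n) * (c * (y / x) ^ p)"
    using xy by (cases "\<mu> = 0") (simp_all add: power_mult_distrib power_divide field_simps)
  finally show ?thesis by (simp add: cycle_rate_def n x_def y_def)
qed

text \<open>At the critical value the ratio tends to 1 and the ratio test is silent. Raabe's
  quotient tends to 3/2, in accordance with terms of order j^(-3/2) by Stirling's formula.\<close>

lemma summable_cycle_rate:
  assumes "0 < \<mu>"
  shows "summable (\<lambda>j. cycle_rate \<mu> j (1 / exp 1))"
proof (rule raabes_test_convergence)
  let ?f = "\<lambda>j. cycle_rate \<mu> j (1 / exp 1)"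
  have pos: "0 < ?f n" if "0 < n" for n using assms that by (intro cycle_rate_pos) auto
  show "\<forall>\<^sub>F n in sequentially. 0 < ?f n" using eventually_gt_at_top[of 0] by eventually_elim (rule pos)
  \<comment> \<open>The quotient \<open>?f n / ?f (Suc n)\<close> in exponential form; the summand 1
    in the exponent comes from 1/c = e.\<close>
  have "(\<lambda>n::nat. real n * (exp (1 + (real n - 1) * ln (real n / (real n + 1))) - 1)) \<longlonglongrightarrow> 3 / 2"
    by real_asymp
  moreover have "\<forall>\<^sub>F n in sequentially. real n * (exp (1 + (real n - 1) * ln (real n / (real n + 1))) - 1)
      = real n * (?f n / ?f (Suc n) - 1)"
    using eventually_gt_at_top[of 0]
  proof eventually_elim
    case (elim n)
    have "exp ((real n - 1) * ln (real n / (real n + 1))) = (real n / (real n + 1)) ^ (n - 1)"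
      using elim exp_of_nat_mult[of "n - 1" "ln (real n / (real n + 1))"] by (simp add: of_nat_diff)
    then have "exp (1 + (real n - 1) * ln (real n / (real n + 1))) = exp 1 * (real n / (real n + 1)) ^ (n - 1)"
      by (simp only: exp_add)
    then show ?case using pos[OF elim] elim
      by (simp add: cycle_rate_Suc[OF elim] field_simps power_divide)
  qed
  ultimately have "(\<lambda>n. real n * (?f n / ?f (Suc n) - 1)) \<longlonglongrightarrow> 3 / 2"
    by (rule Lim_transform_eventually)
  then have "liminf (\<lambda>n. ereal (real n * (?f n / ?f (Suc n) - 1))) = ereal (3 / 2)"
    by (intro lim_imp_Liminf) auto
  then show "1 < liminf (\<lambda>n. ereal (real n * (?f n / ?f (Suc n) - 1)))" by simp
qed

text \<open>Beyond 1/e the ratio of consecutive terms is eventually at least 1, so the positive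
  terms do not tend to 0.\<close>

lemma not_summable_cycle_rate:
  assumes "0 < \<mu>" "1 / exp 1 < c"
  shows "\<not> summable (\<lambda>j. cycle_rate \<mu> j c)"
proof
  assume "summable (\<lambda>j. cycle_rate \<mu> j c)"
  then have lim: "(\<lambda>j. cycle_rate \<mu> j c) \<longlonglongrightarrow> 0" by (rule summable_LIMSEQ_zero)
  have c: "0 < c" using assms(2) by (rule less_trans[rotated]) simp
  have "(\<lambda>n::nat. ((real n + 1) / real n) powr (real n - 1)) \<longlonglongrightarrow> exp 1" by real_asymp
  moreover have "1 / c < exp 1" using assms c by (simp add: field_simps)
  ultimately have "\<forall>\<^sub>F n in sequentially. 1 / c < ((real n + 1) / real n) powr (real n - 1)"
    by (simp add: order_tendstoD)
  then have "\<forall>\<^sub>F n in sequentially. 0 < n \<and> cycle_rate \<mu> n c \<le> cycle_rate \<mu> (Suc n) c"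
    using eventually_gt_at_top[of 0]
  proof eventually_elim
    case (elim n)
    have "((real n + 1) / real n) powr (real n - 1) = ((real n + 1) / real n) ^ (n - 1)"
      using elim by (subst powr_realpow[symmetric]) (auto simp: of_nat_diff)
    then have "1 \<le> c * ((real n + 1) / real n) ^ (n - 1)" using elim c by (simp add: pos_divide_less_eq mult.commute)
    then show ?case using elim cycle_rate_pos[OF c assms(1) elim(2)] unfolding cycle_rate_Suc[OF elim(2)]
      by (metis less_imp_le mult.right_neutral mult_left_mono)
  qed
  then obtain n0 where n0: "\<And>n. n \<ge> n0 \<Longrightarrow> 0 < n \<and> cycle_rate \<mu> n c \<le> cycle_rate \<mu> (Suc n) c"
    by (auto simp: eventually_at_top_linorder)
  have "cycle_rate \<mu> n0 c \<le> cycle_rate \<mu> n c" if "n0 \<le> n" for n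
    using that by (induction n rule: dec_induct) (use n0 in \<open>auto intro: order_trans\<close>)
  then have "cycle_rate \<mu> n0 c \<le> 0"
    by (intro LIMSEQ_le_const[OF lim]) auto
  moreover have "0 < cycle_rate \<mu> n0 c" using n0[of n0] c assms by (intro cycle_rate_pos) auto
  ultimately show False by simp
qed

text \<open>The sum is the exponent of a limiting void probability: at a fixed c beyond 1/e, a large
  K makes that probability as small as desired. Leaving out the lengths below m costs only a
  constant.\<close>

lemma cycle_rate_sum_unbounded:
  assumes "0 < \<mu>" "1 / exp 1 < c"
  shows "\<exists>K0. \<forall>K\<ge>K0. B < (\<Sum>j=m..K. cycle_rate \<mu> j c)"
proof -
  have "0 < 1 / exp (1::real)" by simp
  with assms(2) have c: "0 \<le> c" by linarith
  let ?f = "\<lambda>j. cycle_rate \<mu> j c"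
  have "\<exists>n. B + sum ?f {..<m} < sum ?f {..<n}"
  proof (rule ccontr)
    assume "\<not> ?thesis"
    then have "summable ?f"
      by (intro summableI_nonneg_bounded[where x = "B + sum ?f {..<m}"]) (auto simp: cycle_rate_nonneg c not_less)
    with not_summable_cycle_rate[OF assms] show False ..
  qed
  then obtain n where n: "B + sum ?f {..<m} < sum ?f {..<n}" ..
  show ?thesis
  proof (intro exI allI impI)
    fix K assume "n \<le> K"
    then have "sum ?f {..<n} \<le> sum ?f ({..<m} \<union> {m..K})"
      by (intro sum_mono2) (auto simp: cycle_rate_nonneg c)
    also have "\<dots> = sum ?f {..<m} + sum ?f {m..K}" by (rule sum.union_disjoint) auto
    finally show "B < sum ?f {m..K}" using n by simp
  qed
qed

text \<open>The sum of the limiting means for lengths above K. Taking c = 1/e, the largest value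
  considered, makes it a bound for all smaller c at once.\<close>

definition cycle_tail :: "nat \<Rightarrow> nat \<Rightarrow> real" where
  "cycle_tail \<mu> K = (\<Sum>j. cycle_rate \<mu> (j + Suc K) (1 / exp 1))"

lemma cycle_tail_tendsto_0:
  assumes "0 < \<mu>" shows "cycle_tail \<mu> \<longlonglongrightarrow> 0"
proof -
  have "(\<lambda>K. \<Sum>j. cycle_rate \<mu> (j + K) (1 / exp 1)) \<longlonglongrightarrow> 0"
    by (rule suminf_exist_split2[OF summable_cycle_rate[OF assms]])
  then show ?thesis unfolding cycle_tail_def by (rule LIMSEQ_Suc)
qed

lemma cycle_rate_le: "0 \<le> c \<Longrightarrow> c \<le> 1 / exp 1 \<Longrightarrow> norm (cycle_rate \<mu> j c) \<le> cycle_rate \<mu> j (1 / exp 1)"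
  by (simp add: cycle_rate_nonneg cycle_rate_mono)

lemma summable_cycle_rate_le:
  assumes "0 < \<mu>" "0 \<le> c" "c \<le> 1 / exp 1"
  shows "summable (\<lambda>j. cycle_rate \<mu> j c)"
  using summable_cycle_rate[OF assms(1)] cycle_rate_le[OF assms(2,3)]
  by (intro summable_comparison_test[of "\<lambda>j. cycle_rate \<mu> j c"]) auto

definition cycle_total :: "nat \<Rightarrow> nat \<Rightarrow> real \<Rightarrow> real" where
  "cycle_total \<mu> m c = (\<Sum>j. cycle_rate \<mu> (j + m) c)"

lemma cycle_total_truncate:
  assumes "0 < \<mu>" "0 \<le> c" "c \<le> 1 / exp 1" "m \<le> K"
  shows "(\<Sum>j=m..K. cycle_rate \<mu> j c) \<le> cycle_total \<mu> m c"
    and "cycle_total \<mu> m c \<le> (\<Sum>j=m..K. cycle_rate \<mu> j c) + cycle_tail \<mu> K"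
proof -
  let ?f = "\<lambda>j. cycle_rate \<mu> j c"
  have s: "summable ?f" using assms by (intro summable_cycle_rate_le)
  have sh: "summable (\<lambda>j. ?f (j + i))" for i using s by (rule summable_ignore_initial_segment)
  have "suminf ?f = cycle_total \<mu> m c + sum ?f {..<m}"
    unfolding cycle_total_def by (rule suminf_split_initial_segment[OF s])
  moreover have "suminf ?f = (\<Sum>j. ?f (j + Suc K)) + sum ?f {..<Suc K}"
    by (rule suminf_split_initial_segment[OF s])
  moreover have "sum ?f {..<Suc K} = sum ?f {..<m} + sum ?f {m..K}"
  proof -
    have "{..<Suc K} = {..<m} \<union> {m..K}" using assms(4) by auto
    then show ?thesis by (simp add: sum.union_disjoint disjoint_iff del: lessThan_Suc)
  qed
  ultimately have eq: "cycle_total \<mu> m c = sum ?f {m..K} + (\<Sum>j. ?f (j + Suc K))" by linarith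
  show "sum ?f {m..K} \<le> cycle_total \<mu> m c"
    unfolding eq using suminf_nonneg[OF sh[of "Suc K"]] cycle_rate_nonneg[OF assms(2)] by simp
  have "(\<Sum>j. ?f (j + Suc K)) \<le> cycle_tail \<mu> K"
    unfolding cycle_tail_def using assms summable_cycle_rate[OF assms(1)]
    by (intro suminf_le cycle_rate_mono sh summable_ignore_initial_segment)
  then show "cycle_total \<mu> m c \<le> sum ?f {m..K} + cycle_tail \<mu> K" unfolding eq by simp
qed

lemma continuous_on_cycle_rate: "continuous_on S (cycle_rate \<mu> j)"
  unfolding cycle_rate_def divide_inverse by (intro continuous_intros)

text \<open>The series at 1/e is a summable majorant on the whole interval, so uniform convergence
  includes the end point.\<close>

lemma continuous_on_cycle_total:
  assumes "0 < \<mu>"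
  shows "continuous_on {0..1 / exp 1} (cycle_total \<mu> m)"
proof -
  have "uniform_limit {0..1 / exp 1} (\<lambda>n c. \<Sum>j<n. cycle_rate \<mu> (j + m) c) (\<lambda>c. \<Sum>j. cycle_rate \<mu> (j + m) c) sequentially"
    using summable_ignore_initial_segment[OF summable_cycle_rate[OF assms], of m]
    by (intro Weierstrass_m_test[where M = "\<lambda>j. cycle_rate \<mu> (j + m) (1 / exp 1)"])
      (auto simp: cycle_rate_nonneg cycle_rate_mono)
  then show ?thesis unfolding cycle_total_def[abs_def]
    by (rule uniform_limit_theorem[rotated]) (auto intro!: always_eventually continuous_on_sum continuous_on_cycle_rate)
qed

text \<open>\<open>j ^ (j - 1) * c ^ j / fact j\<close> is
  \<open>(j * c) ^ j / (j * fact j)\<close>: the tree function sums the directed rates over all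
  lengths from 1 on.\<close>

lemma tree_function_eq:
  assumes "0 \<le> c" "c \<le> 1 / exp 1"
  shows "tree_function c = (\<Sum>j. cycle_rate 1 (Suc j) c)"
  unfolding tree_function_def cycle_rate_def
  by (intro suminf_cong) (simp add: power_mult_distrib)

text \<open>The subtracted c is the term of length 1 of the tree function, to which no cycle
  corresponds.\<close>

lemma cycle_total_directed:
  assumes "0 \<le> c" "c \<le> 1 / exp 1"
  shows "cycle_total 1 2 c = tree_function c - c"
proof -
  have "summable (\<lambda>j. cycle_rate 1 (Suc j) c)"
    using summable_ignore_initial_segment[OF summable_cycle_rate_le[of 1 c], of 1] assms by simp
  moreover have "cycle_rate 1 (Suc 0) c = c" by (simp add: cycle_rate_def)
  ultimately show ?thesis
    using assms suminf_split_initial_segment[of "\<lambda>j. cycle_rate 1 (Suc j) c" 1]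
    by (simp add: tree_function_eq cycle_total_def numeral_2_eq_2)
qed

text \<open>Each rate is half the directed one, and the terms of length 1 and 2, namely c and c^2,
  are absent.\<close>

lemma cycle_total_undirected:
  assumes "0 \<le> c" "c \<le> 1 / exp 1"
  shows "cycle_total 2 3 c = (tree_function c - c - c\<^sup>2) / 2"
proof -
  have s: "summable (\<lambda>j. cycle_rate 1 (Suc j) c)"
    using summable_ignore_initial_segment[OF summable_cycle_rate_le[of 1 c], of 1] assms by simp
  have half: "cycle_rate 2 j c = cycle_rate 1 j c / 2" for j by (simp add: cycle_rate_def)
  have "summable (\<lambda>j. cycle_rate 1 (j + 3) c)"
    using summable_ignore_initial_segment[OF summable_cycle_rate_le[of 1 c], of 3] assms by simp
  then have "cycle_total 2 3 c = (\<Sum>j. cycle_rate 1 (j + 3) c) / 2"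
    unfolding cycle_total_def half by (rule suminf_divide)
  moreover have "cycle_rate 1 (Suc 0) c = c" "cycle_rate 1 (Suc (Suc 0)) c = c\<^sup>2"
    by (simp_all add: cycle_rate_def power2_eq_square field_simps)
  then have "(\<Sum>j. cycle_rate 1 (Suc j) c) = (\<Sum>j. cycle_rate 1 (j + 3) c) + (c + c\<^sup>2)"
    using suminf_split_initial_segment[OF s, of 2] by (simp add: numeral_2_eq_2 numeral_3_eq_3)
  ultimately show ?thesis using assms by (simp add: tree_function_eq)
qed

lemma has_derivative_cycle_rate:
  assumes "0 < k"
  shows "(cycle_rate \<mu> k has_real_derivative (c ^ (k - 1) * real k ^ k / (real \<mu> * fact k))) (at c within S)"
proof -
  have eq: "cycle_rate \<mu> k = (\<lambda>c. (real k ^ k / (real \<mu> * real k * fact k)) * c ^ k)"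
    by (simp add: cycle_rate_def fun_eq_iff power_mult_distrib)
  show ?thesis unfolding eq
    by (rule derivative_eq_intros refl)+ (use assms in simp)
qed

section \<open>Riemann-Stieltjes sums with an explicit error\<close>

text \<open>As \<open>H\<close> decreases and \<open>F\<close> increases, the integral over each
  cell lies between the two products. Each increment of \<open>F\<close> is at most B times the mesh
  width, so upper and lower sum differ by a multiple of a sum that telescopes in \<open>H\<close>,
  which varies by at most 1 in total. The explicit error allows R to be fixed before n
  grows.\<close>

lemma stieltjes_sums:
  fixes H F F' :: "real \<Rightarrow> real"
  assumes b: "0 \<le> b" and R: "0 < R"
    and H: "continuous_on {0..b} H" "\<And>x y. 0 \<le> x \<Longrightarrow> x \<le> y \<Longrightarrow> y \<le> b \<Longrightarrow> H y \<le> H x"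
      "\<And>x. 0 \<le> x \<Longrightarrow> x \<le> b \<Longrightarrow> 0 \<le> H x \<and> H x \<le> 1"
    and F: "\<And>x. 0 \<le> x \<Longrightarrow> x \<le> b \<Longrightarrow> (F has_real_derivative F' x) (at x)"
    and F': "continuous_on {0..b} F'" "\<And>x. 0 \<le> x \<Longrightarrow> x \<le> b \<Longrightarrow> 0 \<le> F' x \<and> F' x \<le> B"
  defines "c \<equiv> \<lambda>i. real i * b / real R"
  shows "(\<Sum>i<R. H (c i) * (F (c (Suc i)) - F (c i))) \<le> integral {0..b} (\<lambda>x. H x * F' x) + B * b / real R"
    and "integral {0..b} (\<lambda>x. H x * F' x) - B * b / real R \<le> (\<Sum>i<R. H (c (Suc i)) * (F (c (Suc i)) - F (c i)))"
proof -
  let ?U = "\<Sum>i<R. H (c i) * (F (c (Suc i)) - F (c i))"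
  let ?L = "\<Sum>i<R. H (c (Suc i)) * (F (c (Suc i)) - F (c i))"
  have c0: "c 0 = 0" and cR: "c R = b" using R by (auto simp: c_def)
  have cmono: "c i \<le> c (Suc i)" for i unfolding c_def using b by (intro divide_right_mono mult_right_mono) auto
  have cpos: "0 \<le> c i" for i unfolding c_def using b by simp
  have cle: "c i \<le> b" if "i \<le> R" for i
  proof -
    have "real i * b \<le> real R * b" using that b by (intro mult_right_mono) auto
    then show ?thesis using R by (simp add: c_def divide_le_eq mult.commute)
  qed
  have cont: "continuous_on {0..b} (\<lambda>x. H x * F' x)" using H(1) F'(1) by (rule continuous_on_mult)
  define P where "P x = integral {0..x} (\<lambda>x. H x * F' x)" for x
  have step: "H (c (Suc i)) * (F (c (Suc i)) - F (c i)) \<le> P (c (Suc i)) - P (c i) \<and>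
     P (c (Suc i)) - P (c i) \<le> H (c i) * (F (c (Suc i)) - F (c i))" if i: "i < R" for i
  proof -
    let ?J = "{c i..c (Suc i)}"
    have ce: "c (Suc i) \<le> b" using i by (intro cle) simp
    have sub: "?J \<subseteq> {0..b}" using cpos[of i] ce by auto
    have "integral {0..c i} (\<lambda>x. H x * F' x) + integral ?J (\<lambda>x. H x * F' x) = integral {0..c (Suc i)} (\<lambda>x. H x * F' x)"
      using ce cpos cmono
      by (intro Henstock_Kurzweil_Integration.integral_combine integrable_continuous_interval continuous_on_subset[OF cont]) auto
    then have diff: "P (c (Suc i)) - P (c i) = integral ?J (\<lambda>x. H x * F' x)" by (simp add: P_def)
    have FTC: "(F' has_integral (F (c (Suc i)) - F (c i))) ?J"
      using sub F by (intro fundamental_theorem_of_calculus cmono)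
        (auto simp: has_real_derivative_iff_has_vector_derivative[symmetric] intro: has_field_derivative_at_within)
    have int: "(\<lambda>x. H x * F' x) integrable_on ?J"
      by (intro integrable_continuous_interval continuous_on_subset[OF cont sub])
    have "((\<lambda>x. H y * F' x) has_integral (H y * (F (c (Suc i)) - F (c i)))) ?J" for y
      using FTC by (rule has_integral_mult_right)
    note const = this
    show ?thesis unfolding diff
    proof
      show "H (c (Suc i)) * (F (c (Suc i)) - F (c i)) \<le> integral ?J (\<lambda>x. H x * F' x)"
        by (rule has_integral_le[OF const integrable_integral[OF int]])
          (use ce cpos[of i] in \<open>auto intro!: mult_right_mono H(2) simp: F'(2)\<close>)
      show "integral ?J (\<lambda>x. H x * F' x) \<le> H (c i) * (F (c (Suc i)) - F (c i))"
        by (rule has_integral_le[OF integrable_integral[OF int] const])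
          (use ce cpos[of i] in \<open>auto intro!: mult_right_mono H(2) simp: F'(2)\<close>)
    qed
  qed
  have tele: "(\<Sum>i<R. P (c (Suc i)) - P (c i)) = integral {0..b} (\<lambda>x. H x * F' x)"
    by (subst sum_lessThan_telescope) (simp add: c0 cR P_def)
  have lo: "?L \<le> integral {0..b} (\<lambda>x. H x * F' x)" and up: "integral {0..b} (\<lambda>x. H x * F' x) \<le> ?U"
    unfolding tele[symmetric] using step by (auto intro!: sum_mono)
  have "?U - ?L = (\<Sum>i<R. (H (c i) - H (c (Suc i))) * (F (c (Suc i)) - F (c i)))"
    by (simp add: sum_subtractf[symmetric] left_diff_distrib)
  also have "\<dots> \<le> (\<Sum>i<R. (H (c i) - H (c (Suc i))) * (B * b / real R))"
  proof (rule sum_mono)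
    fix i assume i: "i \<in> {..<R}"
    then have ce: "c (Suc i) \<le> b" by (intro cle) simp
    have "F (c (Suc i)) - F (c i) \<le> B * b / real R"
    proof (cases "c i = c (Suc i)")
      case True
      have "0 \<le> B" using F'(2)[of 0] b by (meson order_refl order_trans)
      then show ?thesis using True b by simp
    next
      case False
      then have lt: "c i < c (Suc i)" using cmono[of i] by simp
      have "\<exists>z. c i < z \<and> z < c (Suc i) \<and> F (c (Suc i)) - F (c i) = (c (Suc i) - c i) * F' z"
        by (rule MVT2[OF lt F]) (use ce cpos[of i] in auto)
      then obtain z where z: "c i < z" "z < c (Suc i)" "F (c (Suc i)) - F (c i) = (c (Suc i) - c i) * F' z" by blast
      have "F' z \<le> B" using F'(2)[of z] z ce cpos[of i] by auto
      moreover have "c (Suc i) - c i = b / real R" by (simp add: c_def add_divide_distrib distrib_right)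
      ultimately show ?thesis using z(3) b mult_left_mono[of "F' z" B b]
        by (simp add: divide_right_mono mult.commute)
    qed
    moreover have "0 \<le> H (c i) - H (c (Suc i))" using H(2)[OF cpos cmono ce] by simp
    ultimately show "(H (c i) - H (c (Suc i))) * (F (c (Suc i)) - F (c i)) \<le> (H (c i) - H (c (Suc i))) * (B * b / real R)"
      by (rule mult_left_mono)
  qed
  also have "\<dots> = (H 0 - H b) * (B * b / real R)"
    using sum_lessThan_telescope'[of "\<lambda>i. H (c i)" R] by (simp only: sum_distrib_right[symmetric] c0 cR)
  also have "\<dots> \<le> 1 * (B * b / real R)"
  proof (rule mult_right_mono)
    show "H 0 - H b \<le> 1" using H(3)[of 0] H(3)[of b] b by auto
    have "0 \<le> B" using F'(2)[of 0] b by (meson order_refl order_trans)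
    then show "0 \<le> B * b / real R" using b by simp
  qed
  finally have "?U - ?L \<le> B * b / real R" by simp
  then show "?U \<le> integral {0..b} (\<lambda>x. H x * F' x) + B * b / real R"
    "integral {0..b} (\<lambda>x. H x * F' x) - B * b / real R \<le> ?L" using lo up by linarith+
qed

section \<open>Cycles of complete graphs\<close>

definition cyclic_arc :: "'v list \<Rightarrow> nat \<Rightarrow> 'v \<times> 'v" where
  "cyclic_arc xs i = (xs ! i, xs ! (Suc i mod length xs))"

lemma Suc_mod_less: "i < n \<Longrightarrow> Suc i mod n < n"
  by (rule mod_less_divisor) simp

lemma pcas_nth:
  "p \<noteq> [] \<Longrightarrow> pcas u p v \<longleftrightarrow>
     fst (hd p) = u \<and> snd (last p) = v \<and> (\<forall>i. Suc i < length p \<longrightarrow> snd (p ! i) = fst (p ! Suc i))"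
proof (induction p arbitrary: u)
  case (Cons a p)
  show ?case
  proof (cases "p = []")
    case False
    have "(\<forall>i. Suc i < length (a # p) \<longrightarrow> snd ((a # p) ! i) = fst ((a # p) ! Suc i)) \<longleftrightarrow>
        snd a = fst (hd p) \<and> (\<forall>i. Suc i < length p \<longrightarrow> snd (p ! i) = fst (p ! Suc i))"
      (is "?L \<longleftrightarrow> ?R")
    proof
      assume L: ?L
      have "snd a = fst (hd p)" using L[rule_format, of 0] False by (simp add: hd_conv_nth)
      moreover have "snd (p ! i) = fst (p ! Suc i)" if "Suc i < length p" for i
        using L[rule_format, of "Suc i"] that by simp
      ultimately show ?R by simp
    next
      assume ?R
      then show ?L using False by (auto simp: nth_Cons hd_conv_nth split: nat.split)
    qed
    then show ?thesis using False Cons.IH[of "snd a"] by (cases a) auto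
  qed (cases a; auto)
qed simp

text \<open>In a closed walk the heads are the tails shifted cyclically by one place, so the list of
  tails determines the walk.\<close>

lemma map_snd_eq_rotate1:
  assumes "p \<noteq> []" "snd (last p) = fst (hd p)" "\<And>i. Suc i < length p \<Longrightarrow> snd (p ! i) = fst (p ! Suc i)"
  shows "map snd p = rotate1 (map fst p)" "p = map (cyclic_arc (map fst p)) [0..<length p]"
proof -
  have *: "snd (p ! i) = map fst p ! (Suc i mod length p)" if "i < length p" for i
  proof (cases "Suc i = length p")
    case True
    then have "p ! i = last p" using assms(1) by (metis diff_Suc_1 last_conv_nth)
    then show ?thesis using True assms by (simp add: hd_conv_nth)
  qed (use that assms in auto)
  then show "map snd p = rotate1 (map fst p)"
    by (intro nth_equalityI) (auto simp: nth_rotate1)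
  show "p = map (cyclic_arc (map fst p)) [0..<length p]"
    using * by (intro nth_equalityI) (auto simp: cyclic_arc_def prod_eq_iff)
qed

text \<open>The vertex list is recovered as the tails of the arcs. The library demands distinct
  heads; these are a rotation of the tails, so both are distinct together. The absence of loops in
  \<open>Kn\<close> rules out a single arc and leaves length at least 2.\<close>

lemma cycle_Kn_iff:
  "pre_digraph.cycle (with_proj (Kn n)) p \<longleftrightarrow>
     (\<exists>xs. p = map (cyclic_arc xs) [0..<length xs] \<and> distinct xs \<and> 2 \<le> length xs \<and> set xs \<subseteq> {..<n})"
proof
  assume "pre_digraph.cycle (with_proj (Kn n)) p"
  then obtain u where p: "p \<noteq> []" "distinct (tl (pawalk_verts u p))" "set p \<subseteq> parcs (Kn n)" "pcas u p u"
    by (auto simp: pre_digraph.cycle_def pre_digraph.awalk_def cas_with_proj_eq awalk_verts_with_proj_eq)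
  have "pawalk_verts u p = u # map snd p"
    using p pre_digraph.awalk_verts_conv'[of "with_proj (Kn n)" u p u] pcas_nth[OF p(1)]
    by (simp add: cas_with_proj_eq awalk_verts_with_proj_eq)
  then have d: "distinct (map snd p)" using p(2) by simp
  from pcas_nth[OF p(1)] p(4) have nth: "snd (last p) = fst (hd p)" "\<And>i. Suc i < length p \<Longrightarrow> snd (p ! i) = fst (p ! Suc i)"
    by auto
  note r = map_snd_eq_rotate1[OF p(1) nth]
  have "length p \<noteq> 1"
  proof
    assume "length p = 1"
    then obtain a where "p = [a]" by (auto simp: length_Suc_conv)
    then show False using nth(1) p(3) by (auto simp: Kn_def)
  qed
  then have "2 \<le> length p" using p(1) by (cases p) (auto simp: Suc_le_eq)
  moreover have "distinct (map fst p)" using d r(1) by simp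
  moreover have "set (map fst p) \<subseteq> {..<n}" using p(3) by (auto simp: Kn_def)
  moreover have "p = map (cyclic_arc (map fst p)) [0..<length (map fst p)]" using r(2) unfolding length_map .
  ultimately show "\<exists>xs. p = map (cyclic_arc xs) [0..<length xs] \<and> distinct xs \<and> 2 \<le> length xs \<and> set xs \<subseteq> {..<n}"
    unfolding length_map by (intro exI[of _ "map fst p"] conjI) (assumption | simp only: length_map)+
next
  assume "\<exists>xs. p = map (cyclic_arc xs) [0..<length xs] \<and> distinct xs \<and> 2 \<le> length xs \<and> set xs \<subseteq> {..<n}"
  then obtain xs where p: "p = map (cyclic_arc xs) [0..<length xs]" and xs: "distinct xs" "2 \<le> length xs" "set xs \<subseteq> {..<n}"
    by auto
  have ne: "p \<noteq> []" using xs p by auto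
  have nth: "p ! i = cyclic_arc xs i" "length p = length xs" if "i < length xs" for i using that p by auto
  have cas: "pcas (xs ! 0) p (xs ! 0)"
    unfolding pcas_nth[OF ne]
  proof (intro conjI allI impI)
    have l: "0 < length xs" "length xs - 1 < length xs" using xs by auto
    show "fst (hd p) = xs ! 0" using ne nth l by (simp add: hd_conv_nth cyclic_arc_def)
    show "snd (last p) = xs ! 0" using ne nth(1)[OF l(2)] nth(2)[OF l(2)] l
      by (simp add: last_conv_nth cyclic_arc_def)
    fix i assume "Suc i < length p"
    then have i: "Suc i < length xs" using p by simp
    then show "snd (p ! i) = fst (p ! Suc i)" by (simp add: nth cyclic_arc_def)
  qed
  have fst: "map fst p = xs" by (intro nth_equalityI) (auto simp: p cyclic_arc_def)
  have "map snd p = rotate1 (map fst p)"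
    using cas unfolding pcas_nth[OF ne] by (intro map_snd_eq_rotate1 ne) auto
  then have d: "distinct (map snd p)" using fst xs by simp
  have "pawalk_verts (xs ! 0) p = xs ! 0 # map snd p"
    using cas pre_digraph.awalk_verts_conv'[of "with_proj (Kn n)" "xs ! 0" p "xs ! 0"] pcas_nth[OF ne] ne
    by (simp add: cas_with_proj_eq awalk_verts_with_proj_eq)
  moreover have "set p \<subseteq> parcs (Kn n)"
  proof
    fix a assume "a \<in> set p"
    then obtain i where i: "i < length xs" "a = cyclic_arc xs i" using p by auto
    then have l: "Suc i mod length xs < length xs" by (simp only: Suc_mod_less)
    have "Suc i mod length xs \<noteq> i" using i xs by (auto simp: mod_Suc)
    then have "xs ! i \<noteq> xs ! (Suc i mod length xs)" using xs(1) i(1) l by (simp add: nth_eq_iff_index_eq)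
    moreover have "xs ! i < n" "xs ! (Suc i mod length xs) < n" using xs(3) i(1) l nth_mem by blast+
    ultimately show "a \<in> parcs (Kn n)" by (simp add: i cyclic_arc_def Kn_def)
  qed
  moreover have "xs ! 0 \<in> pverts (Kn n)"
  proof -
    have "xs ! 0 \<in> set xs" using xs(2) by (intro nth_mem) auto
    then show ?thesis using xs(3) by (auto simp: Kn_def)
  qed
  ultimately show "pre_digraph.cycle (with_proj (Kn n)) p"
    using ne cas d by (auto simp: pre_digraph.cycle_def pre_digraph.awalk_def cas_with_proj_eq awalk_verts_with_proj_eq)
qed

text \<open>A vertex list stands for a closed walk and \<open>ed\<close> for the passage from arc to
  edge: \<open>id\<close> in the directed case, \<open>uedge\<close> in the undirected one. As a set
  of edges the cycle forgets its starting point, and under \<open>uedge\<close> its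
  direction.\<close>

definition cyc :: "(nat \<times> nat \<Rightarrow> 'e) \<Rightarrow> nat list \<Rightarrow> 'e set" where
  "cyc ed xs = (\<lambda>i. ed (cyclic_arc xs i)) ` {..<length xs}"

definition cycles_in :: "(nat \<times> nat \<Rightarrow> 'e) \<Rightarrow> nat \<Rightarrow> nat \<Rightarrow> 'e set set" where
  "cycles_in ed m n = {cyc ed xs |xs. distinct xs \<and> m \<le> length xs \<and> set xs \<subseteq> {..<n}}"

lemma image_set_cyclic_arcs: "ed ` set (map (cyclic_arc xs) [0..<length xs]) = cyc ed xs"
  unfolding cyc_def set_map set_upt atLeast0LessThan image_image ..

lemma cycles_in_eq:
  assumes "2 \<le> m"
  shows "{ed ` set p |p. pre_digraph.cycle (with_proj (Kn n)) p \<and> m \<le> length p} = cycles_in ed m n"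
proof (intro equalityI subsetI)
  fix C assume "C \<in> {ed ` set p |p. pre_digraph.cycle (with_proj (Kn n)) p \<and> m \<le> length p}"
  then obtain xs where "C = ed ` set (map (cyclic_arc xs) [0..<length xs])" "distinct xs" "m \<le> length xs" "set xs \<subseteq> {..<n}"
    unfolding cycle_Kn_iff by fastforce
  then show "C \<in> cycles_in ed m n" unfolding cycles_in_def image_set_cyclic_arcs by blast
next
  fix C assume "C \<in> cycles_in ed m n"
  then obtain xs where xs: "C = cyc ed xs" "distinct xs" "m \<le> length xs" "set xs \<subseteq> {..<n}"
    unfolding cycles_in_def by blast
  let ?p = "map (cyclic_arc xs) [0..<length xs]"
  have "pre_digraph.cycle (with_proj (Kn n)) ?p" unfolding cycle_Kn_iff using xs assms by (intro exI[of _ xs]) simp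
  moreover have "m \<le> length ?p" using xs by simp
  moreover have "C = ed ` set ?p" using xs image_set_cyclic_arcs by metis
  ultimately show "C \<in> {ed ` set p |p. pre_digraph.cycle (with_proj (Kn n)) p \<and> m \<le> length p}" by blast
qed

lemma directed_cycles_eq: "directed_cycles n = cycles_in id 2 n"
proof -
  have "2 \<le> length p" if "pre_digraph.cycle (with_proj (Kn n)) p" for p
    using that unfolding cycle_Kn_iff by auto
  then show ?thesis
    unfolding directed_cycles_def cycles_in_eq[OF order_refl, of id, symmetric] by auto
qed

lemma undirected_cycles_eq: "undirected_cycles n = cycles_in uedge 3 n"
  unfolding undirected_cycles_def by (rule cycles_in_eq) simp

text \<open>
  Directed and undirected edges at once: \<open>ends\<close> is the set of end points, \<open>\<mu>\<close> the number of
  orientations of an edge, \<open>m\<close> the least length of a cycle.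
\<close>

locale edge_kind =
  fixes ed :: "nat \<times> nat \<Rightarrow> 'e" and ends :: "'e \<Rightarrow> nat set" and m \<mu> :: nat
  assumes ends: "ends (ed (u, v)) = {u, v}"
    and ed_eq: "ed a = ed b \<Longrightarrow> a = b \<or> a = prod.swap b \<and> (\<forall>c. ed (prod.swap c) = ed c)"
    and card_orientations: "u \<noteq> v \<Longrightarrow> card {a. ed a = ed (u, v)} = \<mu>"
    and m: "2 \<le> m"
    and inj: "distinct xs \<Longrightarrow> m \<le> length xs \<Longrightarrow> inj_on (\<lambda>i. ed (cyclic_arc xs i)) {..<length xs}"
begin

lemma ends_cyc:
  assumes "e \<in> cyc ed xs" shows "ends e \<subseteq> set xs"
proof -
  from assms obtain i where i: "i < length xs" "e = ed (cyclic_arc xs i)" by (auto simp: cyc_def)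
  then have "Suc i mod length xs < length xs" by (simp only: Suc_mod_less)
  then show ?thesis using i by (auto simp: cyclic_arc_def ends)
qed

lemma card_cyc:
  assumes "distinct xs" "m \<le> length xs" shows "card (cyc ed xs) = length xs"
  unfolding cyc_def using card_image[OF inj[OF assms]] by simp

lemma finite_cyc: "finite (cyc ed xs)" by (simp add: cyc_def)

text \<open>Let \<open>I\<close> index the edges of \<open>ys\<close> that are shared and
  \<open>J\<close> its shared vertices. Both ends of a shared edge are shared vertices, so
  \<open>I\<close> and its cyclic successors lie in \<open>J\<close>. If there are no more shared
  vertices than shared edges, then \<open>I = J\<close>; hence \<open>I\<close> is closed under the
  cyclic successor and, being nonempty, contains every index.\<close>

lemma cyc_subset_cyc:
  assumes xs: "distinct xs" "m \<le> length xs" and ys: "distinct ys" "m \<le> length ys"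
    and ne: "cyc ed xs \<inter> cyc ed ys \<noteq> {}"
    and le: "card (set xs \<inter> set ys) \<le> card (cyc ed xs \<inter> cyc ed ys)"
  shows "cyc ed ys \<subseteq> cyc ed xs"
proof -
  let ?l = "length ys"
  define I where "I = {i. i < ?l \<and> ed (cyclic_arc ys i) \<in> cyc ed xs}"
  define J where "J = {i. i < ?l \<and> ys ! i \<in> set xs}"
  have suc: "i \<in> J" "Suc i mod ?l \<in> J" if "i \<in> I" for i
  proof -
    from that have "ends (ed (cyclic_arc ys i)) \<subseteq> set xs" "i < ?l" by (auto simp: I_def dest: ends_cyc)
    moreover from this(2) have "Suc i mod ?l < ?l" by (rule Suc_mod_less)
    ultimately show "i \<in> J" "Suc i mod ?l \<in> J" by (auto simp: J_def cyclic_arc_def ends)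
  qed
  have "cyc ed xs \<inter> cyc ed ys = (\<lambda>i. ed (cyclic_arc ys i)) ` I" unfolding I_def cyc_def[of _ ys] by blast
  then have "card (cyc ed xs \<inter> cyc ed ys) = card I"
    using inj_on_subset[OF inj[OF ys], of I] by (simp add: card_image I_def subset_iff)
  moreover have "set xs \<inter> set ys = (\<lambda>i. ys ! i) ` J" unfolding J_def set_conv_nth[of ys] by blast
  then have "card (set xs \<inter> set ys) = card J"
    using inj_on_subset[OF inj_on_nth[OF ys(1), of J]] by (simp add: card_image J_def)
  ultimately have "I = J" using le suc(1) by (intro card_seteq) (auto simp: J_def)
  then have closed: "Suc i mod ?l \<in> I" if "i \<in> I" for i using suc(2)[OF that] by simp
  obtain i0 where i0: "i0 \<in> I" using ne unfolding I_def cyc_def[of _ ys] by blast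
  have step: "(i0 + r) mod ?l \<in> I" for r
  proof (induction r)
    case 0 then show ?case using i0 by (simp add: I_def)
  next
    case (Suc r)
    from closed[OF this] show ?case by (simp add: mod_Suc_eq)
  qed
  have "t \<in> I" if "t < ?l" for t
  proof -
    have "i0 < ?l" using i0 by (simp add: I_def)
    then have "(i0 + (?l - i0 + t)) mod ?l = t" using that by simp
    then show ?thesis using step by metis
  qed
  then show ?thesis by (auto simp: cyc_def[of _ ys] I_def)
qed

text \<open>A cycle has as many vertices as edges, so by inclusion-exclusion it is enough that the
  two share more vertices than edges. Otherwise \<open>cyc_subset_cyc\<close> applies in both
  directions and the cycles coincide.\<close>

lemma card_Un_set_less_cyc:
  assumes xs: "distinct xs" "m \<le> length xs" and ys: "distinct ys" "m \<le> length ys"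
    and ne: "cyc ed xs \<inter> cyc ed ys \<noteq> {}" "cyc ed xs \<noteq> cyc ed ys"
  shows "card (set xs \<union> set ys) < card (cyc ed xs \<union> cyc ed ys)"
proof -
  have "card (cyc ed xs \<inter> cyc ed ys) < card (set xs \<inter> set ys)"
  proof (rule ccontr)
    assume "\<not> ?thesis"
    then have le: "card (set xs \<inter> set ys) \<le> card (cyc ed xs \<inter> cyc ed ys)" by simp
    then have "cyc ed ys \<subseteq> cyc ed xs" by (intro cyc_subset_cyc xs ys ne)
    moreover have "cyc ed xs \<subseteq> cyc ed ys"
      using le ne(1) by (intro cyc_subset_cyc xs ys) (simp_all add: Int_commute)
    ultimately show False using ne(2) by simp
  qed
  moreover have "card (cyc ed xs) + card (cyc ed ys) = card (cyc ed xs \<union> cyc ed ys) + card (cyc ed xs \<inter> cyc ed ys)"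
    by (intro card_Un_Int finite_cyc)
  moreover have "card (set xs) + card (set ys) = card (set xs \<union> set ys) + card (set xs \<inter> set ys)"
    by (intro card_Un_Int) auto
  moreover have "card (cyc ed xs) = card (set xs)" "card (cyc ed ys) = card (set ys)"
    using card_cyc xs ys by (simp_all add: distinct_card)
  ultimately show ?thesis by linarith
qed

text \<open>The list is recovered step by step: the edge leaving \<open>xs ! Suc i\<close> lies in
  the other cycle too, where the only edges at that vertex are the one just used and the next.
  Carrying two consecutive vertices through the induction fixes the direction.\<close>

lemma cyc_inject:
  assumes xs: "distinct xs" "m \<le> length xs" and ys: "distinct ys" "m \<le> length ys"
    and eq: "cyc ed xs = cyc ed ys" and start: "xs ! 0 = ys ! 0" "xs ! 1 = ys ! 1"
  shows "xs = ys"
proof -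
  have len: "length xs = length ys" using card_cyc[OF xs] card_cyc[OF ys] eq by simp
  have "Suc i < length xs \<longrightarrow> xs ! i = ys ! i \<and> xs ! Suc i = ys ! Suc i" for i
  proof (induction i)
    case 0
    then show ?case using start by simp
  next
    case (Suc i)
    show ?case
    proof
      assume i: "Suc (Suc i) < length xs"
      with Suc have IH: "xs ! i = ys ! i" "xs ! Suc i = ys ! Suc i" by auto
      have "ed (cyclic_arc xs (Suc i)) \<in> cyc ed ys"
        using i eq[symmetric] by (auto simp: cyc_def)
      then obtain k where k: "k < length ys" "ed (cyclic_arc xs (Suc i)) = ed (cyclic_arc ys k)"
        by (auto simp: cyc_def)
      define k' where "k' = Suc k mod length ys"
      have k': "k' < length ys" using Suc_mod_less[OF k(1)] by (simp add: k'_def)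
      have "{xs ! Suc i, xs ! Suc (Suc i)} = {ys ! k, ys ! k'}"
        using arg_cong[OF k(2), of ends] i by (simp add: cyclic_arc_def ends k'_def)
      then consider "ys ! Suc i = ys ! k" "xs ! Suc (Suc i) = ys ! k'"
        | "ys ! Suc i = ys ! k'" "xs ! Suc (Suc i) = ys ! k"
        using IH by (auto simp: doubleton_eq_iff)
      then have "xs ! Suc (Suc i) = ys ! Suc (Suc i)"
      proof cases
        case 1
        then have "k = Suc i" using ys(1) k(1) i len by (simp add: nth_eq_iff_index_eq)
        then show ?thesis using 1 i len by (simp add: k'_def)
      next
        \<comment> \<open>Going back along the edge just used would make \<open>xs\<close> return to
          \<open>xs ! i\<close>, against distinctness.\<close>
        case 2
        then have "Suc i = k'" using ys(1) k' i len by (simp add: nth_eq_iff_index_eq)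
        then have "k = i" using k(1) by (auto simp: k'_def mod_Suc split: if_splits)
        then have "xs ! Suc (Suc i) = xs ! i" using 2 IH by simp
        then show ?thesis using xs(1) i by (simp add: nth_eq_iff_index_eq)
      qed
      then show "xs ! Suc i = ys ! Suc i \<and> xs ! Suc (Suc i) = ys ! Suc (Suc i)" using IH by simp
    qed
  qed
  note * = this
  show ?thesis
  proof (rule nth_equalityI[OF len])
    fix i assume i: "i < length xs"
    show "xs ! i = ys ! i"
    proof (cases i)
      case 0 then show ?thesis using start by simp
    next
      case (Suc k) then show ?thesis using *[of k] i by simp
    qed
  qed
qed

section \<open>Rotations, reversals and the number of cycles\<close>

lemma cyclic_arc_rotate:
  assumes "i < length xs"
  shows "cyclic_arc (rotate r xs) i = cyclic_arc xs ((r + i) mod length xs)"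
proof -
  have "Suc i mod length xs < length xs" using assms by (rule Suc_mod_less)
  then show ?thesis using assms
    by (simp add: cyclic_arc_def nth_rotate mod_add_right_eq mod_Suc_eq)
qed

lemma cyc_rotate: "cyc ed (rotate r xs) = cyc ed xs"
proof -
  let ?j = "length xs"
  have img: "(\<lambda>i. (r + i) mod ?j) ` {..<?j} = {..<?j}"
  proof (intro equalityI subsetI)
    fix t assume t: "t \<in> {..<?j}"
    then have j: "0 < ?j" by (cases xs) auto
    \<comment> \<open>The preimage of t is t - r modulo the length, written without negative
      numbers.\<close>
    let ?i = "(t + (?j - r mod ?j)) mod ?j"
    have "r + (t + (?j - r mod ?j)) = t + ?j * Suc (r div ?j)"
      using mult_div_mod_eq[of ?j r] mod_less_divisor[OF j, of r] unfolding mult_Suc_right by linarith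
    then have "(r + ?i) mod ?j = t mod ?j" by (simp only: mod_add_right_eq mod_mult_self2)
    then have "(r + ?i) mod ?j = t" using t by simp
    then show "t \<in> (\<lambda>i. (r + i) mod ?j) ` {..<?j}"
      using j by (intro image_eqI[of _ _ ?i]) auto
  qed (auto intro: mod_less_divisor)
  have "cyc ed (rotate r xs) = (\<lambda>i. ed (cyclic_arc xs ((r + i) mod ?j))) ` {..<?j}"
    unfolding cyc_def by (auto simp: cyclic_arc_rotate intro!: image_cong)
  also have "\<dots> = (\<lambda>i. ed (cyclic_arc xs i)) ` ((\<lambda>i. (r + i) mod ?j) ` {..<?j})"
    by (simp add: image_image)
  finally show ?thesis by (simp only: img cyc_def)
qed

lemma cyclic_arc_rev:
  assumes "i < length xs"
  shows "\<exists>k<length xs. cyclic_arc (rev xs) i = prod.swap (cyclic_arc xs k)"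
proof (cases "Suc i = length xs")
  case True
  then have "length xs - Suc 0 = i" "rev xs ! 0 = xs ! (length xs - Suc 0)"
    by (auto intro: rev_nth)
  with True show ?thesis using assms
    by (intro exI[of _ i]) (auto simp: cyclic_arc_def rev_nth)
next
  case False
  with assms have "Suc i < length xs" by simp
  then show ?thesis
    by (intro exI[of _ "length xs - Suc (Suc i)"]) (auto simp: cyclic_arc_def rev_nth Suc_diff_Suc)
qed

lemma cyc_rev_subset:
  assumes "\<And>c. ed (prod.swap c) = ed c"
  shows "cyc ed (rev xs) \<subseteq> cyc ed xs"
proof
  fix e assume "e \<in> cyc ed (rev xs)"
  then obtain i where i: "i < length xs" "e = ed (cyclic_arc (rev xs) i)" by (auto simp: cyc_def)
  from cyclic_arc_rev[OF i(1)] obtain k where "k < length xs" "cyclic_arc (rev xs) i = prod.swap (cyclic_arc xs k)"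
    by auto
  then show "e \<in> cyc ed xs" using i assms by (auto simp: cyc_def)
qed

lemma cyc_rev:
  assumes "\<And>c. ed (prod.swap c) = ed c"
  shows "cyc ed (rev xs) = cyc ed xs"
  using cyc_rev_subset[OF assms, of xs] cyc_rev_subset[OF assms, of "rev xs"] by auto

text \<open>For j at least m, such a list is a cycle of length j together with a starting point and
  a direction of traversal; dividing by the number of these choices counts the cycles.\<close>

definition rooted :: "nat \<Rightarrow> nat \<Rightarrow> nat list set" where
  "rooted n j = {xs. length xs = j \<and> distinct xs \<and> set xs \<subseteq> {..<n}}"

lemma finite_rooted: "finite (rooted n j)"
  unfolding rooted_def using finite_lists_length_eq[of "{..<n}" j] by (rule finite_subset[rotated]) auto

text \<open>A rotation brings any arc of the list to the front. If the list runs through the edge in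
  the other direction, it is reversed beforehand; by \<open>ed_eq\<close> this case arises only when
  \<open>ed\<close> ignores orientation.\<close>

lemma rooted_start_exists:
  assumes xs: "xs \<in> rooted n j" "m \<le> j" and a: "ed (u, v) \<in> cyc ed xs"
  shows "\<exists>ys\<in>rooted n j. cyc ed ys = cyc ed xs \<and> ys ! 0 = u \<and> ys ! 1 = v"
proof -
  have rot: "\<exists>ys\<in>rooted n j. cyc ed ys = cyc ed zs \<and> (ys ! 0, ys ! 1) = cyclic_arc zs i"
    if "zs \<in> rooted n j" "i < j" for zs i
  proof (intro bexI conjI)
    have "1 < j" "length zs = j" using xs(2) m that by (auto simp: rooted_def)
    then show "(rotate i zs ! 0, rotate i zs ! 1) = cyclic_arc zs i"
      using that(2) by (auto simp: cyclic_arc_def nth_rotate)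
  qed (use that in \<open>auto simp: rooted_def cyc_rotate\<close>)
  from a obtain i where i: "i < j" "ed (u, v) = ed (cyclic_arc xs i)" using xs by (auto simp: cyc_def rooted_def)
  from ed_eq[OF i(2)] show ?thesis
  proof
    assume "(u, v) = cyclic_arc xs i"
    then show ?thesis using rot[OF xs(1) i(1)] by (metis Pair_inject)
  next
    assume s: "(u, v) = prod.swap (cyclic_arc xs i) \<and> (\<forall>c. ed (prod.swap c) = ed c)"
    have r: "rev xs \<in> rooted n j" using xs by (simp add: rooted_def)
    obtain k where k: "k < j" "cyclic_arc (rev xs) k = prod.swap (cyclic_arc xs i)"
      using cyclic_arc_rev[of i "rev xs"] i(1) xs(1) by (auto simp: rooted_def)
    then show ?thesis using rot[OF r k(1)] s cyc_rev[of xs] by (metis Pair_inject)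
  qed
qed

text \<open>By \<open>cyc_inject\<close> a list with the given cycle is determined by its first arc,
  and every orientation of every edge of the cycle occurs as a first arc. There are j edges with
  \<mu> orientations each.\<close>

lemma card_rooted_fibre:
  assumes xs: "xs \<in> rooted n j" "m \<le> j"
  shows "card {ys \<in> rooted n j. cyc ed ys = cyc ed xs} = \<mu> * j"
proof -
  let ?F = "{ys \<in> rooted n j. cyc ed ys = cyc ed xs}"
  let ?f = "\<lambda>ys :: nat list. (ys ! 0, ys ! 1)"
  have l: "distinct ys" "length ys = j" if "ys \<in> rooted n j" for ys using that by (auto simp: rooted_def)
  have "card (?f ` ?F) = card ?F"
  proof (intro card_image inj_onI)
    fix ys zs assume "ys \<in> ?F" "zs \<in> ?F" "?f ys = ?f zs"
    then show "ys = zs" using l xs(2) by (intro cyc_inject) auto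
  qed
  moreover have "?f ` ?F = {a. ed a \<in> cyc ed xs}"
  proof safe
    fix ys assume ys: "ys \<in> rooted n j" and eq: "cyc ed ys = cyc ed xs"
    have "1 < j" using xs(2) m by simp
    then have "ed (cyclic_arc ys 0) \<in> cyc ed ys" using l[OF ys] by (auto simp: cyc_def)
    then show "ed (ys ! 0, ys ! 1) \<in> cyc ed xs" using eq l[OF ys] \<open>1 < j\<close> by (simp add: cyclic_arc_def)
  next
    fix u v assume "ed (u, v) \<in> cyc ed xs"
    from rooted_start_exists[OF xs this]
    obtain ys where "ys \<in> rooted n j" "cyc ed ys = cyc ed xs" "ys ! 0 = u" "ys ! 1 = v" by blast
    then show "(u, v) \<in> ?f ` ?F" by (intro image_eqI[of _ _ ys]) simp_all
  qed
  ultimately have "card ?F = card {a. ed a \<in> cyc ed xs}" by (simp only:)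
  also have "{a. ed a \<in> cyc ed xs} = (\<Union>e\<in>cyc ed xs. {a. ed a = e})" by auto
  also have "card \<dots> = (\<Sum>e\<in>cyc ed xs. card {a. ed a = e})"
  proof (rule card_UN_disjoint[OF finite_cyc])
    show "\<forall>e\<in>cyc ed xs. finite {a. ed a = e}"
    proof
      fix e assume "e \<in> cyc ed xs"
      have "{a. ed a = e} \<subseteq> set xs \<times> set xs"
      proof safe
        fix u v assume "e = ed (u, v)"
        then have "{u, v} \<subseteq> set xs" using ends_cyc[OF \<open>e \<in> cyc ed xs\<close>] ends by simp
        then show "u \<in> set xs" "v \<in> set xs" by auto
      qed
      then show "finite {a. ed a = e}" by (rule finite_subset) simp
    qed
  qed auto
  also have "\<dots> = (\<Sum>e\<in>cyc ed xs. \<mu>)"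
  proof (rule sum.cong[OF refl])
    fix e assume "e \<in> cyc ed xs"
    then obtain i where i: "i < j" "e = ed (cyclic_arc xs i)" using l[OF xs(1)] by (auto simp: cyc_def)
    have "Suc i mod j < j" "Suc i mod j \<noteq> i" using i xs(2) m by (auto simp: mod_Suc)
    then have "xs ! i \<noteq> xs ! (Suc i mod j)" using l[OF xs(1)] i(1) by (simp add: nth_eq_iff_index_eq)
    then show "card {a. ed a = e} = \<mu>" using l[OF xs(1)] i by (simp add: cyclic_arc_def card_orientations)
  qed
  also have "\<dots> = \<mu> * j" using card_cyc[of xs] l[OF xs(1)] xs(2) by simp
  finally show ?thesis .
qed

lemma cycles_of_length_eq:
  assumes "m \<le> j"
  shows "{C \<in> cycles_in ed m n. card C = j} = cyc ed ` rooted n j"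
  using assms by (auto simp: cycles_in_def rooted_def card_cyc)

lemma card_cycles_rooted:
  assumes "m \<le> j"
  shows "\<mu> * j * card {C \<in> cycles_in ed m n. card C = j} = card (rooted n j)"
proof -
  have "card (rooted n j) = (\<Sum>xs\<in>rooted n j. 1)" by simp
  also have "\<dots> = (\<Sum>C\<in>cyc ed ` rooted n j. \<Sum>xs | xs \<in> rooted n j \<and> cyc ed xs = C. 1)"
    by (rule sum.image_gen[OF finite_rooted])
  also have "\<dots> = (\<Sum>C\<in>cyc ed ` rooted n j. \<mu> * j)"
    using card_rooted_fibre assms by (intro sum.cong) auto
  finally show ?thesis by (simp add: cycles_of_length_eq[OF assms])
qed

lemma card_cycles_le:
  assumes "m \<le> j"
  shows "\<mu> * j * card {C \<in> cycles_in ed m n. card C = j} \<le> n ^ j"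
proof -
  have "card (rooted n j) \<le> card {xs. set xs \<subseteq> {..<n} \<and> length xs = j}"
    by (intro card_mono finite_lists_length_eq) (auto simp: rooted_def)
  then show ?thesis using card_cycles_rooted[OF assms] by (simp add: card_lists_length_eq)
qed

text \<open>The number of lists is a falling factorial, a product of j factors larger than n - j.
  Together with the upper bound n^j this is sharp to leading order for fixed j.\<close>

lemma card_cycles_ge:
  assumes "m \<le> j" "j \<le> n"
  shows "(n - j) ^ j \<le> \<mu> * j * card {C \<in> cycles_in ed m n. card C = j}"
proof -
  have "(n - j) ^ j = (\<Prod>i\<in>{n - j + 1..n}. n - j)" using assms by simp
  also have "\<dots> \<le> \<Prod>{n - j + 1..n}" by (intro prod_mono) auto
  also have "\<dots> = card (rooted n j)"
    using card_lists_distinct_length_eq[of "{..<n}" j] assms by (simp add: rooted_def)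
  finally show ?thesis using card_cycles_rooted[OF assms(1)] by simp
qed

lemma cycles_in_subset:
  assumes "C \<in> cycles_in ed m n"
  shows "C \<subseteq> ed ` parcs (Kn n)"
proof -
  from assms obtain p where "C = ed ` set p" "pre_digraph.cycle (with_proj (Kn n)) p"
    unfolding cycles_in_eq[OF m, symmetric] by blast
  then show ?thesis by (auto simp: pre_digraph.cycle_def pre_digraph.awalk_def)
qed

lemma card_cycles_in_ge: "C \<in> cycles_in ed m n \<Longrightarrow> m \<le> card C"
  by (auto simp: cycles_in_def card_cyc)

lemma orientations_pos: "0 < \<mu>"
proof -
  have "finite {a. ed a = ed (0, 1)}"
    by (rule finite_subset[of _ "{0, 1} \<times> {0, 1}"]) (auto dest: ed_eq)
  moreover have "(0, 1) \<in> {a. ed a = ed (0, 1)}" by simp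
  ultimately show ?thesis using card_orientations[of 0 1] card_gt_0_iff by (metis empty_iff zero_neq_one)
qed

text \<open>By \<open>card_Un_set_less_cyc\<close> a union with s + 1 edges has at most s vertices.
  Hence the pair is described by a vector of s vertices and two lists of positions in it. The lists
  have length at most K and entries below 2K, so their number depends on K alone, while there are
  n^s vectors.\<close>

lemma overlapping_pairs_bound:
  "\<exists>B. \<forall>n s. card {(C, D). C \<in> cycles_in ed m n \<and> D \<in> cycles_in ed m n \<and> card C \<le> K \<and> card D \<le> K \<and>
      C \<noteq> D \<and> C \<inter> D \<noteq> {} \<and> card (C \<union> D) = Suc s} \<le> B * n ^ s"
proof (intro exI allI)
  fix n s :: nat
  let ?idx = "{is. set is \<subseteq> {..<2 * K} \<and> length is \<le> K}"
  let ?vec = "{us. set us \<subseteq> {..<n} \<and> length us = s}"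
  let ?P = "{(C, D). C \<in> cycles_in ed m n \<and> D \<in> cycles_in ed m n \<and> card C \<le> K \<and> card D \<le> K \<and>
      C \<noteq> D \<and> C \<inter> D \<noteq> {} \<and> card (C \<union> D) = Suc s}"
  let ?g = "\<lambda>us is. cyc ed (map ((!) us) is)"
  let ?f = "\<lambda>((is, js), us). (?g us is, ?g us js)"
  have fin: "finite ?idx" "finite ?vec" by (simp_all add: finite_lists_length_le finite_lists_length_eq)
  have "?P \<subseteq> ?f ` ((?idx \<times> ?idx) \<times> ?vec)"
  proof
    fix p assume "p \<in> ?P"
    then obtain C D where p: "p = (C, D)" and CD: "C \<in> cycles_in ed m n" "D \<in> cycles_in ed m n" "card C \<le> K" "card D \<le> K"
      "C \<noteq> D" "C \<inter> D \<noteq> {}" "card (C \<union> D) = Suc s" by blast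
    from CD(1,2) obtain xs ys where xs: "C = cyc ed xs" "distinct xs" "m \<le> length xs" "set xs \<subseteq> {..<n}"
      and ys: "D = cyc ed ys" "distinct ys" "m \<le> length ys" "set ys \<subseteq> {..<n}" by (auto simp: cycles_in_def)
    let ?S = "set xs \<union> set ys"
    have len: "length xs \<le> K" "length ys \<le> K" using CD xs ys card_cyc by auto
    have S: "card ?S \<le> s" using card_Un_set_less_cyc[of xs ys] xs ys CD by auto
    have "Suc s \<le> card C + card D" using card_Un_le[of C D] CD by simp
    then have s: "s < 2 * K" using CD(3,4) by simp
    have "xs ! 0 \<in> ?S" using xs(3) m by (intro UnI1 nth_mem) linarith
    \<comment> \<open>Padding with a repeated vertex gives the vector length exactly s even if fewer
      vertices occur.\<close>
    define us where "us = sorted_list_of_set ?S @ replicate (s - card ?S) (xs ! 0)"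
    have us: "set us = ?S" "length us = s"
      using S \<open>xs ! 0 \<in> ?S\<close> by (auto simp: us_def)
    have idx: "\<exists>is. set is \<subseteq> {..<s} \<and> length is = length zs \<and> map ((!) us) is = zs" if "set zs \<subseteq> ?S" for zs
    proof -
      have "\<forall>z\<in>set zs. \<exists>i<s. us ! i = z" using that us by (metis in_set_conv_nth subsetD)
      then obtain h where h: "\<And>z. z \<in> set zs \<Longrightarrow> h z < s \<and> us ! h z = z" by metis
      then show ?thesis by (intro exI[of _ "map h zs"]) (auto simp: map_idI)
    qed
    from idx[of xs] obtain "is" where "is": "set is \<subseteq> {..<s}" "length is = length xs" "map ((!) us) is = xs" by auto
    from idx[of ys] obtain js where js: "set js \<subseteq> {..<s}" "length js = length ys" "map ((!) us) js = ys" by auto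
    have "is \<in> ?idx" "js \<in> ?idx" using "is" js len s by auto
    moreover have "us \<in> ?vec" using us xs ys by auto
    ultimately have "((is, js), us) \<in> (?idx \<times> ?idx) \<times> ?vec" by simp
    moreover have "p = ?f ((is, js), us)" using p xs ys "is" js by simp
    ultimately show "p \<in> ?f ` ((?idx \<times> ?idx) \<times> ?vec)" by (rule image_eqI[rotated])
  qed
  then have "card ?P \<le> card ((?idx \<times> ?idx) \<times> ?vec)"
    using fin by (intro surj_card_le) auto
  also have "\<dots> = (card ?idx)\<^sup>2 * n ^ s"
    by (simp add: card_cartesian_product card_lists_length_eq power2_eq_square)
  finally show "card ?P \<le> (card ?idx)\<^sup>2 * n ^ s" .
qed

end

interpretation directed: edge_kind "id :: nat \<times> nat \<Rightarrow> nat \<times> nat" "\<lambda>(u, v). {u, v}" 2 1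
proof
  fix xs :: "nat list" assume "distinct xs" "2 \<le> length xs"
  then show "inj_on (\<lambda>i. id (cyclic_arc xs i)) {..<length xs}"
    by (auto simp: inj_on_def cyclic_arc_def nth_eq_iff_index_eq)
qed auto

interpretation undirected: edge_kind uedge id 3 2
proof
  fix xs :: "nat list" assume xs: "distinct xs" "3 \<le> length xs"
  show "inj_on (\<lambda>i. uedge (cyclic_arc xs i)) {..<length xs}"
  proof (rule inj_onI)
    fix i k assume ik: "i \<in> {..<length xs}" "k \<in> {..<length xs}" and eq: "uedge (cyclic_arc xs i) = uedge (cyclic_arc xs k)"
    then have lt: "Suc i mod length xs < length xs" "Suc k mod length xs < length xs" by (auto intro: Suc_mod_less)
    from eq ik lt xs(1) have "i = k \<or> i = Suc k mod length xs \<and> Suc i mod length xs = k"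
      by (auto simp: uedge_def cyclic_arc_def doubleton_eq_iff nth_eq_iff_index_eq)
    \<comment> \<open>In the other case the two arcs are reverse to each other, which would make the
      length a divisor of 2.\<close>
    then show "i = k" using xs(2) ik by (auto simp: mod_Suc split: if_splits)
  qed
next
  fix u v :: nat assume "u \<noteq> v"
  then have "{a. uedge a = uedge (u, v)} = {(u, v), (v, u)}" by (auto simp: uedge_def doubleton_eq_iff)
  then show "card {a. uedge a = uedge (u, v)} = 2" using \<open>u \<noteq> v\<close> by simp
next
  fix a b assume "uedge a = uedge b"
  then show "a = b \<or> a = prod.swap b \<and> (\<forall>c. uedge (prod.swap c) = uedge c)"
    by (cases a; cases b) (auto simp: uedge_def doubleton_eq_iff)
qed (auto simp: uedge_def)

section \<open>The min mean-weight cycle\<close>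

text \<open>What the probabilistic argument needs of complete graphs besides the weights: the number
  of cycles of length j is n^j / (\<mu> j) to leading order, and overlapping pairs are rarer by one
  power of n than the number of edges in their union suggests. Each n has a probability space of its
  own.\<close>

locale cycle_model =
  fixes E :: "nat \<Rightarrow> 'e set" and \<C> :: "nat \<Rightarrow> 'e set set" and m \<mu> :: nat
    and M :: "nat \<Rightarrow> 'a measure" and W :: "nat \<Rightarrow> 'e \<Rightarrow> 'a \<Rightarrow> real"
  assumes iid: "iid_exponential_family (M n) (E n) (W n)"
    and sub_E: "C \<in> \<C> n \<Longrightarrow> C \<subseteq> E n"
    and card_ge: "C \<in> \<C> n \<Longrightarrow> m \<le> card C"
    and m: "2 \<le> m" and \<mu>: "0 < \<mu>"
    and count_le: "m \<le> j \<Longrightarrow> \<mu> * j * card {C \<in> \<C> n. card C = j} \<le> n ^ j"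
    and count_ge: "m \<le> j \<Longrightarrow> j \<le> n \<Longrightarrow> (n - j) ^ j \<le> \<mu> * j * card {C \<in> \<C> n. card C = j}"
    and overlap: "\<exists>B. \<forall>n s. card {(C, D). C \<in> \<C> n \<and> D \<in> \<C> n \<and> card C \<le> K \<and> card D \<le> K \<and>
      C \<noteq> D \<and> C \<inter> D \<noteq> {} \<and> card (C \<union> D) = Suc s} \<le> B * n ^ s"
begin

sublocale iid: iid_exponential_family "M n" "E n" "W n" for n by (rule iid)

lemma finite_\<C>: "finite (\<C> n)"
  using iid.finite_E[of n] sub_E by (intro finite_subset[of "\<C> n" "Pow (E n)"]) auto

lemma card_pos: "C \<in> \<C> n \<Longrightarrow> 0 < card C"
  using card_ge[of C n] m by auto

lemma nonempty: "C \<in> \<C> n \<Longrightarrow> C \<noteq> {}"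
  using card_pos[of C n] by auto

abbreviation wt :: "nat \<Rightarrow> 'a \<Rightarrow> 'e set \<Rightarrow> real" where "wt n \<omega> \<equiv> weight (\<lambda>e. W n e \<omega>)"
abbreviation mw :: "nat \<Rightarrow> 'a \<Rightarrow> 'e set \<Rightarrow> real" where "mw n \<omega> \<equiv> mean_weight (\<lambda>e. W n e \<omega>)"

lemma mean_weight_le_iff: "C \<in> \<C> n \<Longrightarrow> mean_weight w C \<le> t \<longleftrightarrow> weight w C \<le> real (card C) * t"
  using card_pos[of C n] by (simp add: mean_weight_def divide_le_eq mult.commute)

definition short :: "nat \<Rightarrow> nat \<Rightarrow> 'e set set" where "short K n = {C \<in> \<C> n. card C \<le> K}"

text \<open>The threshold may depend on the length, since later the threshold of length k alone is
  moved. It is stated for the weight rather than the mean weight because the Erlang bounds apply to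
  the weight.\<close>

definition cheap :: "(nat \<Rightarrow> real) \<Rightarrow> nat \<Rightarrow> 'e set \<Rightarrow> 'a set" where
  "cheap a n C = {\<omega> \<in> space (M n). wt n \<omega> C \<le> real (card C) * a (card C) / real n}"

lemma finite_short: "finite (short K n)" using finite_\<C> by (simp add: short_def)

lemma cheap_events[measurable]: "C \<in> \<C> n \<Longrightarrow> cheap a n C \<in> sets (M n)"
  unfolding cheap_def using iid.measurable_weight[OF sub_E] by measurable

lemma prob_cheap_bounds:
  assumes "C \<in> \<C> n" "0 \<le> a (card C)"
  defines "x \<equiv> real (card C) * a (card C) / real n"
  shows "measure (M n) (cheap a n C) \<le> x ^ card C / fact (card C)"
    and "exp (- x) * x ^ card C / fact (card C) \<le> measure (M n) (cheap a n C)"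
  unfolding cheap_def x_def
  using assms(2) by (intro iid.weight_cdf_bounds sub_E[OF assms(1)] nonempty[OF assms(1)]; simp)+

lemma card_cycles_of_length_le:
  assumes "m \<le> j" "0 < n"
  shows "real (card {C \<in> \<C> n. card C = j}) * (x / real n) ^ j \<le> \<bar>x\<bar> ^ j / (real \<mu> * real j)"
proof -
  have pos: "0 < real \<mu> * real j" using \<mu> m assms by simp
  have "real \<mu> * real j * real (card {C \<in> \<C> n. card C = j}) \<le> real n ^ j"
    using count_le[OF assms(1), of n] by (metis of_nat_le_iff of_nat_mult of_nat_power)
  then have "real (card {C \<in> \<C> n. card C = j}) \<le> real n ^ j / (real \<mu> * real j)"
    using pos by (simp add: pos_le_divide_eq mult.commute)
  then have "real (card {C \<in> \<C> n. card C = j}) * (\<bar>x\<bar> / real n) ^ j \<le> real n ^ j / (real \<mu> * real j) * (\<bar>x\<bar> / real n) ^ j"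
    by (intro mult_right_mono) auto
  also have "\<dots> = \<bar>x\<bar> ^ j / (real \<mu> * real j)" using assms(2) by (simp add: power_divide)
  finally have "real (card {C \<in> \<C> n. card C = j}) * (\<bar>x\<bar> / real n) ^ j \<le> \<bar>x\<bar> ^ j / (real \<mu> * real j)" .
  moreover have "real (card {C \<in> \<C> n. card C = j}) * (x / real n) ^ j \<le> real (card {C \<in> \<C> n. card C = j}) * (\<bar>x\<bar> / real n) ^ j"
  proof (rule mult_left_mono)
    have "(x / real n) ^ j \<le> \<bar>(x / real n) ^ j\<bar>" by simp
    also have "\<dots> = (\<bar>x\<bar> / real n) ^ j" by (simp add: power_abs)
    finally show "(x / real n) ^ j \<le> (\<bar>x\<bar> / real n) ^ j" .
  qed simp
  ultimately show ?thesis by simp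
qed

lemma card_cycles_of_length_tendsto:
  assumes "m \<le> j"
  shows "(\<lambda>n. real (card {C \<in> \<C> n. card C = j}) * (x / real n) ^ j) \<longlonglongrightarrow> x ^ j / (real \<mu> * real j)"
proof -
  let ?N = "\<lambda>n. real (card {C \<in> \<C> n. card C = j})"
  have pos: "0 < real \<mu> * real j" using \<mu> m assms by simp
  have "(\<lambda>n. real \<mu> * real j * ?N n / real n ^ j) \<longlonglongrightarrow> 1"
  proof (rule tendsto_sandwich)
    show "\<forall>\<^sub>F n in sequentially. ((real n - real j) / real n) ^ j \<le> real \<mu> * real j * ?N n / real n ^ j"
      using eventually_gt_at_top[of 0] eventually_ge_at_top[of j]
    proof eventually_elim
      case (elim n)
      have "real ((n - j) ^ j) \<le> real (\<mu> * j * card {C \<in> \<C> n. card C = j})"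
        using count_ge[OF assms elim(2)] by (simp only: of_nat_le_iff)
      then show ?case using elim by (simp add: power_divide divide_right_mono of_nat_diff)
    qed
    show "\<forall>\<^sub>F n in sequentially. real \<mu> * real j * ?N n / real n ^ j \<le> 1"
      using eventually_gt_at_top[of 0]
    proof eventually_elim
      case (elim n)
      have "real (\<mu> * j * card {C \<in> \<C> n. card C = j}) \<le> real (n ^ j)"
        using count_le[OF assms, of n] by (simp only: of_nat_le_iff)
      then show ?case using elim by simp
    qed
    have "(\<lambda>n. (real n - real j) / real n) \<longlonglongrightarrow> 1" by real_asymp
    then show "(\<lambda>n. ((real n - real j) / real n) ^ j) \<longlonglongrightarrow> 1"
      using tendsto_power[of "\<lambda>n. (real n - real j) / real n" 1 sequentially j] by simp
  qed simp
  then have "(\<lambda>n. real \<mu> * real j * ?N n / real n ^ j * (x ^ j / (real \<mu> * real j))) \<longlonglongrightarrow> 1 * (x ^ j / (real \<mu> * real j))"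
    by (intro tendsto_mult tendsto_const)
  moreover have "real \<mu> * real j * ?N n / real n ^ j * (x ^ j / (real \<mu> * real j)) = ?N n * (x / real n) ^ j" for n
    using \<mu> m assms by (simp add: power_divide)
  ultimately show ?thesis by simp
qed

lemma sum_short_eq:
  "(\<Sum>C\<in>short K n. f C) = (\<Sum>j=m..K. \<Sum>C | C \<in> \<C> n \<and> card C = j. f C :: real)"
proof -
  have "(\<Sum>j=m..K. \<Sum>C | C \<in> short K n \<and> card C = j. f C) = (\<Sum>C\<in>short K n. f C)"
    by (rule sum.group[OF finite_short]) (use card_ge in \<open>auto simp: short_def\<close>)
  moreover have "{C. C \<in> short K n \<and> card C = j} = {C. C \<in> \<C> n \<and> card C = j}" if "j \<in> {m..K}" for j
    using that by (auto simp: short_def)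
  ultimately show ?thesis by simp
qed

text \<open>There are about n^j / (\<mu> j) cycles of length j, each cheap with probability about
  \<open>x ^ j / fact j\<close> for \<open>x = j * a j / n\<close>. The lower Erlang bound is off by
  the factor \<open>exp (- x)\<close>, which tends to 1.\<close>

lemma sum_prob_cheap_tendsto:
  assumes a: "\<And>j. 0 \<le> a j"
  shows "(\<lambda>n. \<Sum>C\<in>short K n. measure (M n) (cheap a n C)) \<longlonglongrightarrow> (\<Sum>j=m..K. cycle_rate \<mu> j (a j))"
  unfolding sum_short_eq
proof (rule tendsto_sum)
  fix j assume "j \<in> {m..K}"
  then have j: "m \<le> j" by simp
  let ?N = "\<lambda>n. real (card {C \<in> \<C> n. card C = j})"
  let ?x = "\<lambda>n. real j * a j / real n"
  have lim: "(\<lambda>n. ?N n * ?x n ^ j / fact j) \<longlonglongrightarrow> cycle_rate \<mu> j (a j)"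
    using tendsto_divide[OF card_cycles_of_length_tendsto[OF j] tendsto_const, of "fact j" "real j * a j"]
    by (simp add: cycle_rate_def)
  have "?x \<longlonglongrightarrow> 0" by real_asymp
  then have "(\<lambda>n. exp (- ?x n)) \<longlonglongrightarrow> exp (- 0)" by (intro tendsto_exp tendsto_minus)
  from tendsto_mult[OF this lim]
  have lim2: "(\<lambda>n. exp (- ?x n) * (?N n * ?x n ^ j / fact j)) \<longlonglongrightarrow> cycle_rate \<mu> j (a j)" by simp
  show "(\<lambda>n. \<Sum>C | C \<in> \<C> n \<and> card C = j. measure (M n) (cheap a n C)) \<longlonglongrightarrow> cycle_rate \<mu> j (a j)"
  proof (rule tendsto_sandwich[OF _ _ lim2 lim]; intro always_eventually allI)
    fix n
    have "(\<Sum>C | C \<in> \<C> n \<and> card C = j. exp (- ?x n) * ?x n ^ j / fact j) \<le> (\<Sum>C | C \<in> \<C> n \<and> card C = j. measure (M n) (cheap a n C))"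
      by (rule sum_mono) (use prob_cheap_bounds(2)[OF _ a] in auto)
    then show "exp (- ?x n) * (?N n * ?x n ^ j / fact j) \<le> (\<Sum>C | C \<in> \<C> n \<and> card C = j. measure (M n) (cheap a n C))"
      by (simp add: ac_simps)
    have "(\<Sum>C | C \<in> \<C> n \<and> card C = j. measure (M n) (cheap a n C)) \<le> (\<Sum>C | C \<in> \<C> n \<and> card C = j. ?x n ^ j / fact j)"
      by (rule sum_mono) (use prob_cheap_bounds(1)[OF _ a] in auto)
    then show "(\<Sum>C | C \<in> \<C> n \<and> card C = j. measure (M n) (cheap a n C)) \<le> ?N n * ?x n ^ j / fact j"
      by simp
  qed
qed

section \<open>Void probabilities for bounded lengths\<close>

definition void :: "(nat \<Rightarrow> real) \<Rightarrow> nat \<Rightarrow> nat \<Rightarrow> 'a set" where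
  "void a K n = {\<omega> \<in> space (M n). \<forall>C\<in>\<C> n. card C \<le> K \<longrightarrow> a (card C) / real n < mw n \<omega> C}"

lemma void_eq: "void a K n = {\<omega> \<in> space (M n). \<forall>C\<in>short K n. \<omega> \<notin> cheap a n C}"
proof -
  have "a (card C) / real n < mw n \<omega> C \<longleftrightarrow> \<not> wt n \<omega> C \<le> real (card C) * a (card C) / real n" if "C \<in> \<C> n" for C \<omega>
    using mean_weight_le_iff[OF that, of "\<lambda>e. W n e \<omega>" "a (card C) / real n"] times_divide_eq_right
    by (metis not_le)
  then show ?thesis by (auto simp: void_def short_def cheap_def)
qed

lemma void_events[measurable]: "void a K n \<in> sets (M n)"
  unfolding void_eq using finite_short by (measurable; simp add: short_def)

text \<open>The neighbourhood of a cycle consists of the short cycles that share an edge with it,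
  itself included; the others are jointly independent of it. With z = b / n bounding all thresholds,
  the diagonal terms leave a spare factor z, and the O(n^s) overlapping pairs with s + 1 edges
  contribute at most z^(s+1) each. Both errors are O(1/n).\<close>

lemma void_tendsto:
  assumes a: "\<And>j. 0 \<le> a j"
  shows "(\<lambda>n. measure (M n) (void a K n)) \<longlonglongrightarrow> exp (- (\<Sum>j=m..K. cycle_rate \<mu> j (a j)))"
proof -
  let ?p = "\<lambda>n C. measure (M n) (cheap a n C)"
  let ?nb = "\<lambda>n C. {D \<in> short K n. D \<inter> C \<noteq> {}}"
  let ?Q = "\<lambda>n. {(C, D). C \<in> \<C> n \<and> D \<in> \<C> n \<and> card C \<le> K \<and> card D \<le> K \<and> C \<noteq> D \<and> C \<inter> D \<noteq> {}}"
  \<comment> \<open>\<open>b\<close> dominates the numerators of all thresholds. The summand 1 makes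
    its powers increasing, so that \<open>b ^ (2 * K)\<close> serves for all exponents up to
    2K.\<close>
  define b where "b = 1 + (\<Sum>j\<le>K. real j * a j)"
  have b1: "1 \<le> b" unfolding b_def using a by (simp add: sum_nonneg)
  have ba: "real j * a j \<le> b" if "j \<le> K" for j
    using member_le_sum[of j "{..K}" "\<lambda>j. real j * a j"] that a by (simp add: b_def)
  obtain B where B: "\<And>n s. card {(C, D). C \<in> \<C> n \<and> D \<in> \<C> n \<and> card C \<le> K \<and> card D \<le> K \<and>
      C \<noteq> D \<and> C \<inter> D \<noteq> {} \<and> card (C \<union> D) = Suc s} \<le> B * n ^ s"
    using overlap[of K] by blast
  \<comment> \<open>The diagonal comes first, then the overlapping pairs, counted once for products
    and once for intersections.\<close>
  define err where "err = (real K + 1) * b ^ (2 * K) + 2 * (real (2 * K) * real B * b ^ (2 * K))"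
  have bound: "\<bar>measure (M n) (void a K n) - exp (- (\<Sum>C\<in>short K n. ?p n C))\<bar> \<le> err / real n"
    if n: "0 < n" "b \<le> real n" for n
  proof -
    define z where "z = b / real n"
    have z: "0 \<le> z" "z \<le> 1" using n b1 by (auto simp: z_def)
    have finQ: "finite (?Q n)"
      by (rule finite_subset[of _ "\<C> n \<times> \<C> n"]) (auto simp: finite_\<C>)
    have thr: "real (card C) * a (card C) / real n \<le> z" if "C \<in> short K n" for C
      using that ba n by (auto simp: short_def z_def intro!: divide_right_mono)
    have pz: "?p n C \<le> z ^ card C" if "C \<in> short K n" for C
    proof -
      have C: "C \<in> \<C> n" using that by (simp add: short_def)
      have "?p n C \<le> (real (card C) * a (card C) / real n) ^ card C / fact (card C)"
        using prob_cheap_bounds(1)[OF C] a by simp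
      also have "\<dots> \<le> (real (card C) * a (card C) / real n) ^ card C / 1"
        using a by (intro divide_left_mono) (auto simp: fact_ge_1)
      also have "\<dots> \<le> z ^ card C" using thr[OF that] a by (auto intro!: power_mono)
      finally show ?thesis .
    qed
    have pp: "?p n C * ?p n D \<le> z ^ (card C + card D)" if "C \<in> short K n" "D \<in> short K n" for C D
      unfolding power_add using z pz that by (intro mult_mono) auto
    \<comment> \<open>Since z \<le> 1, the larger exponent of the product may be lowered to that of
      the union, so that products and intersections share one bound.\<close>
    have pq: "?p n C * ?p n D \<le> z ^ card (C \<union> D)" if "C \<in> short K n" "D \<in> short K n" for C D
      using pp[OF that] power_decreasing[OF card_Un_le z, of C D] by linarith
    have pi: "measure (M n) (cheap a n C \<inter> cheap a n D) \<le> z ^ card (C \<union> D)" if "C \<in> short K n" "D \<in> short K n" for C D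
    proof -
      have "cheap a n C \<inter> cheap a n D = {\<omega> \<in> space (M n). wt n \<omega> C \<le> real (card C) * a (card C) / real n \<and>
          wt n \<omega> D \<le> real (card D) * a (card D) / real n}" by (auto simp: cheap_def)
      then show ?thesis
        using iid.prob_two_weights_le[OF sub_E sub_E thr[OF that(1)] thr[OF that(2)] z(1)] that by (simp add: short_def)
    qed
    have Qsum: "(\<Sum>(C, D)\<in>?Q n. z ^ card (C \<union> D)) \<le> real (2 * K) * real B * b ^ (2 * K) / real n"
    proof -
      have img: "(\<lambda>(C, D). card (C \<union> D)) ` ?Q n \<subseteq> Suc ` {..<2 * K}"
      proof (rule image_subsetI)
        fix p assume "p \<in> ?Q n"
        then obtain C D where p: "p = (C, D)" and C: "C \<in> \<C> n" "D \<in> \<C> n" "card C \<le> K" "card D \<le> K" by blast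
        have "finite C" "finite D" using C sub_E iid.finite_E finite_subset by blast+
        then have "card (C \<union> D) \<noteq> 0" using nonempty[OF C(1)] by simp
        moreover have "card (C \<union> D) \<le> 2 * K" using card_Un_le[of C D] C by simp
        ultimately show "(\<lambda>(C, D). card (C \<union> D)) p \<in> Suc ` {..<2 * K}"
          unfolding p by (intro image_eqI[of _ _ "card (C \<union> D) - 1"]) auto
      qed
      have "(\<Sum>(C, D)\<in>?Q n. z ^ card (C \<union> D)) =
          (\<Sum>t\<in>Suc ` {..<2 * K}. \<Sum>p | p \<in> ?Q n \<and> (\<lambda>(C, D). card (C \<union> D)) p = t. (\<lambda>(C, D). z ^ card (C \<union> D)) p)"
        by (rule sum.group[OF finQ _ img, symmetric]) simp
      also have "\<dots> = (\<Sum>s<2 * K. \<Sum>p | p \<in> ?Q n \<and> (\<lambda>(C, D). card (C \<union> D)) p = Suc s. (\<lambda>(C, D). z ^ card (C \<union> D)) p)"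
        by (subst sum.reindex) auto
      also have "\<dots> \<le> (\<Sum>s<2 * K. real B * b ^ (2 * K) / real n)"
      proof (rule sum_mono)
        fix s assume s: "s \<in> {..<2 * K}"
        let ?Qs = "{p. p \<in> ?Q n \<and> (\<lambda>(C, D). card (C \<union> D)) p = Suc s}"
        have Qs: "?Qs = {(C, D). C \<in> \<C> n \<and> D \<in> \<C> n \<and> card C \<le> K \<and> card D \<le> K \<and>
          C \<noteq> D \<and> C \<inter> D \<noteq> {} \<and> card (C \<union> D) = Suc s}" by auto
        have "(\<Sum>p\<in>?Qs. (\<lambda>(C, D). z ^ card (C \<union> D)) p) = (\<Sum>p\<in>?Qs. z ^ Suc s)"
          by (rule sum.cong) auto
        also have "\<dots> = real (card ?Qs) * z ^ Suc s" by simp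
        also have "\<dots> \<le> real (B * n ^ s) * z ^ Suc s"
          using z unfolding Qs by (intro mult_right_mono of_nat_mono B) auto
        also have "\<dots> = real B * b ^ Suc s / real n" using n by (simp add: z_def power_divide)
        also have "\<dots> \<le> real B * b ^ (2 * K) / real n"
          using s b1 by (intro divide_right_mono mult_left_mono power_increasing) auto
        finally show "(\<Sum>p\<in>?Qs. (\<lambda>(C, D). z ^ card (C \<union> D)) p) \<le> real B * b ^ (2 * K) / real n" .
      qed
      also have "\<dots> = real (2 * K) * real B * b ^ (2 * K) / real n" by simp
      finally show ?thesis .
    qed
    have Dsum: "(\<Sum>C\<in>short K n. z ^ (card C + card C)) \<le> (real K + 1) * b ^ (2 * K) / real n"
    proof -
      have "(\<Sum>C\<in>short K n. z ^ (card C + card C)) \<le> (\<Sum>j=m..K. b ^ (2 * K) / real n)"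
        unfolding sum_short_eq
      proof (rule sum_mono)
        fix j assume j: "j \<in> {m..K}"
        have mj: "0 < j" "1 \<le> real \<mu> * real j" using j m \<mu> by (auto simp flip: of_nat_mult simp: Suc_le_eq)
        have "(\<Sum>C | C \<in> \<C> n \<and> card C = j. z ^ (card C + card C)) = real (card {C \<in> \<C> n. card C = j}) * (b / real n) ^ j * z ^ j"
          by (simp add: power_add z_def)
        also have "\<dots> \<le> \<bar>b\<bar> ^ j / (real \<mu> * real j) * z ^ j"
          using card_cycles_of_length_le[of j n b] j n z by (intro mult_right_mono) auto
        \<comment> \<open>Of the j spare factors z one is kept to supply 1/n; the others are at most
          1.\<close>
        also have "\<dots> \<le> \<bar>b\<bar> ^ j / 1 * z ^ 1"
          using b1 mj z by (intro mult_mono divide_left_mono power_decreasing) auto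
        also have "\<dots> = b ^ Suc j / real n" using b1 by (simp add: z_def)
        also have "\<dots> \<le> b ^ (2 * K) / real n"
          using j m b1 by (intro divide_right_mono power_increasing) auto
        finally show "(\<Sum>C | C \<in> \<C> n \<and> card C = j. z ^ (card C + card C)) \<le> b ^ (2 * K) / real n" .
      qed
      also have "\<dots> \<le> (real K + 1) * (b ^ (2 * K) / real n)"
        using b1 m by (simp, intro mult_right_mono divide_right_mono) auto
      finally show ?thesis by simp
    qed
    have Sig: "(\<Sum>C\<in>short K n. \<Sum>D\<in>?nb n C - {C}. f C D) = (\<Sum>(C, D)\<in>?Q n. f C D)" for f :: "'e set \<Rightarrow> 'e set \<Rightarrow> real"
    proof -
      have "(\<Sum>C\<in>short K n. \<Sum>D\<in>?nb n C - {C}. f C D) = (\<Sum>(C, D)\<in>Sigma (short K n) (\<lambda>C. ?nb n C - {C}). f C D)"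
        by (rule sum.Sigma) (auto simp: finite_short)
      also have "Sigma (short K n) (\<lambda>C. ?nb n C - {C}) = ?Q n" by (auto simp: short_def)
      finally show ?thesis .
    qed
    have "\<bar>measure (M n) (void a K n) - exp (- (\<Sum>C\<in>short K n. ?p n C))\<bar>
       \<le> (\<Sum>C\<in>short K n. \<Sum>D\<in>?nb n C. ?p n C * ?p n D) +
         (\<Sum>C\<in>short K n. \<Sum>D\<in>?nb n C - {C}. measure (M n) (cheap a n C \<inter> cheap a n D))"
      unfolding void_eq
    proof (rule iid.poisson_void[OF finite_short])
      fix C s assume C: "C \<in> short K n" and s: "0 \<le> s" "s \<le> (1::real)"
      have C': "C \<in> \<C> n" using C by (simp add: short_def)
      have subs: "D \<subseteq> E n - C" if "D \<in> short K n - ?nb n C" for D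
        using that sub_E[of D n] by (auto simp: short_def)
      show "(\<integral>\<omega>. indicator (cheap a n C) \<omega> * s ^ card {D \<in> short K n - ?nb n C. \<omega> \<in> cheap a n D} \<partial>M n) =
        ?p n C * (\<integral>\<omega>. s ^ card {D \<in> short K n - ?nb n C. \<omega> \<in> cheap a n D} \<partial>M n)"
        unfolding cheap_def
        by (rule iid.indep_count[OF sub_E[OF C'] _ subs s]) (auto simp: finite_short)
    next
      fix C assume C: "C \<in> short K n"
      then have "C \<in> \<C> n" by (simp add: short_def)
      then show "cheap a n C \<in> sets (M n)" by (rule cheap_events)
      show "C \<in> ?nb n C" using C nonempty[OF \<open>C \<in> \<C> n\<close>] by simp
      show "?nb n C \<subseteq> short K n" by blast
    qed
    \<comment> \<open>The cycle is split off from its own neighbourhood, to which it belongs because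
      it is nonempty.\<close>
    also have "(\<Sum>C\<in>short K n. \<Sum>D\<in>?nb n C. ?p n C * ?p n D) =
        (\<Sum>C\<in>short K n. ?p n C * ?p n C + (\<Sum>D\<in>?nb n C - {C}. ?p n C * ?p n D))"
      using nonempty by (intro sum.cong refl sum.remove) (auto simp: finite_\<C> short_def)
    also have "\<dots> = (\<Sum>C\<in>short K n. ?p n C * ?p n C) + (\<Sum>(C, D)\<in>?Q n. ?p n C * ?p n D)"
      by (simp only: sum.distrib Sig)
    also have "(\<Sum>C\<in>short K n. \<Sum>D\<in>?nb n C - {C}. measure (M n) (cheap a n C \<inter> cheap a n D)) =
        (\<Sum>(C, D)\<in>?Q n. measure (M n) (cheap a n C \<inter> cheap a n D))"
      by (rule Sig)
    also have "(\<Sum>C\<in>short K n. ?p n C * ?p n C) + (\<Sum>(C, D)\<in>?Q n. ?p n C * ?p n D) + (\<Sum>(C, D)\<in>?Q n. measure (M n) (cheap a n C \<inter> cheap a n D))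
       \<le> (\<Sum>C\<in>short K n. z ^ (card C + card C)) + (\<Sum>(C, D)\<in>?Q n. z ^ card (C \<union> D)) + (\<Sum>(C, D)\<in>?Q n. z ^ card (C \<union> D))"
      by (intro add_mono sum_mono) (use pp pq pi in \<open>auto simp: short_def\<close>)
    also have "\<dots> \<le> (real K + 1) * b ^ (2 * K) / real n + real (2 * K) * real B * b ^ (2 * K) / real n + real (2 * K) * real B * b ^ (2 * K) / real n"
      by (intro add_mono Dsum Qsum)
    also have "\<dots> = err / real n" by (simp add: err_def add_divide_distrib)
    finally show ?thesis .
  qed
  have "(\<lambda>n. measure (M n) (void a K n) - exp (- (\<Sum>C\<in>short K n. ?p n C))) \<longlonglongrightarrow> 0"
  proof (rule Lim_null_comparison)
    show "\<forall>\<^sub>F n in sequentially. norm (measure (M n) (void a K n) - exp (- (\<Sum>C\<in>short K n. ?p n C))) \<le> err / real n"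
      using eventually_gt_at_top[of 0] eventually_ge_at_top[of "nat \<lceil>b\<rceil>"]
    proof eventually_elim
      case (elim n)
      then have "b \<le> real n" by linarith
      then show ?case using bound elim by simp
    qed
    show "(\<lambda>n. err / real n) \<longlonglongrightarrow> 0" by real_asymp
  qed
  moreover have "(\<lambda>n. exp (- (\<Sum>C\<in>short K n. ?p n C))) \<longlonglongrightarrow> exp (- (\<Sum>j=m..K. cycle_rate \<mu> j (a j)))"
    by (intro tendsto_exp tendsto_minus sum_prob_cheap_tendsto a)
  ultimately have "(\<lambda>n. measure (M n) (void a K n) - exp (- (\<Sum>C\<in>short K n. ?p n C)) + exp (- (\<Sum>C\<in>short K n. ?p n C)))
     \<longlonglongrightarrow> 0 + exp (- (\<Sum>j=m..K. cycle_rate \<mu> j (a j)))"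
    by (rule tendsto_add)
  then show ?thesis by simp
qed

end

lemma exp_minus_diff_le:
  fixes x y :: real
  assumes "0 \<le> x" "x \<le> y"
  shows "exp (- x) - exp (- y) \<le> y - x"
proof -
  have "exp (- x) - exp (- y) = exp (- x) * (1 - exp (- (y - x)))"
    by (simp add: right_diff_distrib flip: exp_add)
  also have "\<dots> \<le> 1 * (y - x)"
  proof (rule mult_mono)
    show "1 - exp (- (y - x)) \<le> y - x" using exp_ge_add_one_self[of "- (y - x)"] by linarith
  qed (use assms in auto)
  finally show ?thesis by simp
qed

context cycle_model
begin

lemma void_antimono: "(\<And>j. a j \<le> a' j) \<Longrightarrow> void a' K n \<subseteq> void a K n"
  unfolding void_def by (auto intro!: le_less_trans[OF divide_right_mono[of "a _" "a' _" "real n"]])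

text \<open>The limit separates into a factor in c, from the other lengths, and a factor in d, from
  length k. Moving d alone yields increments of the second factor weighted by the first, as in a
  Stieltjes sum.\<close>

lemma void_except_tendsto:
  assumes "k \<in> {m..K}" "0 \<le> c" "0 \<le> d"
  shows "(\<lambda>n. measure (M n) (void (\<lambda>j. if j = k then d else c) K n)) \<longlonglongrightarrow>
    exp (- (\<Sum>j\<in>{m..K} - {k}. cycle_rate \<mu> j c)) * exp (- cycle_rate \<mu> k d)"
proof -
  have "(\<Sum>j=m..K. cycle_rate \<mu> j (if j = k then d else c)) =
      cycle_rate \<mu> k d + (\<Sum>j\<in>{m..K} - {k}. cycle_rate \<mu> j c)"
    using assms(1) by (subst sum.remove[of _ k]) (auto intro!: sum.cong)
  then show ?thesis
    using void_tendsto[of "\<lambda>j. if j = k then d else c" K] assms by (simp add: exp_add[symmetric] add.commute)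
qed

lemma void_const_tendsto:
  assumes "k \<in> {m..K}" "0 \<le> c"
  shows "(\<lambda>n. measure (M n) (void (\<lambda>_. c) K n)) \<longlonglongrightarrow>
    exp (- (\<Sum>j\<in>{m..K} - {k}. cycle_rate \<mu> j c)) * exp (- cycle_rate \<mu> k c)"
  using void_except_tendsto[OF assms assms(2)] by simp

section \<open>Bounds for the event that the minimum has length k\<close>

definition min_event :: "nat \<Rightarrow> nat \<Rightarrow> 'a set" where
  "min_event k n = {\<omega> \<in> space (M n). \<exists>C. is_min_mean_cycle (\<lambda>e. W n e \<omega>) (\<C> n) C \<and> card C = k}"

definition cheap_min_event :: "nat \<Rightarrow> nat \<Rightarrow> 'a set" where
  "cheap_min_event k n = {\<omega> \<in> space (M n). \<exists>C. is_min_mean_cycle (\<lambda>e. W n e \<omega>) (\<C> n) C \<and> card C = k \<and>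
     weight (\<lambda>e. W n e \<omega>) C \<le> real k / (exp 1 * real n)}"

lemma min_event_measurable[measurable]: "min_event k n \<in> sets (M n)"
proof -
  have "min_event k n = (\<Union>C\<in>{C \<in> \<C> n. card C = k}. {\<omega> \<in> space (M n). \<forall>D\<in>\<C> n - {C}. mw n \<omega> C < mw n \<omega> D})"
    by (auto simp: min_event_def is_min_mean_cycle_def)
  also have "\<dots> \<in> sets (M n)"
  proof (rule sets.finite_UN)
    fix C assume "C \<in> {C \<in> \<C> n. card C = k}"
    then have [measurable]: "(\<lambda>\<omega>. mw n \<omega> C) \<in> borel_measurable (M n)" by (intro iid.measurable_mean_weight sub_E) simp
    have [measurable]: "(\<lambda>\<omega>. mw n \<omega> D) \<in> borel_measurable (M n)" if "D \<in> \<C> n - {C}" for D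
      using that by (intro iid.measurable_mean_weight sub_E) simp
    have "finite (\<C> n - {C})" using finite_\<C> by simp
    then show "{\<omega> \<in> space (M n). \<forall>D\<in>\<C> n - {C}. mw n \<omega> C < mw n \<omega> D} \<in> sets (M n)" by measurable
  qed (simp add: finite_\<C>)
  finally show ?thesis .
qed

lemma cheap_min_event_measurable[measurable]: "cheap_min_event k n \<in> sets (M n)"
proof -
  have "cheap_min_event k n = (\<Union>C\<in>{C \<in> \<C> n. card C = k}. {\<omega> \<in> space (M n). (\<forall>D\<in>\<C> n - {C}. mw n \<omega> C < mw n \<omega> D) \<and>
      wt n \<omega> C \<le> real k / (exp 1 * real n)})"
    by (auto simp: cheap_min_event_def is_min_mean_cycle_def)
  also have "\<dots> \<in> sets (M n)"
  proof (rule sets.finite_UN)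
    fix C assume C: "C \<in> {C \<in> \<C> n. card C = k}"
    then have [measurable]: "(\<lambda>\<omega>. mw n \<omega> C) \<in> borel_measurable (M n)" by (intro iid.measurable_mean_weight sub_E) simp
    from C have [measurable]: "(\<lambda>\<omega>. wt n \<omega> C) \<in> borel_measurable (M n)" by (intro iid.measurable_weight sub_E) simp
    have [measurable]: "(\<lambda>\<omega>. mw n \<omega> D) \<in> borel_measurable (M n)" if "D \<in> \<C> n - {C}" for D
      using that by (intro iid.measurable_mean_weight sub_E) simp
    have "finite (\<C> n - {C})" using finite_\<C> by simp
    then show "{\<omega> \<in> space (M n). (\<forall>D\<in>\<C> n - {C}. mw n \<omega> C < mw n \<omega> D) \<and> wt n \<omega> C \<le> real k / (exp 1 * real n)} \<in> sets (M n)"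
      by measurable
  qed (simp add: finite_\<C>)
  finally show ?thesis .
qed

lemma cheap_min_event_subset: "cheap_min_event k n \<subseteq> min_event k n"
  by (auto simp: cheap_min_event_def min_event_def)

text \<open>A union bound over all long cycles. For each length the expected number never exceeds
  its limit, since the count is at most n^j / (\<mu> j) and the probability at most x^j / j!; so the
  bound is uniform in n although the lengths are not bounded.\<close>

lemma long_bound:
  assumes "0 < n" "m \<le> K"
  shows "measure (M n) {\<omega> \<in> space (M n). \<exists>D\<in>\<C> n. K < card D \<and> mw n \<omega> D \<le> 1 / exp 1 / real n} \<le> cycle_tail \<mu> K"
proof -
  let ?b = "1 / exp 1 :: real" and ?S = "{D \<in> \<C> n. K < card D}"
  let ?N = "card (E n)"
  have "{\<omega> \<in> space (M n). \<exists>D\<in>\<C> n. K < card D \<and> mw n \<omega> D \<le> ?b / real n} = (\<Union>D\<in>?S. cheap (\<lambda>_. ?b) n D)"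
    by (auto simp: cheap_def mean_weight_le_iff)
  also have "measure (M n) \<dots> \<le> (\<Sum>D\<in>?S. measure (M n) (cheap (\<lambda>_. ?b) n D))"
    by (intro iid.finite_measure_subadditive_finite) (auto simp: finite_\<C>)
  also have "\<dots> = (\<Sum>j\<in>{K<..?N}. \<Sum>D | D \<in> ?S \<and> card D = j. measure (M n) (cheap (\<lambda>_. ?b) n D))"
    by (rule sum.group[symmetric]) (auto simp: finite_\<C> intro!: card_mono iid.finite_E dest: sub_E)
  also have "\<dots> \<le> (\<Sum>j\<in>{K<..?N}. cycle_rate \<mu> j ?b)"
  proof (rule sum_mono)
    fix j assume j: "j \<in> {K<..?N}"
    have "(\<Sum>D | D \<in> ?S \<and> card D = j. measure (M n) (cheap (\<lambda>_. ?b) n D))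
        \<le> (\<Sum>D | D \<in> ?S \<and> card D = j. (real j * ?b / real n) ^ j / fact j)"
      by (rule sum_mono) (use prob_cheap_bounds(1)[of _ n "\<lambda>_. ?b"] in auto)
    also have "\<dots> = real (card {D \<in> \<C> n. card D = j}) * (real j * ?b / real n) ^ j / fact j"
    proof -
      have "{D. D \<in> ?S \<and> card D = j} = {D \<in> \<C> n. card D = j}" using j by auto
      then show ?thesis by simp
    qed
    also have "\<dots> \<le> \<bar>real j * ?b\<bar> ^ j / (real \<mu> * real j) / fact j"
      using card_cycles_of_length_le[of j n "real j * ?b"] j assms by (intro divide_right_mono) auto
    also have "\<dots> = cycle_rate \<mu> j ?b" by (simp add: cycle_rate_def)
    finally show "(\<Sum>D | D \<in> ?S \<and> card D = j. measure (M n) (cheap (\<lambda>_. ?b) n D)) \<le> cycle_rate \<mu> j ?b" .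
  qed
  also have "\<dots> = (\<Sum>i<?N - K. cycle_rate \<mu> (i + Suc K) ?b)"
    by (rule sum.reindex_bij_witness[of _ "\<lambda>i. i + Suc K" "\<lambda>j. j - Suc K"]) auto
  also have "\<dots> \<le> cycle_tail \<mu> K"
    unfolding cycle_tail_def
    by (rule sum_le_suminf[OF summable_ignore_initial_segment[OF summable_cycle_rate[OF \<mu>]]])
      (auto simp: cycle_rate_nonneg)
  finally show ?thesis .
qed

text \<open>Take the last threshold at which voidness still holds. The minimal cycle is short, so it
  does not exceed the next threshold, and raising the threshold of length k alone already destroys
  voidness. What remains are the outcomes where voidness fails at \<open>c 0\<close> or survives at
  \<open>c R\<close>.\<close>

lemma min_event_upper:
  fixes c :: "nat \<Rightarrow> real"
  assumes c: "\<And>i. c i \<le> c (Suc i)" and k: "k \<le> K"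
  shows "measure (M n) (min_event k n) \<le> 1 - measure (M n) (void (\<lambda>_. c 0) K n)
    + (\<Sum>i<R. measure (M n) (void (\<lambda>_. c i) K n) - measure (M n) (void (\<lambda>j. if j = k then c (Suc i) else c i) K n))
    + measure (M n) (void (\<lambda>_. c R) K n)"
proof -
  let ?V = "\<lambda>i. void (\<lambda>_. c i) K n" and ?F = "\<lambda>i. void (\<lambda>j. if j = k then c (Suc i) else c i) K n"
  have "min_event k n \<subseteq> (space (M n) - ?V 0) \<union> (\<Union>i<R. ?V i - ?F i) \<union> ?V R"
  proof
    fix \<omega> assume \<omega>: "\<omega> \<in> min_event k n"
    then obtain C where C: "C \<in> \<C> n" "card C = k" and less: "\<And>D. D \<in> \<C> n \<Longrightarrow> D \<noteq> C \<Longrightarrow> mw n \<omega> C < mw n \<omega> D"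
      and sp: "\<omega> \<in> space (M n)"
      unfolding min_event_def is_min_mean_cycle_def by blast
    have min: "mw n \<omega> C \<le> mw n \<omega> D" if "D \<in> \<C> n" for D
      using less[OF that] by (cases "D = C") auto
    show "\<omega> \<in> (space (M n) - ?V 0) \<union> (\<Union>i<R. ?V i - ?F i) \<union> ?V R"
    proof (rule ccontr)
      assume neg: "\<not> ?thesis"
      have "\<omega> \<in> ?V i" if "i \<le> R" for i
        using that
      proof (induction i)
        case 0
        then show ?case using neg sp by blast
      next
        case (Suc i)
        show ?case
        proof (rule ccontr)
          assume "\<omega> \<notin> ?V (Suc i)"
          then obtain D where D: "D \<in> \<C> n" "mw n \<omega> D \<le> c (Suc i) / real n"
            using sp by (auto simp: void_def not_less)
          then have "mw n \<omega> C \<le> c (Suc i) / real n" using min[OF D(1)] by simp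
          moreover have "c (Suc i) / real n < mw n \<omega> C" if "\<omega> \<in> ?F i"
            using that C k unfolding void_def by force
          ultimately have "\<omega> \<notin> ?F i" by fastforce
          moreover have "\<omega> \<in> ?V i" using Suc by simp
          ultimately show False using neg Suc.prems by auto
        qed
      qed
      then show False using neg by blast
    qed
  qed
  then have "measure (M n) (min_event k n) \<le> measure (M n) ((space (M n) - ?V 0) \<union> (\<Union>i<R. ?V i - ?F i) \<union> ?V R)"
    by (intro iid.finite_measure_mono) auto
  also have "\<dots> \<le> measure (M n) (space (M n) - ?V 0) + measure (M n) (\<Union>i<R. ?V i - ?F i) + measure (M n) (?V R)"
    by (intro order_trans[OF measure_Un_le] add_mono order_refl) auto
  also have "measure (M n) (space (M n) - ?V 0) = 1 - measure (M n) (?V 0)" by (rule iid.prob_compl) simp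
  also have "measure (M n) (\<Union>i<R. ?V i - ?F i) \<le> (\<Sum>i<R. measure (M n) (?V i - ?F i))"
    by (intro iid.finite_measure_subadditive_finite) auto
  also have "(\<Sum>i<R. measure (M n) (?V i - ?F i)) = (\<Sum>i<R. measure (M n) (?V i) - measure (M n) (?F i))"
    by (intro sum.cong refl iid.finite_measure_Diff void_antimono) (auto simp: c)
  finally show ?thesis by simp
qed

text \<open>In the window \<open>?G i - ?V (Suc i)\<close> some short cycle has mean weight at most
  \<open>c (Suc i) / n\<close>, while all short cycles of length other than k lie above it; so the
  cheapest short cycle has length k. Only a longer cycle of mean weight at most 1/(en) can spoil
  this, at the cost of \<open>cycle_tail\<close>, and the absence of ties makes the minimum strict.
  The windows are disjoint, so their probabilities add up.\<close>

lemma cheap_min_event_lower: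
  fixes c :: "nat \<Rightarrow> real"
  assumes c: "\<And>i. c i \<le> c (Suc i)" "c R \<le> 1 / exp 1" and k: "m \<le> k" "k \<le> K" and n: "0 < n"
  shows "(\<Sum>i<R. measure (M n) (void (\<lambda>j. if j = k then c i else c (Suc i)) K n) - measure (M n) (void (\<lambda>_. c (Suc i)) K n))
     \<le> measure (M n) (cheap_min_event k n) + cycle_tail \<mu> K"
proof -
  let ?V = "\<lambda>i. void (\<lambda>_. c i) K n" and ?G = "\<lambda>i. void (\<lambda>j. if j = k then c i else c (Suc i)) K n"
  let ?Long = "{\<omega> \<in> space (M n). \<exists>D\<in>\<C> n. K < card D \<and> mw n \<omega> D \<le> 1 / exp 1 / real n}"
  have mono: "c i \<le> c j" if "i \<le> j" for i j using lift_Suc_mono_le[of c] c(1) that by blast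
  have Long[measurable]: "?Long \<in> sets (M n)"
  proof -
    have "?Long = (\<Union>D\<in>{D \<in> \<C> n. K < card D}. cheap (\<lambda>_. 1 / exp 1) n D)"
      by (auto simp: cheap_def mean_weight_le_iff)
    then show ?thesis using finite_\<C>[of n] by (auto intro!: sets.finite_UN)
  qed
  have sub_Pow: "\<C> n \<subseteq> Pow (E n)" using sub_E by blast
  have disj: "disjoint_family_on (\<lambda>i. ?G i - ?V (Suc i)) {..<R}"
  proof -
    \<comment> \<open>For i < j every threshold of \<open>?G j\<close> is at least
      \<open>c j\<close>, hence at least \<open>c (Suc i)\<close>.\<close>
    have "?G j \<subseteq> ?V (Suc i)" if "i < j" for i j
      using that by (intro void_antimono) (auto intro: mono)
    then have "(?G i - ?V (Suc i)) \<inter> (?G j - ?V (Suc j)) = {}" if "i \<noteq> j" for i j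
      using that by (cases i j rule: linorder_cases) blast+
    then show ?thesis by (auto simp: disjoint_family_on_def)
  qed
  have "(\<Sum>i<R. measure (M n) (?G i) - measure (M n) (?V (Suc i))) = (\<Sum>i<R. measure (M n) (?G i - ?V (Suc i)))"
    by (intro sum.cong refl iid.finite_measure_Diff[symmetric] void_antimono) (auto simp: c)
  also have "\<dots> = measure (M n) (\<Union>i<R. ?G i - ?V (Suc i))"
    by (rule iid.finite_measure_finite_Union[symmetric, OF _ _ disj]) auto
  also have "\<dots> \<le> measure (M n) (cheap_min_event k n \<union> ?Long)"
  proof (rule iid.finite_measure_mono_AE)
    show "AE \<omega> in M n. \<omega> \<in> (\<Union>i<R. ?G i - ?V (Suc i)) \<longrightarrow> \<omega> \<in> cheap_min_event k n \<union> ?Long"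
      using iid.AE_no_mean_weight_ties[OF sub_Pow]
    proof eventually_elim
      case (elim \<omega>)
      show ?case
      proof (intro impI, rule ccontr)
        assume "\<omega> \<in> (\<Union>i<R. ?G i - ?V (Suc i))" and neg: "\<omega> \<notin> cheap_min_event k n \<union> ?Long"
        then obtain i where i: "i < R" "\<omega> \<in> ?G i" "\<omega> \<notin> ?V (Suc i)" by blast
        then have sp: "\<omega> \<in> space (M n)" by (simp add: void_def)
        from i obtain D where D: "D \<in> \<C> n" "mw n \<omega> D \<le> c (Suc i) / real n" using sp by (auto simp: void_def not_less)
        have "finite (\<C> n)" "\<C> n \<noteq> {}" using D finite_\<C> by auto
        from ex_min_if_finite[of "mw n \<omega> ` \<C> n"] this
        obtain C where C: "C \<in> \<C> n" "\<And>C'. C' \<in> \<C> n \<Longrightarrow> mw n \<omega> C \<le> mw n \<omega> C'"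
          by (auto simp: not_less)
        have "is_min_mean_cycle (\<lambda>e. W n e \<omega>) (\<C> n) C"
          unfolding is_min_mean_cycle_def using C elim by (metis order_le_less)
        moreover have CD: "mw n \<omega> C \<le> c (Suc i) / real n" using C(2)[OF D(1)] D(2) by simp
        have "c (Suc i) \<le> 1 / exp 1" using mono[of "Suc i" R] i(1) c(2) by simp
        then have "c (Suc i) / real n \<le> 1 / exp 1 / real n" by (rule divide_right_mono) simp
        with CD have Cb: "mw n \<omega> C \<le> 1 / exp 1 / real n" by simp
        then have "card C \<le> K" using neg C(1) sp by (auto simp: not_less)
        then have "(if card C = k then c i else c (Suc i)) / real n < mw n \<omega> C"
          using i(2) C(1) unfolding void_def by blast
        then have "card C = k" using CD by (auto split: if_splits)
        moreover have "wt n \<omega> C \<le> real k / (exp 1 * real n)"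
          using Cb \<open>card C = k\<close> mean_weight_le_iff[OF C(1)] by simp
        ultimately show False using neg sp by (auto simp: cheap_min_event_def)
      qed
    qed
  qed (rule sets.Un[OF cheap_min_event_measurable Long])
  also have "\<dots> \<le> measure (M n) (cheap_min_event k n) + measure (M n) ?Long"
    by (rule measure_Un_le[OF cheap_min_event_measurable Long])
  also have "\<dots> \<le> measure (M n) (cheap_min_event k n) + cycle_tail \<mu> K"
    using long_bound[OF n, of K] k by simp
  finally show ?thesis .
qed

section \<open>The limiting integral\<close>

text \<open>The derivative of \<open>cycle_rate \<mu> k\<close>: the rate at which cycles of length
  k appear as the threshold c rises.\<close>

definition limit_density :: "nat \<Rightarrow> real \<Rightarrow> real" where
  "limit_density k c = c ^ (k - 1) * real k ^ k / (real \<mu> * fact k)"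

lemma limit_density_bounds:
  assumes "0 \<le> c" "c \<le> b"
  shows "0 \<le> limit_density k c" "limit_density k c \<le> limit_density k b"
  unfolding limit_density_def using assms by (auto intro!: divide_right_mono mult_right_mono power_mono)

lemma continuous_on_limit_density: "continuous_on S (limit_density k)"
  unfolding limit_density_def divide_inverse by (intro continuous_intros)

text \<open>Truncation at K lowers the exponent by at most \<open>cycle_tail \<mu> K\<close>, and
  \<open>exp (- x)\<close> is 1-Lipschitz for x \<ge> 0. The other two factors of the error are the
  largest density and the length 1/e of the interval.\<close>

lemma truncated_integral_bounds:
  assumes "m \<le> k" "k \<le> K"
  defines "I \<equiv> integral {0..1 / exp 1} (\<lambda>c. limit_density k c * exp (- cycle_total \<mu> m c))"
    and "J \<equiv> integral {0..1 / exp 1} (\<lambda>c. limit_density k c * exp (- (\<Sum>j=m..K. cycle_rate \<mu> j c)))"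
  shows "I \<le> J" "J \<le> I + cycle_tail \<mu> K * (limit_density k (1 / exp 1) * (1 / exp 1))"
proof -
  let ?b = "1 / exp 1 :: real"
  let ?S = "\<lambda>c. \<Sum>j=m..K. cycle_rate \<mu> j c"
  have S0: "0 \<le> ?S c" if "0 \<le> c" for c using that by (intro sum_nonneg cycle_rate_nonneg)
  have trunc: "?S c \<le> cycle_total \<mu> m c" "cycle_total \<mu> m c \<le> ?S c + cycle_tail \<mu> K" if "c \<in> {0..?b}" for c
    using cycle_total_truncate[OF \<mu>, of c m K] that assms by auto
  have i1: "(\<lambda>c. limit_density k c * exp (- cycle_total \<mu> m c)) integrable_on {0..?b}"
    by (intro integrable_continuous_interval continuous_intros continuous_on_limit_density continuous_on_cycle_total \<mu>)
  have i2: "(\<lambda>c. limit_density k c * exp (- ?S c)) integrable_on {0..?b}"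
    by (intro integrable_continuous_interval continuous_intros continuous_on_limit_density continuous_on_cycle_rate)
  show "I \<le> J" unfolding I_def J_def
    using i1 i2 trunc by (intro integral_le) (auto intro!: mult_left_mono limit_density_bounds)
  have "J - I = integral {0..?b} (\<lambda>c. limit_density k c * exp (- ?S c) - limit_density k c * exp (- cycle_total \<mu> m c))"
    unfolding I_def J_def by (rule Henstock_Kurzweil_Integration.integral_diff[OF i2 i1, symmetric])
  also have "\<dots> \<le> integral {0..?b} (\<lambda>c. limit_density k ?b * cycle_tail \<mu> K)"
  proof (rule integral_le)
    show "(\<lambda>c. limit_density k c * exp (- ?S c) - limit_density k c * exp (- cycle_total \<mu> m c)) integrable_on {0..?b}"
      by (rule Henstock_Kurzweil_Integration.integrable_diff[OF i2 i1])
    fix c assume c: "c \<in> {0..?b}"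
    have "exp (- ?S c) - exp (- cycle_total \<mu> m c) \<le> cycle_total \<mu> m c - ?S c"
      using c S0 trunc(1)[OF c] by (intro exp_minus_diff_le) auto
    then have "exp (- ?S c) - exp (- cycle_total \<mu> m c) \<le> cycle_tail \<mu> K" using trunc(2)[OF c] by linarith
    then have "limit_density k c * (exp (- ?S c) - exp (- cycle_total \<mu> m c)) \<le> limit_density k ?b * cycle_tail \<mu> K"
      using c trunc(1)[OF c] by (intro mult_mono limit_density_bounds) auto
    then show "limit_density k c * exp (- ?S c) - limit_density k c * exp (- cycle_total \<mu> m c) \<le> limit_density k ?b * cycle_tail \<mu> K"
      by (simp add: right_diff_distrib)
  qed (rule integrable_const_ivl)
  also have "\<dots> = cycle_tail \<mu> K * (limit_density k ?b * ?b)" by simp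
  finally show "J \<le> I + cycle_tail \<mu> K * (limit_density k ?b * ?b)" by simp
qed

text \<open>This is \<open>stieltjes_sums\<close> with integrator - G, whose derivative is G times
  \<open>limit_density\<close>; the product of H and G restores the full truncated exponent. The
  other lengths, collected in H, are evaluated at the left end of each cell for the upper bound and
  at the right end for the lower.\<close>

lemma partition_sum_bounds:
  fixes k K R :: nat
  assumes k: "m \<le> k" "k \<le> K" and R: "0 < R"
  defines "H \<equiv> \<lambda>c. exp (- (\<Sum>j\<in>{m..K} - {k}. cycle_rate \<mu> j c))" and "G \<equiv> \<lambda>c. exp (- cycle_rate \<mu> k c)"
    and "b \<equiv> 1 / exp 1 :: real"
  defines "c \<equiv> \<lambda>i. real i * b / real R"
    and "J \<equiv> integral {0..b} (\<lambda>c. limit_density k c * exp (- (\<Sum>j=m..K. cycle_rate \<mu> j c)))"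
  shows "(\<Sum>i<R. H (c i) * G (c i) - H (c i) * G (c (Suc i))) \<le> J + limit_density k b * b / real R"
    and "J - limit_density k b * b / real R \<le> (\<Sum>i<R. H (c (Suc i)) * G (c i) - H (c (Suc i)) * G (c (Suc i)))"
proof -
  have b0: "0 \<le> b" by (simp add: b_def)
  have k0: "0 < k" using k m by simp
  have HG: "H x * G x = exp (- (\<Sum>j=m..K. cycle_rate \<mu> j x))" for x
  proof -
    have "(\<Sum>j=m..K. cycle_rate \<mu> j x) = cycle_rate \<mu> k x + (\<Sum>j\<in>{m..K} - {k}. cycle_rate \<mu> j x)"
      using k by (intro sum.remove) auto
    then show ?thesis by (simp add: H_def G_def exp_add[symmetric])
  qed
  have "(\<lambda>x. H x * (G x * limit_density k x)) = (\<lambda>x. limit_density k x * exp (- (\<Sum>j=m..K. cycle_rate \<mu> j x)))"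
    using HG by (simp add: fun_eq_iff mult.assoc[symmetric] mult.commute)
  then have J: "J = integral {0..b} (\<lambda>x. H x * (G x * limit_density k x))" by (simp only: J_def)
  have G1: "0 \<le> G x" "G x \<le> 1" if "0 \<le> x" for x
    using cycle_rate_nonneg[OF that] by (auto simp: G_def)
  note st = stieltjes_sums[of b R H "\<lambda>x. - G x" "\<lambda>x. G x * limit_density k x" "limit_density k b", OF b0 R]
  have prems: "continuous_on {0..b} H"
    "\<And>x y. 0 \<le> x \<Longrightarrow> x \<le> y \<Longrightarrow> y \<le> b \<Longrightarrow> H y \<le> H x"
    "\<And>x. 0 \<le> x \<Longrightarrow> x \<le> b \<Longrightarrow> 0 \<le> H x \<and> H x \<le> 1"
    "\<And>x. 0 \<le> x \<Longrightarrow> x \<le> b \<Longrightarrow> ((\<lambda>x. - G x) has_real_derivative G x * limit_density k x) (at x)"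
    "continuous_on {0..b} (\<lambda>x. G x * limit_density k x)"
    "\<And>x. 0 \<le> x \<Longrightarrow> x \<le> b \<Longrightarrow> 0 \<le> G x * limit_density k x \<and> G x * limit_density k x \<le> limit_density k b"
  proof -
    show "continuous_on {0..b} H" unfolding H_def by (intro continuous_intros continuous_on_cycle_rate)
    show "H y \<le> H x" if "0 \<le> x" "x \<le> y" "y \<le> b" for x y
      unfolding H_def using that by (auto intro!: sum_mono cycle_rate_mono)
    show "0 \<le> H x \<and> H x \<le> 1" if "0 \<le> x" "x \<le> b" for x
      unfolding H_def using that by (auto intro!: sum_nonneg cycle_rate_nonneg)
    show "((\<lambda>x. - G x) has_real_derivative G x * limit_density k x) (at x)" for x
      unfolding G_def limit_density_def
      by (rule derivative_eq_intros has_derivative_cycle_rate[OF k0] refl)+ simp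
    show "continuous_on {0..b} (\<lambda>x. G x * limit_density k x)"
      unfolding G_def by (intro continuous_intros continuous_on_cycle_rate continuous_on_limit_density)
    show "0 \<le> G x * limit_density k x \<and> G x * limit_density k x \<le> limit_density k b" if "0 \<le> x" "x \<le> b" for x
      using mult_mono[OF G1(2)[OF that(1)] limit_density_bounds(2)[OF that, of k]] limit_density_bounds(1)[OF that, of k] G1[OF that(1)]
      by simp
  qed
  show "(\<Sum>i<R. H (c i) * G (c i) - H (c i) * G (c (Suc i))) \<le> J + limit_density k b * b / real R"
    using st(1)[OF prems] by (simp add: J c_def right_diff_distrib)
  show "J - limit_density k b * b / real R \<le> (\<Sum>i<R. H (c (Suc i)) * G (c i) - H (c (Suc i)) * G (c (Suc i)))"
    using st(2)[OF prems] by (simp add: J c_def right_diff_distrib)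
qed

text \<open>The mesh covers [0, 1/e] and has one more cell, up to some b' slightly beyond. Closeness
  of b' to 1/e keeps the extra cell negligible, and divergence of the rates at b' makes voidness
  there unlikely once K is large. Hence b' is chosen before K.\<close>

lemma eventually_min_event_less:
  assumes k: "m \<le> k" and \<eta>: "0 < \<eta>"
  shows "\<forall>\<^sub>F n in sequentially. measure (M n) (min_event k n) <
    integral {0..1 / exp 1} (\<lambda>c. limit_density k c * exp (- cycle_total \<mu> m c)) + \<eta>"
proof -
  define b :: real where "b = 1 / exp 1"
  \<comment> \<open>Four errors stay below \<open>\<delta>\<close> each: the mesh, the truncation,
    the extra cell, and voidness at b'.\<close>
  define \<delta> where "\<delta> = \<eta> / 5"
  let ?r = "cycle_rate \<mu> k" and ?D = "limit_density k b * b"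
  have pos: "0 < \<delta>" "0 < b" using \<eta> by (simp_all add: \<delta>_def b_def)
  obtain b' where b': "b < b'" "?r b' - ?r b < \<delta>"
  proof -
    have "isCont ?r b" using continuous_on_cycle_rate[of UNIV \<mu> k] by (simp add: continuous_on_eq_continuous_at)
    then obtain d where d: "d > 0" "\<And>x. dist x b < d \<Longrightarrow> dist (?r x) (?r b) < \<delta>"
      using pos(1) unfolding continuous_at_eps_delta by blast
    have "dist (?r (b + d / 2)) (?r b) < \<delta>" using d by (simp add: dist_real_def)
    then show thesis using d(1) by (intro that[of "b + d / 2"]) (auto simp: dist_real_def)
  qed
  obtain K where K: "k \<le> K" "cycle_tail \<mu> K * ?D < \<delta>" "exp (- (\<Sum>j=m..K. cycle_rate \<mu> j b')) < \<delta>"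
  proof -
    have "(\<lambda>K. cycle_tail \<mu> K * ?D) \<longlonglongrightarrow> 0 * ?D" by (intro tendsto_mult tendsto_const cycle_tail_tendsto_0 \<mu>)
    then have ev1: "\<forall>\<^sub>F K in sequentially. cycle_tail \<mu> K * ?D < \<delta>" using pos(1) by (simp add: order_tendstoD)
    obtain K0 where K0: "\<forall>K\<ge>K0. - ln \<delta> < (\<Sum>j=m..K. cycle_rate \<mu> j b')"
      using cycle_rate_sum_unbounded[OF \<mu>, of b' "- ln \<delta>" m] b'(1) unfolding b_def by blast
    have ev2: "\<forall>\<^sub>F K in sequentially. exp (- (\<Sum>j=m..K. cycle_rate \<mu> j b')) < \<delta>"
      using eventually_ge_at_top[of K0]
    proof eventually_elim
      case (elim K)
      then have "- (\<Sum>j=m..K. cycle_rate \<mu> j b') < ln \<delta>" using K0 by force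
      then have "exp (- (\<Sum>j=m..K. cycle_rate \<mu> j b')) < exp (ln \<delta>)" by (simp only: exp_less_cancel_iff)
      then show ?case using pos by simp
    qed
    from eventually_conj[OF eventually_conj[OF ev1 ev2] eventually_ge_at_top[of k]]
    show thesis using that by (auto simp: eventually_at_top_linorder)
  qed
  obtain R where R: "0 < R" "?D / real R < \<delta>"
  proof -
    obtain R where "?D / \<delta> < real R" using reals_Archimedean2 by blast
    moreover have "0 \<le> ?D" using limit_density_bounds[of b b k] pos by simp
    then have "0 \<le> ?D / \<delta>" using pos by simp
    ultimately have "0 < real R" "?D < real R * \<delta>" using pos(1) by (linarith, simp add: divide_less_eq)
    then show thesis by (intro that[of R]) (auto simp: divide_less_eq mult.commute)
  qed
  define c where "c i = (if i \<le> R then real i * b / real R else b')" for i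
  have cR: "c R = b" and c0: "c 0 = 0" and cS: "c (Suc R) = b'" using R by (auto simp: c_def)
  have c_mono: "c i \<le> c (Suc i)" for i
  proof -
    consider "Suc i \<le> R" | "i = R" | "R < i" by linarith
    then show ?thesis
    proof cases
      case 1
      then show ?thesis using pos by (auto simp: c_def intro!: divide_right_mono mult_right_mono)
    next
      case 2
      then show ?thesis using b' cR cS by simp
    qed (simp add: c_def)
  qed
  have c_nonneg: "0 \<le> c i" for i using pos b' by (auto simp: c_def)
  have kK: "k \<in> {m..K}" using k K by simp
  define H where "H = (\<lambda>c. exp (- (\<Sum>j\<in>{m..K} - {k}. cycle_rate \<mu> j c)))"
  define G where "G = (\<lambda>c. exp (- ?r c))"
  let ?u = "\<lambda>n. 1 - measure (M n) (void (\<lambda>_. c 0) K n)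
    + (\<Sum>i<Suc R. measure (M n) (void (\<lambda>_. c i) K n) - measure (M n) (void (\<lambda>j. if j = k then c (Suc i) else c i) K n))
    + measure (M n) (void (\<lambda>_. c (Suc R)) K n)"
  let ?U = "1 - H (c 0) * G (c 0) + (\<Sum>i<Suc R. H (c i) * G (c i) - H (c i) * G (c (Suc i))) + H (c (Suc R)) * G (c (Suc R))"
  have lim: "?u \<longlonglongrightarrow> ?U"
    unfolding H_def G_def
    by (intro tendsto_add tendsto_diff tendsto_const tendsto_sum void_const_tendsto void_except_tendsto kK c_nonneg)
  have "?U < integral {0..1 / exp 1} (\<lambda>c. limit_density k c * exp (- cycle_total \<mu> m c)) + \<eta>"
  proof -
    \<comment> \<open>At threshold 0 all rates vanish, so the term for failure of voidness at the
      start drops out in the limit.\<close>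
    have "H (c 0) * G (c 0) = 1" using m k by (simp add: c0 H_def G_def cycle_rate_0 sum.neutral)
    moreover have "(\<Sum>i<R. H (c i) * G (c i) - H (c i) * G (c (Suc i))) \<le>
      integral {0..b} (\<lambda>c. limit_density k c * exp (- (\<Sum>j=m..K. cycle_rate \<mu> j c))) + ?D / real R"
    proof -
      have "(\<Sum>i<R. H (c i) * G (c i) - H (c i) * G (c (Suc i))) =
          (\<Sum>i<R. H (real i * b / real R) * G (real i * b / real R) - H (real i * b / real R) * G (real (Suc i) * b / real R))"
        by (intro sum.cong) (auto simp: c_def)
      then show ?thesis
        using partition_sum_bounds(1)[OF k K(1) R(1)] unfolding H_def G_def b_def by simp
    qed
    moreover have "integral {0..b} (\<lambda>c. limit_density k c * exp (- (\<Sum>j=m..K. cycle_rate \<mu> j c))) \<le>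
        integral {0..b} (\<lambda>c. limit_density k c * exp (- cycle_total \<mu> m c)) + cycle_tail \<mu> K * ?D"
      using truncated_integral_bounds(2)[OF k K(1)] by (simp add: b_def)
    moreover have "H (c R) * G (c R) - H (c R) * G (c (Suc R)) < \<delta>"
    proof -
      have "G b - G b' \<le> ?r b' - ?r b" unfolding G_def
        using b'(1) pos by (intro exp_minus_diff_le cycle_rate_nonneg cycle_rate_mono) auto
      moreover have "0 \<le> G b - G b'" unfolding G_def
        using b'(1) pos by (auto intro!: cycle_rate_mono)
      moreover have "0 \<le> H b" "H b \<le> 1" unfolding H_def
        using pos by (auto intro!: sum_nonneg cycle_rate_nonneg)
      ultimately have "H b * (G b - G b') \<le> 1 * (?r b' - ?r b)" by (intro mult_mono) auto
      then show ?thesis using b'(2) by (simp add: cR cS right_diff_distrib)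
    qed
    moreover have "H (c (Suc R)) * G (c (Suc R)) < \<delta>"
    proof -
      have "(\<Sum>j=m..K. cycle_rate \<mu> j b') = ?r b' + (\<Sum>j\<in>{m..K} - {k}. cycle_rate \<mu> j b')"
        using kK by (intro sum.remove) auto
      then have "exp (- (\<Sum>j=m..K. cycle_rate \<mu> j b')) = G b' * H b'"
        by (simp only: H_def G_def minus_add_distrib exp_add)
      then show ?thesis using K(3) by (simp add: cS mult.commute)
    qed
    moreover have "5 * \<delta> = \<eta>" by (simp add: \<delta>_def)
    ultimately show ?thesis using K(2) R(2) pos(1) unfolding b_def sum.lessThan_Suc by linarith
  qed
  then have "\<forall>\<^sub>F n in sequentially. ?u n < integral {0..1 / exp 1} (\<lambda>c. limit_density k c * exp (- cycle_total \<mu> m c)) + \<eta>"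
    by (rule order_tendstoD(2)[OF lim])
  then show ?thesis
  proof eventually_elim
    case (elim n)
    then show ?case using min_event_upper[of c k K n "Suc R", OF c_mono K(1)] by linarith
  qed
qed

text \<open>Two errors are to be met, the mesh and the long cycles. Truncating the exponent costs
  nothing in this direction, because a smaller exponent only enlarges the integral.\<close>

lemma eventually_cheap_min_event_greater:
  assumes k: "m \<le> k" and \<eta>: "0 < \<eta>"
  shows "\<forall>\<^sub>F n in sequentially. integral {0..1 / exp 1} (\<lambda>c. limit_density k c * exp (- cycle_total \<mu> m c)) - \<eta>
    < measure (M n) (cheap_min_event k n)"
proof -
  define b :: real where "b = 1 / exp 1"
  define \<delta> where "\<delta> = \<eta> / 2"
  let ?D = "limit_density k b * b"
  have pos: "0 < \<delta>" "0 < b" using \<eta> by (simp_all add: \<delta>_def b_def)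
  obtain K where K: "k \<le> K" "cycle_tail \<mu> K < \<delta>"
  proof -
    have "\<forall>\<^sub>F K in sequentially. cycle_tail \<mu> K < \<delta>"
      using cycle_tail_tendsto_0[OF \<mu>] pos(1) by (rule order_tendstoD)
    from eventually_conj[OF this eventually_ge_at_top[of k]]
    show thesis using that by (auto simp: eventually_at_top_linorder)
  qed
  obtain R where R: "0 < R" "?D / real R < \<delta>"
  proof -
    obtain R where "?D / \<delta> < real R" using reals_Archimedean2 by blast
    moreover have "0 \<le> ?D" using limit_density_bounds[of b b k] pos by simp
    then have "0 \<le> ?D / \<delta>" using pos by simp
    ultimately have "0 < real R" "?D < real R * \<delta>" using pos(1) by (linarith, simp add: divide_less_eq)
    then show thesis by (intro that[of R]) (auto simp: divide_less_eq mult.commute)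
  qed
  define c where "c i = real i * b / real R" for i
  have cR: "c R = b" using R by (auto simp: c_def)
  have c_mono: "c i \<le> c (Suc i)" for i unfolding c_def using pos by (intro divide_right_mono mult_right_mono) auto
  have c_nonneg: "0 \<le> c i" for i using pos by (auto simp: c_def)
  have kK: "k \<in> {m..K}" using k K by simp
  define H where "H = (\<lambda>c. exp (- (\<Sum>j\<in>{m..K} - {k}. cycle_rate \<mu> j c)))"
  define G where "G = (\<lambda>c. exp (- cycle_rate \<mu> k c))"
  let ?u = "\<lambda>n. \<Sum>i<R. measure (M n) (void (\<lambda>j. if j = k then c i else c (Suc i)) K n) - measure (M n) (void (\<lambda>_. c (Suc i)) K n)"
  let ?U = "\<Sum>i<R. H (c (Suc i)) * G (c i) - H (c (Suc i)) * G (c (Suc i))"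
  have lim: "?u \<longlonglongrightarrow> ?U"
    unfolding H_def G_def
    by (intro tendsto_diff tendsto_sum void_const_tendsto void_except_tendsto kK c_nonneg)
  have "integral {0..b} (\<lambda>c. limit_density k c * exp (- (\<Sum>j=m..K. cycle_rate \<mu> j c))) - ?D / real R \<le> ?U"
    using partition_sum_bounds(2)[OF k K(1) R(1)] unfolding H_def G_def b_def c_def .
  moreover have "integral {0..b} (\<lambda>c. limit_density k c * exp (- cycle_total \<mu> m c)) \<le>
      integral {0..b} (\<lambda>c. limit_density k c * exp (- (\<Sum>j=m..K. cycle_rate \<mu> j c)))"
    using truncated_integral_bounds(1)[OF k K(1)] by (simp add: b_def)
  ultimately have "integral {0..b} (\<lambda>c. limit_density k c * exp (- cycle_total \<mu> m c)) - \<delta> < ?U"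
    using R(2) by linarith
  from order_tendstoD(1)[OF lim this] eventually_gt_at_top[of 0]
  show ?thesis
  proof eventually_elim
    case (elim n)
    have "?u n \<le> measure (M n) (cheap_min_event k n) + cycle_tail \<mu> K"
      by (rule cheap_min_event_lower[of c R k K n, OF c_mono _ k K(1) elim(2)]) (simp add: cR b_def)
    then show ?case using elim K(2) by (simp add: b_def \<delta>_def)
  qed
qed

text \<open>The event with the weight restriction lies inside the other, so the upper bound for the
  larger event and the lower bound for the smaller one squeeze both.\<close>

theorem min_event_limits:
  assumes k: "m \<le> k"
  defines "L \<equiv> integral {0..1 / exp 1} (\<lambda>c. limit_density k c * exp (- cycle_total \<mu> m c))"
  shows "(\<lambda>n. measure (M n) (min_event k n)) \<longlonglongrightarrow> L" "(\<lambda>n. measure (M n) (cheap_min_event k n)) \<longlonglongrightarrow> L"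
proof -
  have le: "measure (M n) (cheap_min_event k n) \<le> measure (M n) (min_event k n)" for n
    by (intro iid.finite_measure_mono cheap_min_event_subset) simp
  have up: "\<forall>\<^sub>F n in sequentially. measure (M n) (min_event k n) < a" if "L < a" for a
    using eventually_min_event_less[OF k, of "a - L"] that by (simp add: L_def)
  have lo: "\<forall>\<^sub>F n in sequentially. a < measure (M n) (cheap_min_event k n)" if "a < L" for a
    using eventually_cheap_min_event_greater[OF k, of "L - a"] that by (simp add: L_def)
  show "(\<lambda>n. measure (M n) (min_event k n)) \<longlonglongrightarrow> L"
  proof (rule order_tendstoI)
    show "\<forall>\<^sub>F n in sequentially. a < measure (M n) (min_event k n)" if "a < L" for a
      using lo[OF that] by eventually_elim (use le in \<open>auto intro: less_le_trans\<close>)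
  qed (rule up)
  show "(\<lambda>n. measure (M n) (cheap_min_event k n)) \<longlonglongrightarrow> L"
  proof (rule order_tendstoI[OF lo])
    show "\<forall>\<^sub>F n in sequentially. measure (M n) (cheap_min_event k n) < a" if "L < a" for a
      using up[OF that] by eventually_elim (use le in \<open>auto intro: le_less_trans\<close>)
  qed
qed

end

section \<open>Application to the directed and undirected complete graphs\<close>

lemma iid_exponential_family_iff:
  "iid_exponential M E W \<and> finite E \<longleftrightarrow> iid_exponential_family M E W"
  by (auto simp: iid_exponential_def iid_exponential_family_def iid_exponential_family_axioms_def)

lemma (in edge_kind) cycle_model_Kn:
  assumes "\<And>n. iid_exponential (M n) (ed ` parcs (Kn n)) (W n)"
  shows "cycle_model (\<lambda>n. ed ` parcs (Kn n)) (cycles_in ed m) m \<mu> M W"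
proof (rule cycle_model.intro)
  fix n
  have "parcs (Kn n) \<subseteq> {..<n} \<times> {..<n}" by (auto simp: Kn_def)
  then have "finite (parcs (Kn n))" by (rule finite_subset) simp
  then show "iid_exponential_family (M n) (ed ` parcs (Kn n)) (W n)"
    using assms by (simp add: iid_exponential_family_iff[symmetric])
qed (use cycles_in_subset card_cycles_in_ge m orientations_pos card_cycles_le card_cycles_ge overlapping_pairs_bound in auto)

theorem theorem5p2:
  fixes k :: nat
    and M :: "nat \<Rightarrow> 'a measure" and W :: "nat \<Rightarrow> nat \<times> nat \<Rightarrow> 'a \<Rightarrow> real"
    and N :: "nat \<Rightarrow> 'b measure" and X :: "nat \<Rightarrow> nat set \<Rightarrow> 'b \<Rightarrow> real"
  shows
    "(2 \<le> k \<and> (\<forall>n. iid_exponential (M n) (parcs (Kn n)) (W n)) \<longrightarrow>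
       (let L = integral {0..1 / exp 1}
                  (\<lambda>c. c ^ (k - 1) * real k ^ k / fact k * exp (- tree_function c + c))
        in ((\<lambda>n. measure (M n) {\<omega> \<in> space (M n).
                \<exists>C. is_min_mean_cycle (\<lambda>e. W n e \<omega>) (directed_cycles n) C \<and> card C = k})
              \<longlonglongrightarrow> L) \<and>
           ((\<lambda>n. measure (M n) {\<omega> \<in> space (M n).
                \<exists>C. is_min_mean_cycle (\<lambda>e. W n e \<omega>) (directed_cycles n) C \<and> card C = k \<and>
                    weight (\<lambda>e. W n e \<omega>) C \<le> real k / (exp 1 * real n)})
              \<longlonglongrightarrow> L)))
     \<and>
     (3 \<le> k \<and> (\<forall>n. iid_exponential (N n) (Kn_edges n) (X n)) \<longrightarrow>
       (let L = integral {0..1 / exp 1}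
                  (\<lambda>c. c ^ (k - 1) * real k ^ k / (2 * fact k) *
                       exp ((- tree_function c + c + c\<^sup>2) / 2))
        in ((\<lambda>n. measure (N n) {\<omega> \<in> space (N n).
                \<exists>C. is_min_mean_cycle (\<lambda>e. X n e \<omega>) (undirected_cycles n) C \<and> card C = k})
              \<longlonglongrightarrow> L) \<and>
           ((\<lambda>n. measure (N n) {\<omega> \<in> space (N n).
                \<exists>C. is_min_mean_cycle (\<lambda>e. X n e \<omega>) (undirected_cycles n) C \<and> card C = k \<and>
                    weight (\<lambda>e. X n e \<omega>) C \<le> real k / (exp 1 * real n)})
              \<longlonglongrightarrow> L)))"
proof (intro conjI impI)
  assume asm: "2 \<le> k \<and> (\<forall>n. iid_exponential (M n) (parcs (Kn n)) (W n))"
  interpret dir: cycle_model "\<lambda>n. parcs (Kn n)" directed_cycles 2 1 M W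
    using directed.cycle_model_Kn[of M W] asm unfolding directed_cycles_eq[abs_def] by (simp del: One_nat_def)
  \<comment> \<open>The closed form of \<open>cycle_total\<close> in terms of the tree function is
    available on [0, 1/e], which is the interval of integration.\<close>
  have "integral {0..1 / exp 1} (\<lambda>c. dir.limit_density k c * exp (- cycle_total 1 2 c)) =
      integral {0..1 / exp 1} (\<lambda>c. c ^ (k - 1) * real k ^ k / fact k * exp (- tree_function c + c))"
    by (intro Henstock_Kurzweil_Integration.integral_cong) (simp add: dir.limit_density_def cycle_total_directed del: One_nat_def)
  with dir.min_event_limits[of k] asm
  show "let L = integral {0..1 / exp 1}
                  (\<lambda>c. c ^ (k - 1) * real k ^ k / fact k * exp (- tree_function c + c))
        in ((\<lambda>n. measure (M n) {\<omega> \<in> space (M n).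
                \<exists>C. is_min_mean_cycle (\<lambda>e. W n e \<omega>) (directed_cycles n) C \<and> card C = k})
              \<longlonglongrightarrow> L) \<and>
           ((\<lambda>n. measure (M n) {\<omega> \<in> space (M n).
                \<exists>C. is_min_mean_cycle (\<lambda>e. W n e \<omega>) (directed_cycles n) C \<and> card C = k \<and>
                    weight (\<lambda>e. W n e \<omega>) C \<le> real k / (exp 1 * real n)})
              \<longlonglongrightarrow> L)"
    unfolding Let_def dir.min_event_def dir.cheap_min_event_def by simp
next
  assume asm: "3 \<le> k \<and> (\<forall>n. iid_exponential (N n) (Kn_edges n) (X n))"
  interpret undir: cycle_model Kn_edges undirected_cycles 3 2 N X
    using undirected.cycle_model_Kn[of N X] asm unfolding undirected_cycles_eq[abs_def] uedge_arcs_Kn by simp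
  have "integral {0..1 / exp 1} (\<lambda>c. undir.limit_density k c * exp (- cycle_total 2 3 c)) =
      integral {0..1 / exp 1} (\<lambda>c. c ^ (k - 1) * real k ^ k / (2 * fact k) * exp ((- tree_function c + c + c\<^sup>2) / 2))"
  proof (rule Henstock_Kurzweil_Integration.integral_cong)
    fix c :: real assume "c \<in> {0..1 / exp 1}"
    then have "- cycle_total 2 3 c = (- tree_function c + c + c\<^sup>2) / 2"
      by (simp add: cycle_total_undirected field_simps)
    then show "undir.limit_density k c * exp (- cycle_total 2 3 c) =
        c ^ (k - 1) * real k ^ k / (2 * fact k) * exp ((- tree_function c + c + c\<^sup>2) / 2)"
      by (simp add: undir.limit_density_def)
  qed
  with undir.min_event_limits[of k] asm
  show "let L = integral {0..1 / exp 1}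
                  (\<lambda>c. c ^ (k - 1) * real k ^ k / (2 * fact k) *
                       exp ((- tree_function c + c + c\<^sup>2) / 2))
        in ((\<lambda>n. measure (N n) {\<omega> \<in> space (N n).
                \<exists>C. is_min_mean_cycle (\<lambda>e. X n e \<omega>) (undirected_cycles n) C \<and> card C = k})
              \<longlonglongrightarrow> L) \<and>
           ((\<lambda>n. measure (N n) {\<omega> \<in> space (N n).
                \<exists>C. is_min_mean_cycle (\<lambda>e. X n e \<omega>) (undirected_cycles n) C \<and> card C = k \<and>
                    weight (\<lambda>e. X n e \<omega>) C \<le> real k / (exp 1 * real n)})
              \<longlonglongrightarrow> L)"
    unfolding Let_def undir.min_event_def undir.cheap_min_event_def by simp
qed

end
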